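(* Let $m\ge2$ be an integer and let $G_{S_0}$ be the Cayley graph of the lamplighter group $\mathbb{Z}_m\wr\mathbb{Z}$ with respect to the generating set $$S_0=\{(l\cdot\delta_1,1): l\in\mathbb{Z}_m\}\cup\{(l\cdot\delta_0,-1): l\in\mathbb{Z}_m\}.$$ Consider independent site or independent bond percolation on $G_{S_0}$ with parameter $p$. Then for every $0<p<1$ there are positive constants $c_1,c_2$ such that $$e^{-c_1e^{c_2E^{-1/2}}}\le N^D(E)\le N^A(E)\quad\text{for all }E>0\text{ small enough}.$$
   Context: $\mathbb{Z}_m\wr\mathbb{Z}$ is the set of pairs $(\varphi,x)$ with $\varphi:\mathbb{Z}\to\mathbb{Z}_m$ finitely supported and $x\in\mathbb{Z}$, with product $(\varphi_1,x_1)(\varphi_2,x_2)=(\varphi_1+\varphi_2(\cdot-x_1),x_1+x_2)$; $l\cdot\delta_z$ denotes the function with value $l$ at $z$ and $0$ elsewhere. Let $k=|S_0|$ and $\iota$ be the identity. Site percolation: vertices open independently with probability $p$, $G(\omega)$ the induced subgraph on open vertices; bond percolation: edges open independently with probability $p$, $G(\omega)$ consisting of open edges and their endpoints. For a subgraph $G'=(V',E')$ with degrees $d_{G'}(x)$: $(D(G')\varphi)(x)=d_{G'}(x)\varphi(x)$, $(A(G')\varphi)(x)=\sum_{y\in V',y\sim_{G'}x}\varphi(y)$, $\Delta^A(G')=k\,\mathrm{Id}-A(G')$, $\Delta^D(G')=2k\,\mathrm{Id}-D(G')-A(G')$. $\Delta^{\#}_\omega=\Delta^{\#}(G(\omega))$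 on $\ell^2(V(\omega))$, and $N^{\#}(E)=\mathbb{E}\{\langle\chi_{(-\infty,E]}(\Delta^{\#}_\omega)\delta_\iota,\delta_\iota\rangle\}$ with the inner product taken as $0$ if $\iota\notin V(\omega)$. *)

theory Defs
  imports "HOL-Probability.Probability"
begin

text \<open>Elements of the lamplighter group Z_m wr Z: pairs (phi, x), phi : int => int with
values in {0..<m} (representatives of Z_m) and finite support.\<close>
type_synonym lamp = "(int \<Rightarrow> int) \<times> int"

definition lamp_verts :: "nat \<Rightarrow> lamp set" where
  "lamp_verts m = {(\<phi>, x). (\<forall>z. \<phi> z \<in> {0..<int m}) \<and> finite {z. \<phi> z \<noteq> 0}}"

definition lamp_mult :: "nat \<Rightarrow> lamp \<Rightarrow> lamp \<Rightarrow> lamp" where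
  "lamp_mult m g h = ((\<lambda>z. (fst g z + fst h (z - snd g)) mod int m), snd g + snd h)"

definition lamp_id :: lamp where
  "lamp_id = ((\<lambda>_. 0), 0)"

definition S0 :: "nat \<Rightarrow> lamp set" where
  "S0 m = {((\<lambda>z. if z = 1 then l else 0), 1) | l. l \<in> {0..<int m}}
        \<union> {((\<lambda>z. if z = 0 then l else 0), -1) | l. l \<in> {0..<int m}}"

definition kdeg :: "nat \<Rightarrow> real" where
  "kdeg m = real (card (S0 m))"

definition cay_edges :: "nat \<Rightarrow> lamp set set" where
  "cay_edges m = {{g, lamp_mult m g s} | g s. g \<in> lamp_verts m \<and> s \<in> S0 m}"

definition adjop :: "lamp set \<Rightarrow> lamp set set \<Rightarrow> (lamp \<Rightarrow> real) \<Rightarrow> lamp \<Rightarrow> real" where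
  "adjop V E f x = (if x \<in> V then (\<Sum>y\<in>{y \<in> V. {x, y} \<in> E}. f y) else 0)"

definition degop :: "lamp set \<Rightarrow> lamp set set \<Rightarrow> (lamp \<Rightarrow> real) \<Rightarrow> lamp \<Rightarrow> real" where
  "degop V E f x = (if x \<in> V then real (card {y \<in> V. {x, y} \<in> E}) * f x else 0)"

definition lapA :: "nat \<Rightarrow> lamp set \<Rightarrow> lamp set set \<Rightarrow> (lamp \<Rightarrow> real) \<Rightarrow> lamp \<Rightarrow> real" where
  "lapA m V E f x = (if x \<in> V then kdeg m * f x - adjop V E f x else 0)"

definition lapD :: "nat \<Rightarrow> lamp set \<Rightarrow> lamp set set \<Rightarrow> (lamp \<Rightarrow> real) \<Rightarrow> lamp \<Rightarrow> real" where
  "lapD m V E f x = (if x \<in> V then 2 * kdeg m * f x - degop V E f x - adjop V E f x else 0)"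

text \<open>Spectral measure of the (bounded self-adjoint) operator T at the vector delta_v:
the unique compactly supported finite Borel measure on the reals whose moments are
the matrix elements of the powers of T, i.e. mu(B) = <chi_B(T) delta_v, delta_v>.\<close>
definition spec_measure :: "((lamp \<Rightarrow> real) \<Rightarrow> (lamp \<Rightarrow> real)) \<Rightarrow> lamp \<Rightarrow> real measure" where
  "spec_measure T v = (THE \<mu>. sets \<mu> = sets borel \<and> finite_measure \<mu> \<and>
      (\<exists>R. emeasure \<mu> (- {-R..R}) = 0) \<and>
      (\<forall>n::nat. (\<integral>x. x ^ n \<partial>\<mu>) = (T ^^ n) (indicator {v}) v))"

definition site_graph :: "nat \<Rightarrow> (lamp \<Rightarrow> bool) \<Rightarrow> lamp set \<times> lamp set set" where
  "site_graph m \<omega> = ({x \<in> lamp_verts m. \<omega> x}, {e \<in> cay_edges m. \<forall>x\<in>e. \<omega> x})"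

definition bond_graph :: "nat \<Rightarrow> (lamp set \<Rightarrow> bool) \<Rightarrow> lamp set \<times> lamp set set" where
  "bond_graph m \<omega> = (\<Union>{e \<in> cay_edges m. \<omega> e}, {e \<in> cay_edges m. \<omega> e})"

definition site_meas :: "nat \<Rightarrow> real \<Rightarrow> (lamp \<Rightarrow> bool) measure" where
  "site_meas m p = PiM (lamp_verts m) (\<lambda>_. measure_pmf (bernoulli_pmf p))"

definition bond_meas :: "nat \<Rightarrow> real \<Rightarrow> (lamp set \<Rightarrow> bool) measure" where
  "bond_meas m p = PiM (cay_edges m) (\<lambda>_. measure_pmf (bernoulli_pmf p))"

text \<open>Integrated density of states N(E) = E[<chi_(-inf,E](Delta_omega) delta_iota, delta_iota>],
the inner product being 0 if iota is not a vertex of G(omega).\<close>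
definition spec_at_id ::
  "(nat \<Rightarrow> lamp set \<Rightarrow> lamp set set \<Rightarrow> (lamp \<Rightarrow> real) \<Rightarrow> lamp \<Rightarrow> real) \<Rightarrow> nat
   \<Rightarrow> lamp set \<times> lamp set set \<Rightarrow> real \<Rightarrow> real" where
  "spec_at_id L m G E = (if lamp_id \<in> fst G
      then measure (spec_measure (L m (fst G) (snd G)) lamp_id) {..E} else 0)"

definition dos_site ::
  "(nat \<Rightarrow> lamp set \<Rightarrow> lamp set set \<Rightarrow> (lamp \<Rightarrow> real) \<Rightarrow> lamp \<Rightarrow> real) \<Rightarrow> nat \<Rightarrow> real \<Rightarrow> real \<Rightarrow> real" where
  "dos_site L m p E = (\<integral>\<omega>. spec_at_id L m (site_graph m \<omega>) E \<partial>site_meas m p)"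

definition dos_bond ::
  "(nat \<Rightarrow> lamp set \<Rightarrow> lamp set set \<Rightarrow> (lamp \<Rightarrow> real) \<Rightarrow> lamp \<Rightarrow> real) \<Rightarrow> nat \<Rightarrow> real \<Rightarrow> real \<Rightarrow> real" where
  "dos_bond L m p E = (\<integral>\<omega>. spec_at_id L m (bond_graph m \<omega>) E \<partial>bond_meas m p)"

end

theory Submission
  imports Defs "HOL-Real_Asymp.Real_Asymp" "HOL-Algebra.Group"
begin

text \<open>
  For \<open>N\<^sup>D \<le> N\<^sup>A\<close>, the operators \<open>T\<^sub>t = k - A + t (k - D)\<close> interpolate between \<open>\<Delta>\<^sup>A\<close> and \<open>\<Delta>\<^sup>D\<close>, and
  \<open>T \<mapsto> \<tau>(T) = E\<langle>T \<delta>\<^sub>\<iota>, \<delta>\<^sub>\<iota>\<rangle>\<close> is a trace by translation invariance. Hence for a polynomial \<open>q\<close> the derivative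
  of \<open>\<tau>(q(T\<^sub>t))\<close> is \<open>\<tau>((k - D) q'(T\<^sub>t))\<close>, which is nonpositive when \<open>q\<close> decreases on the spectrum.
  The indicator of \<open>{..E}\<close> is a bounded pointwise limit of such polynomials, and the inequality passes to the limit.

  For the lower bound, the configurations \<open>(\<phi>, x)\<close> with \<open>\<bar>x\<bar> \<le> r\<close> and lamps lit only in \<open>{-r+1..r}\<close> span a finite
  subgraph with \<open>(2r+1) m\<^sup>2\<^sup>r\<close> vertices, in which every vertex at an interior level keeps its full degree.
  If it is isolated, \<open>cos (\<pi> x / (2r+1))\<close> is an eigenfunction of \<open>\<Delta>\<^sup>D\<close> with eigenvalue of order \<open>r\<^sup>-\<^sup>2\<close>.
  Isolation has probability exponentially small in the number of vertices.
\<close>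

section \<open>The Hausdorff moment problem\<close>

text \<open>\<open>spec_measure\<close> is a definite description by moments, so nothing can be said
  about it before existence and uniqueness are settled. Both rest on quadratic forms of finitely
  supported functions alone: positivity of \<open>S^k (1 - S)^l\<close> for
  \<open>0 \<le> S \<le> 1\<close> is what the Hausdorff moment problem asks for, and one explicit
  family of polynomials recovers the distribution function from the moments.

  The comparison needs a trace because \<open>\<Delta>\<^sup>A \<le> \<Delta>\<^sup>D\<close> as
  forms does not in general order the diagonal entries of the spectral projections at a fixed
  vector: \<open>A\<close> and \<open>D\<close> need not commute. Under the trace the diagonal
  factor moves cyclically to the front, where it acts at \<open>\<iota>\<close> as a nonnegative
  scalar. What remains is the sign of one diagonal entry of \<open>q'(T_t)\<close>, which calls for
  a spectral interval common to all \<open>t\<close>.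

  In the lower bound the spectral mass that an isolated box contributes is at least the reciprocal
  of its number of vertices. This is negligible against the cost of isolation, so only the growth of
  the box with the energy matters.\<close>

locale completely_monotone =
  fixes w :: "nat \<Rightarrow> nat \<Rightarrow> real"
  assumes nonneg: "0 \<le> w k l"
    and step: "w k l = w (Suc k) l + w k (Suc l)"
begin

text \<open>With \<open>w k l\<close> read as the integral of \<open>x^k (1 - x)^l\<close> this is
  \<open>(x + (1 - x))^n = 1\<close> multiplied by \<open>x^j\<close>. No measure is available yet,
  so Pascal's rule is played against \<open>step\<close> instead.\<close>

lemma binomial_sum: "(\<Sum>k\<le>n. real (n choose k) * w (j + k) (n - k)) = w j 0"
proof (induction n arbitrary: j)
  case 0
  then show ?case by simp
next
  case (Suc n)
  have "(\<Sum>k\<le>Suc n. real (Suc n choose k) * w (j + k) (Suc n - k))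
      = w j (Suc n) + (\<Sum>k\<le>n. real (Suc n choose Suc k) * w (Suc j + k) (n - k))"
    by (subst sum.atMost_Suc_shift) simp
  also have "\<dots> = w j (Suc n) + (\<Sum>k\<le>n. real (n choose Suc k) * w (Suc j + k) (n - k))
      + (\<Sum>k\<le>n. real (n choose k) * w (Suc j + k) (n - k))"
    by (simp add: sum.distrib[symmetric] algebra_simps)
  also have "w j (Suc n) + (\<Sum>k\<le>n. real (n choose Suc k) * w (Suc j + k) (n - k))
      = (\<Sum>k\<le>Suc n. real (n choose k) * w (j + k) (Suc n - k))"
    by (subst sum.atMost_Suc_shift[of _ n]) simp
  also have "\<dots> = (\<Sum>k\<le>n. real (n choose k) * w (j + k) (Suc (n - k)))"
    by (simp add: Suc_diff_le)
  also have "\<dots> + (\<Sum>k\<le>n. real (n choose k) * w (Suc j + k) (n - k))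
      = (\<Sum>k\<le>n. real (n choose k) * w (j + k) (n - k))"
    by (simp add: sum.distrib[symmetric] step[of "_ + _" "_ - _"] algebra_simps)
  finally show ?case using Suc by simp
qed

text \<open>The measure with mass \<open>(n choose k) * w k (n - k)\<close> at \<open>k / n\<close>
  has the exact \<open>j\<close>-th moment once \<open>(k / n)^j\<close> is replaced by the ratio of
  binomials. Absorption turns the sum into \<open>binomial_sum\<close> shifted by
  \<open>j\<close>.\<close>

lemma fall_sum:
  assumes "j \<le> n"
  shows "(\<Sum>k\<le>n. real (n choose k) * w k (n - k) * (real (k choose j) / real (n choose j))) = w j 0"
proof -
  have nz: "real (n choose j) \<noteq> 0" using assms by simp
  have "(\<Sum>k\<le>n. real (n choose k) * w k (n - k) * (real (k choose j) / real (n choose j)))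
     = (\<Sum>k\<in>{j..n}. real (n choose k) * w k (n - k) * (real (k choose j) / real (n choose j)))"
    by (rule sum.mono_neutral_right) auto
  also have "\<dots> = (\<Sum>k\<in>{j..n}. real ((n - j) choose (k - j)) * w k (n - k))"
  proof (rule sum.cong)
    fix k assume k: "k \<in> {j..n}"
    have "(n choose k) * (k choose j) = (n choose j) * ((n - j) choose (k - j))"
      using k choose_mult[of j k n] by auto
    hence "real (n choose k) * real (k choose j) = real (n choose j) * real ((n - j) choose (k - j))"
      by (metis of_nat_mult)
    then show "real (n choose k) * w k (n - k) * (real (k choose j) / real (n choose j))
        = real ((n - j) choose (k - j)) * w k (n - k)"
      using nz by (simp add: field_simps)
  qed simp
  also have "\<dots> = (\<Sum>k\<le>n - j. real ((n - j) choose k) * w (j + k) (n - j - k))"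
    by (rule sum.reindex_bij_witness[of _ "\<lambda>k. k + j" "\<lambda>k. k - j"]) (use assms in auto)
  also have "\<dots> = w j 0" by (rule binomial_sum)
  finally show ?thesis .
qed

lemma bounded: "w k l \<le> w 0 0"
proof -
  have "w k l \<le> w k 0" for l
  proof (induction l)
    case (Suc l)
    then show ?case using step[of k l] nonneg[of "Suc k" l] by linarith
  qed simp
  moreover have "w k 0 \<le> w 0 0"
  proof (induction k)
    case (Suc k)
    then show ?case using step[of k 0] nonneg[of k "Suc 0"] by linarith
  qed simp
  ultimately show ?thesis by (meson order_trans)
qed

end

text \<open>The ratio of binomials is a product of \<open>j\<close> factors in \<open>[0,1]\<close>,
  so the difference of the two products is at most the sum of the differences of their factors, each
  at most \<open>j / (n - j)\<close>.\<close>

lemma falling_ratio_bound: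
  assumes "k \<le> n" "j < n"
  shows "\<bar>(real k / real n) ^ j - real (k choose j) / real (n choose j)\<bar> \<le> real (j * j) / real (n - j)"
proof -
  have prod: "real (k choose j) / real (n choose j) = (\<Prod>i<j. real (k - i) / real (n - i))" if "j \<le> n" for j
    using that
  proof (induction j)
    case (Suc j)
    have nz: "real (n choose j) \<noteq> 0" "real (n choose Suc j) \<noteq> 0" "real (n - j) \<noteq> 0"
      using Suc.prems by (auto simp: binomial_eq_0_iff)
    have a: "real (Suc j) * real (k choose Suc j) = real (k - j) * real (k choose j)" for k
      using binomial_absorb_comp[of k j] Suc_times_binomial_eq[of "k - 1" j]
      by (metis binomial_absorption binomial_absorb_comp diff_Suc_1 of_nat_mult)
    have "real (k choose Suc j) / real (n choose Suc j)
        = (real (Suc j) * real (k choose Suc j)) / (real (Suc j) * real (n choose Suc j))"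
      by simp
    also have "\<dots> = (real (k choose j) / real (n choose j)) * (real (k - j) / real (n - j))"
      unfolding a by (simp add: mult.commute)
    finally show ?case using Suc by simp
  qed simp
  have t: "\<bar>real k / real n - real (k - i) / real (n - i)\<bar> \<le> real j / real (n - j)" if "i < j" for i
  proof (cases "k \<le> i")
    case True
    have "real k / real n \<le> real j / real (n - j)"
      by (rule frac_le) (use True that assms in auto)
    thus ?thesis using True by simp
  next
    case False
    have n: "real (n - i) = real n - real i" "real (k - i) = real k - real i"
        "real (n - j) = real n - real j"
      using False that assms by (auto simp: of_nat_diff)
    have "real k / real n - real (k - i) / real (n - i)
        = (real i * ((real n - real k) / real n)) / (real n - real i)"
      unfolding n using that assms by (simp add: field_simps)
    moreover have "\<dots> \<ge> 0" using that assms by (intro divide_nonneg_pos mult_nonneg_nonneg) auto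
    moreover have "(real i * ((real n - real k) / real n)) / (real n - real i)
        \<le> real j / (real n - real j)"
    proof (rule frac_le)
      have "real i * ((real n - real k) / real n) \<le> real j * 1"
        by (rule mult_mono) (use that assms in auto)
      thus "real i * ((real n - real k) / real n) \<le> real j" by simp
    qed (use that assms in auto)
    ultimately show ?thesis unfolding n by linarith
  qed
  have "\<bar>(\<Prod>i<j. real k / real n) - (\<Prod>i<j. real (k - i) / real (n - i))\<bar>
      \<le> (\<Sum>i<j. \<bar>real k / real n - real (k - i) / real (n - i)\<bar>)"
    using norm_prod_diff[of "{..<j}" "\<lambda>_. real k / real n" "\<lambda>i. real (k - i) / real (n - i)"] assms
    by (simp add: divide_simps) 
  also have "\<dots> \<le> (\<Sum>i<j. real j / real (n - j))" by (rule sum_mono) (use t in auto)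
  also have "\<dots> = real (j * j) / real (n - j)" by simp
  finally show ?thesis using prod[of j] assms by simp
qed

text \<open>Bernstein's discretization: the masses in \<open>fall_sum\<close> form probability
  measures on \<open>[0,1]\<close>, hence a tight sequence, and a weak limit has the prescribed
  moments because the error of passing from binomial ratios to powers vanishes.\<close>

theorem (in completely_monotone) Hausdorff_moment:
  assumes one: "w 0 0 = 1"
  obtains \<mu> where "real_distribution \<mu>" "AE x in \<mu>. x \<in> {0..1}" "\<And>j. (\<integral>x. x ^ j \<partial>\<mu>) = w j 0"
proof -
  define g where "g n k = (if k \<le> n then real (n choose k) * w k (n - k) else 0)" for n k
  define P where "P n = embed_pmf (g n)" for n
  have g0: "0 \<le> g n k" for n k unfolding g_def using nonneg by simp
  have "(\<integral>\<^sup>+k. ennreal (g n k) \<partial>count_space UNIV) = 1" for n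
  proof -
    have "(\<integral>\<^sup>+k. ennreal (g n k) \<partial>count_space UNIV) = (\<Sum>k\<le>n. ennreal (g n k))"
      by (rule nn_integral_count_space') (auto simp: g_def)
    also have "\<dots> = ennreal (\<Sum>k\<le>n. g n k)" using g0 by (simp add: sum_ennreal)
    also have "(\<Sum>k\<le>n. g n k) = 1" using binomial_sum[of n 0] one by (simp add: g_def)
    finally show ?thesis by simp
  qed
  hence pmfP: "pmf (P n) k = g n k" for n k unfolding P_def using g0 by (intro pmf_embed_pmf) auto
  define \<mu> where "\<mu> n = distr (measure_pmf (P n)) borel (\<lambda>k. real k / real n)" for n
  have rd: "real_distribution (\<mu> n)" for n
    unfolding \<mu>_def by (intro prob_space.real_distribution_distr measure_pmf.prob_space_axioms) simp
  have int: "(\<integral>x. f x \<partial>\<mu> n) = (\<Sum>k\<le>n. f (real k / real n) * g n k)"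
    if [measurable]: "f \<in> borel_measurable borel" for f :: "real \<Rightarrow> real" and n
  proof -
    have "(\<integral>x. f x \<partial>\<mu> n) = (\<integral>k. f (real k / real n) \<partial>measure_pmf (P n))"
      unfolding \<mu>_def by (rule integral_distr) auto
    also have "\<dots> = (\<Sum>k\<le>n. f (real k / real n) * pmf (P n) k)"
      by (rule integral_measure_pmf_real) (auto simp: set_pmf_iff pmfP g_def split: if_splits)
    finally show ?thesis by (simp add: pmfP)
  qed
  have supp: "AE x in \<mu> n. x \<in> {0..1}" for n
    unfolding \<mu>_def
    by (subst AE_distr_iff) (auto simp: AE_measure_pmf_iff set_pmf_iff pmfP g_def divide_simps split: if_splits)
  have tight: "tight \<mu>"
    unfolding tight_def
  proof (intro conjI allI impI)
    fix e :: real assume e: "e > 0"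
    have "measure (\<mu> n) {-1<..1} = 1" for n
    proof -
      interpret real_distribution "\<mu> n" by (rule rd)
      show ?thesis by (subst prob_eq_1) (use supp[of n] in \<open>auto elim: AE_mp\<close>)
    qed
    thus "\<exists>a b. a < b \<and> (\<forall>n. 1 - e < measure (\<mu> n) {a<..b})"
      using e by (intro exI[of _ "-1"] exI[of _ 1]) auto
  qed (rule rd)
  obtain r M where r: "strict_mono (r :: nat \<Rightarrow> nat)" and M: "real_distribution M"
    and wc: "weak_conv_m (\<mu> \<circ> id \<circ> r) M"
    using tight_imp_convergent_subsubsequence[OF tight strict_mono_id] by blast
  interpret M: real_distribution M by (rule M)
  have conv: "(\<lambda>n. \<integral>x. f x \<partial>\<mu> (r n)) \<longlonglongrightarrow> (\<integral>x. f x \<partial>M)"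
    if "\<And>x. isCont f x" "\<And>x. norm (f x) \<le> B" for f :: "real \<Rightarrow> real" and B
    using weak_conv_imp_integral_bdd_continuous_conv[OF _ M wc that] rd by simp
  \<comment> \<open>Weak convergence tests bounded continuous functions on the whole line. Clamping
    makes the powers bounded without changing them on the support.\<close>
  define cl where "cl x = max 0 (min 1 x)" for x :: real
  have cl: "isCont cl x" "0 \<le> cl x" "cl x \<le> 1" for x
    unfolding cl_def by (auto intro!: continuous_intros)
  have clm[measurable]: "cl \<in> borel_measurable borel" unfolding cl_def by measurable
  have suppM: "AE x in M. x \<in> {0..1}"
  proof -
    \<comment> \<open>The truncated distance to \<open>[0,1]\<close>: it is bounded and continuous
      and vanishes exactly on the interval, so a zero integral confines the limit to it.\<close>
    define f where "f x = min 1 \<bar>x - cl x\<bar>" for x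
    have [measurable]: "f \<in> borel_measurable borel" unfolding f_def by measurable
    have fb: "norm (f x) \<le> 1" "f x \<ge> 0" for x unfolding f_def by auto
    have "(\<lambda>n. \<integral>x. f x \<partial>\<mu> (r n)) \<longlonglongrightarrow> (\<integral>x. f x \<partial>M)"
      by (rule conv[of _ 1]) (auto simp: f_def intro!: continuous_intros cl(1))
    moreover have "(\<integral>x. f x \<partial>\<mu> n) = 0" for n
      unfolding int[OF \<open>f \<in> _\<close>] by (auto simp: f_def cl_def divide_simps)
    ultimately have z: "(\<integral>x. f x \<partial>M) = 0" by (simp add: LIMSEQ_const_iff)
    have "AE x in M. f x = 0"
      by (subst integral_nonneg_eq_0_iff_AE[symmetric])
         (use z fb in \<open>auto intro!: M.integrable_const_bound[of _ 1]\<close>)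
    thus ?thesis by eventually_elim (auto simp: f_def cl_def split: if_splits)
  qed
  have mom: "(\<integral>x. x ^ j \<partial>M) = w j 0" for j
  proof -
    have "(\<lambda>n. \<integral>x. cl x ^ j \<partial>\<mu> (r n)) \<longlonglongrightarrow> (\<integral>x. cl x ^ j \<partial>M)"
      by (rule conv[of _ 1]) (auto intro!: continuous_intros cl simp: power_abs abs_of_nonneg[OF cl(2)] power_le_one[OF cl(2,3)])
    moreover have "(\<lambda>n. \<integral>x. cl x ^ j \<partial>\<mu> (r n)) \<longlonglongrightarrow> w j 0"
    proof -
      have ineq: "\<bar>(\<integral>x. cl x ^ j \<partial>\<mu> n) - w j 0\<bar> \<le> real (j * j) / real (n - j)" if "n > j" for n
      proof -
        have eq: "(\<integral>x. cl x ^ j \<partial>\<mu> n) = (\<Sum>k\<le>n. (real k / real n) ^ j * g n k)"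
          by (subst int) (auto intro!: sum.cong simp: cl_def divide_simps)
        have eq2: "w j 0 = (\<Sum>k\<le>n. (real (k choose j) / real (n choose j)) * g n k)"
          using fall_sum[of j n] that by (simp add: g_def mult_ac)
        have "\<bar>(\<integral>x. cl x ^ j \<partial>\<mu> n) - w j 0\<bar>
           = \<bar>\<Sum>k\<le>n. ((real k / real n) ^ j - real (k choose j) / real (n choose j)) * g n k\<bar>"
          unfolding eq eq2 by (simp add: sum_subtractf algebra_simps)
        also have "\<dots> \<le> (\<Sum>k\<le>n. \<bar>((real k / real n) ^ j - real (k choose j) / real (n choose j)) * g n k\<bar>)"
          by (rule sum_abs)
        also have "\<dots> \<le> (\<Sum>k\<le>n. (real (j * j) / real (n - j)) * g n k)"
          unfolding abs_mult using falling_ratio_bound[of _ n j] that g0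
          by (intro sum_mono mult_mono) auto
        also have "\<dots> = (real (j * j) / real (n - j)) * (\<Sum>k\<le>n. g n k)"
          by (rule sum_distrib_left[symmetric])
        also have "(\<Sum>k\<le>n. g n k) = 1" using binomial_sum[of n 0] one by (simp add: g_def)
        finally show ?thesis by simp
      qed
      have "(\<lambda>n. (\<integral>x. cl x ^ j \<partial>\<mu> n) - w j 0) \<longlonglongrightarrow> 0"
      proof (rule Lim_null_comparison)
        show "\<forall>\<^sub>F n in sequentially. norm ((\<integral>x. cl x ^ j \<partial>\<mu> n) - w j 0) \<le> real (j * j) / real (n - j)"
          using eventually_gt_at_top[of j] by eventually_elim (use ineq in auto)
        have "(\<lambda>n. real (j * j) / real n) \<longlonglongrightarrow> 0" by (rule lim_const_over_n)
        hence "(\<lambda>n. real (j * j) / real (n + j - j)) \<longlonglongrightarrow> 0" by simp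
        thus "(\<lambda>n. real (j * j) / real (n - j)) \<longlonglongrightarrow> 0" by (rule LIMSEQ_offset[where k=j])
      qed
      hence "(\<lambda>n. \<integral>x. cl x ^ j \<partial>\<mu> n) \<longlonglongrightarrow> w j 0" by (simp add: LIM_zero_iff)
      from LIMSEQ_subseq_LIMSEQ[OF this r] show ?thesis by (simp add: comp_def)
    qed
    ultimately have "(\<integral>x. cl x ^ j \<partial>M) = w j 0" by (rule LIMSEQ_unique)
    moreover have "(\<integral>x. cl x ^ j \<partial>M) = (\<integral>x. x ^ j \<partial>M)"
      using suppM by (intro integral_cong_AE) (auto simp: cl_def)
    ultimately show ?thesis by simp
  qed
  show thesis by (rule that[OF M suppM mom])
qed

text \<open>Brosowski--Deutsch polynomials: on \<open>[a, b]\<close> they decrease from 1 to 0 and converge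
  pointwise to the indicator of \<open>{..E}\<close>, as \<open>b\<^sub>n \<alpha>\<^sup>n \<longlonglongrightarrow> 0\<close> for the exponents \<open>b\<^sub>n\<close> below while
  \<open>b\<^sub>n u\<^sup>n \<longlonglongrightarrow> \<infinity>\<close> for every \<open>u > \<alpha>\<close>.\<close>

definition cut_exp :: "real \<Rightarrow> nat \<Rightarrow> nat" where
  "cut_exp \<alpha> n = nat \<lfloor>1 / (real n * \<alpha> ^ n)\<rfloor>"

definition cut_poly :: "real \<Rightarrow> real \<Rightarrow> real \<Rightarrow> nat \<Rightarrow> real poly" where
  "cut_poly a b E n =
    (1 - [:- a / (b - a), 1 / (b - a):] ^ n) ^ cut_exp ((E - a) / (b - a)) n"

lemma poly_cut_poly:
  "poly (cut_poly a b E n) x = (1 - ((x - a) / (b - a)) ^ n) ^ cut_exp ((E - a) / (b - a)) n"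
  by (simp add: cut_poly_def poly_power diff_divide_distrib)

lemma cut_poly_range:
  assumes "a < b" "x \<in> {a..b}"
  shows "0 \<le> poly (cut_poly a b E n) x" "poly (cut_poly a b E n) x \<le> 1"
proof -
  have "0 \<le> (x - a) / (b - a)" "(x - a) / (b - a) \<le> 1" using assms by auto
  hence "0 \<le> ((x - a) / (b - a)) ^ n" "((x - a) / (b - a)) ^ n \<le> 1" by (auto intro: power_le_one)
  thus "0 \<le> poly (cut_poly a b E n) x" "poly (cut_poly a b E n) x \<le> 1"
    unfolding poly_cut_poly by (auto intro!: power_le_one)
qed

text \<open>Monotonicity, beyond convergence, is what the comparison along the path uses: the
  negative of this derivative is a polynomial nonnegative on the spectral interval.\<close>

lemma cut_poly_pderiv_nonpos:
  assumes "a < b" "x \<in> {a..b}"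
  shows "poly (pderiv (cut_poly a b E n)) x \<le> 0"
proof -
  let ?u = "(x - a) / (b - a)" and ?N = "cut_exp ((E - a) / (b - a)) n"
  have u: "0 \<le> ?u" "?u \<le> 1" using assms by auto
  have "poly (pderiv (cut_poly a b E n)) x
      = real ?N * (1 - ?u ^ n) ^ (?N - 1) * (- (real n * ?u ^ (n - 1) * (1 / (b - a))))"
    unfolding cut_poly_def
    by (simp add: pderiv_power pderiv_diff pderiv_pCons poly_power diff_divide_distrib)
  also have "\<dots> \<le> 0"
  proof (rule mult_nonneg_nonpos)
    have "?u ^ n \<le> 1" using u by (rule power_le_one)
    thus "0 \<le> real ?N * (1 - ?u ^ n) ^ (?N - 1)" by simp
    show "- (real n * ?u ^ (n - 1) * (1 / (b - a))) \<le> 0" using u(1) assms(1) by simp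
  qed
  finally show ?thesis .
qed

lemma cut_poly_tendsto:
  assumes E: "a < E" "E < b" and x: "x \<in> {a..b}"
  shows "(\<lambda>n. poly (cut_poly a b E n) x) \<longlonglongrightarrow> indicator {..E} x"
proof -
  define \<alpha> where "\<alpha> = (E - a) / (b - a)"
  define u where "u = (x - a) / (b - a)"
  have \<alpha>: "0 < \<alpha>" "\<alpha> < 1" unfolding \<alpha>_def using E by auto
  have u: "0 \<le> u" "u \<le> 1" unfolding u_def using x E by auto
  have un: "0 \<le> u ^ n" "u ^ n \<le> 1" for n using u by (auto intro: power_le_one)
  have p: "poly (cut_poly a b E n) x = (1 - u ^ n) ^ cut_exp \<alpha> n" for n
    unfolding poly_cut_poly u_def \<alpha>_def ..
  have inv0: "(\<lambda>n. 1 / real n) \<longlonglongrightarrow> 0" by (rule lim_const_over_n)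
  show ?thesis
  proof (cases "x \<le> E")
    case True
    hence ua: "u \<le> \<alpha>" unfolding u_def \<alpha>_def using E by (simp add: divide_right_mono)
    \<comment> \<open>Rounding down gives
      \<open>cut_exp \<alpha> n * \<alpha>^n \<le> 1 / n\<close>. The factor \<open>1 / n\<close>
      makes the limit 1 even at \<open>u = \<alpha>\<close>, so an atom at \<open>E\<close> is
      counted, as the closed half-line requires.\<close>
    have lower: "1 - 1 / real n \<le> (1 - u ^ n) ^ cut_exp \<alpha> n" for n
    proof -
      have "real (cut_exp \<alpha> n) * u ^ n \<le> (1 / (real n * \<alpha> ^ n)) * \<alpha> ^ n"
      proof (rule mult_mono)
        have "0 \<le> 1 / (real n * \<alpha> ^ n)" using \<alpha> by simp
        thus "real (cut_exp \<alpha> n) \<le> 1 / (real n * \<alpha> ^ n)" unfolding cut_exp_def by linarith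
        show "0 \<le> 1 / (real n * \<alpha> ^ n)" using \<alpha> by simp
      qed (use ua u in \<open>auto intro: power_mono\<close>)
      also have "\<dots> = 1 / real n" using \<alpha> by simp
      finally have "1 - 1 / real n \<le> 1 + real (cut_exp \<alpha> n) * (- (u ^ n))" by simp
      also have "\<dots> \<le> (1 + (- (u ^ n))) ^ cut_exp \<alpha> n"
        by (rule Bernoulli_inequality) (use un[of n] in linarith)
      finally show ?thesis by simp
    qed
    have "(\<lambda>n. 1 - 1 / real n) \<longlonglongrightarrow> 1 - 0" by (intro tendsto_diff tendsto_const inv0)
    hence "(\<lambda>n. 1 - 1 / real n) \<longlonglongrightarrow> 1" by simp
    hence "(\<lambda>n. (1 - u ^ n) ^ cut_exp \<alpha> n) \<longlonglongrightarrow> 1"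
      by (rule tendsto_sandwich[rotated 2, OF _ tendsto_const])
         (use lower un in \<open>auto intro!: always_eventually power_le_one\<close>)
    thus ?thesis using True by (simp add: p)
  next
    case False
    hence ua: "\<alpha> < u" unfolding u_def \<alpha>_def using E by (simp add: divide_strict_right_mono)
    define r where "r = u / \<alpha>"
    have r: "1 < r" unfolding r_def using ua \<alpha> by simp
    \<comment> \<open>From \<open>1 - y \<le> exp (- y)\<close>. The summand 1 in the exponent
      absorbs the loss from rounding the exponent down, which is at most
      \<open>u^n \<le> 1\<close>.\<close>
    have upper: "(1 - u ^ n) ^ cut_exp \<alpha> n \<le> exp (1 - r ^ n / real n)" for n
    proof -
      have "(1 - u ^ n) ^ cut_exp \<alpha> n \<le> exp (- (u ^ n)) ^ cut_exp \<alpha> n"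
        by (rule power_mono) (use exp_ge_add_one_self[of "- (u ^ n)"] un in auto)
      also have "\<dots> = exp (- (real (cut_exp \<alpha> n) * u ^ n))" by (simp add: exp_of_nat_mult[symmetric])
      also have "\<dots> \<le> exp (1 - r ^ n / real n)"
      proof -
        have "1 / (real n * \<alpha> ^ n) - 1 \<le> real (cut_exp \<alpha> n)" unfolding cut_exp_def by linarith
        hence "(1 / (real n * \<alpha> ^ n) - 1) * u ^ n \<le> real (cut_exp \<alpha> n) * u ^ n"
          using un by (intro mult_right_mono) auto
        moreover have "(1 / (real n * \<alpha> ^ n) - 1) * u ^ n = r ^ n / real n - u ^ n"
          unfolding r_def using \<alpha> by (simp add: field_simps power_divide)
        ultimately show ?thesis using un(2)[of n] by simp
      qed
      finally show ?thesis .
    qed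
    have "filterlim (\<lambda>n. r ^ n / real n) at_top sequentially"
      using r by real_asymp
    hence "filterlim (\<lambda>n. r ^ n / real n - 1) at_top sequentially"
      using filterlim_tendsto_add_at_top[of "\<lambda>_. -1::real" "-1"] by fastforce
    hence "filterlim (\<lambda>n. - (r ^ n / real n - 1)) at_bot sequentially"
      by (simp add: filterlim_uminus_at_top)
    hence "((\<lambda>n. exp (- (r ^ n / real n - 1))) \<longlongrightarrow> 0) sequentially"
      by (rule filterlim_compose[OF exp_at_bot])
    hence "(\<lambda>n. exp (1 - r ^ n / real n)) \<longlonglongrightarrow> 0" by simp
    hence "(\<lambda>n. (1 - u ^ n) ^ cut_exp \<alpha> n) \<longlonglongrightarrow> 0"
      by (rule tendsto_sandwich[rotated 2, OF tendsto_const])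
         (use upper un in \<open>auto intro!: always_eventually\<close>)
    thus ?thesis using False by (simp add: p)
  qed
qed

section \<open>Compactly supported measures and their moments\<close>

text \<open>The Riesz functional of the sequence \<open>M\<close>. It evaluates integrals of
  polynomials and diagonal entries of polynomials in an operator alike, so the two sides meet
  without a polynomial calculus for operators.\<close>

definition moment_eval :: "(nat \<Rightarrow> real) \<Rightarrow> real poly \<Rightarrow> real" where
  "moment_eval M q = (\<Sum>i\<le>degree q. coeff q i * M i)"

lemma (in real_distribution) integrable_bounded_support:
  assumes "AE x in M. x \<in> {a..b}" "continuous_on UNIV f"
  shows "integrable M (f :: real \<Rightarrow> real)"
proof -
  have [measurable]: "f \<in> borel_measurable borel" by (rule borel_measurable_continuous_onI[OF assms(2)])
  have "compact (f ` {a..b})"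
    by (rule compact_continuous_image[OF continuous_on_subset[OF assms(2)]]) auto
  then obtain B where "\<And>x. x \<in> {a..b} \<Longrightarrow> norm (f x) \<le> B"
    using compact_imp_bounded bounded_iff by (metis imageI)
  thus ?thesis using assms(1) by (intro integrable_const_bound[of _ B]) auto
qed

lemma (in real_distribution) integral_poly:
  assumes "AE x in M. x \<in> {a..b}"
  shows "(\<integral>x. poly q x \<partial>M) = moment_eval (\<lambda>i. \<integral>x. x ^ i \<partial>M) q"
  unfolding poly_altdef moment_eval_def
  by (subst Bochner_Integration.integral_sum)
     (auto intro!: integrable_bounded_support[OF assms] continuous_intros)

lemma (in real_distribution) moment_eval_cut_poly_tendsto:
  assumes E: "a < E" "E < b" and supp: "AE x in M. x \<in> {a..b}"
  shows "(\<lambda>n. moment_eval (\<lambda>i. \<integral>x. x ^ i \<partial>M) (cut_poly a b E n)) \<longlonglongrightarrow> measure M {..E}"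
proof -
  have "(\<lambda>n. \<integral>x. poly (cut_poly a b E n) x \<partial>M) \<longlonglongrightarrow> (\<integral>x. indicator {..E} x \<partial>M)"
  proof (rule integral_dominated_convergence[where w="\<lambda>_. 1"])
    show "AE x in M. (\<lambda>n. poly (cut_poly a b E n) x) \<longlonglongrightarrow> indicator {..E} x"
      using supp by eventually_elim (use cut_poly_tendsto[OF E] in auto)
    show "AE x in M. norm (poly (cut_poly a b E n) x) \<le> 1" for n
      using supp by eventually_elim (use cut_poly_range[of a b _ E n] E in auto)
  qed (auto intro!: measurable_finite_borel borel_measurable_continuous_onI continuous_intros)
  thus ?thesis unfolding integral_poly[OF supp] by simp
qed

lemma (in real_distribution) moment_eval_cut_poly_range:
  assumes ab: "a < b" and supp: "AE x in M. x \<in> {a..b}"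
  shows "0 \<le> moment_eval (\<lambda>i. \<integral>x. x ^ i \<partial>M) (cut_poly a b E n)"
    and "moment_eval (\<lambda>i. \<integral>x. x ^ i \<partial>M) (cut_poly a b E n) \<le> 1"
proof -
  have int: "integrable M (poly (cut_poly a b E n))"
    by (rule integrable_bounded_support[OF supp]) (auto intro!: continuous_intros)
  have "AE x in M. 0 \<le> poly (cut_poly a b E n) x"
    using supp by eventually_elim (rule cut_poly_range[OF ab])
  thus "0 \<le> moment_eval (\<lambda>i. \<integral>x. x ^ i \<partial>M) (cut_poly a b E n)"
    unfolding integral_poly[OF supp, symmetric] by (rule integral_nonneg_AE)
  have "AE x in M. poly (cut_poly a b E n) x \<le> 1"
    using supp by eventually_elim (rule cut_poly_range[OF ab])
  hence "(\<integral>x. poly (cut_poly a b E n) x \<partial>M) \<le> (\<integral>x. 1 \<partial>M)"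
    by (intro integral_mono_AE int) auto
  thus "moment_eval (\<lambda>i. \<integral>x. x ^ i \<partial>M) (cut_poly a b E n) \<le> 1"
    unfolding integral_poly[OF supp] using prob_space by simp
qed

text \<open>The cut polynomials recover the distribution function at every point, atoms included,
  from the moments alone.\<close>

lemma moments_unique:
  assumes M: "real_distribution M" "AE x in M. x \<in> {a..b}"
    and N: "real_distribution N" "AE x in N. x \<in> {c..d}"
    and eq: "\<And>i::nat. (\<integral>x. x ^ i \<partial>M) = (\<integral>x. x ^ i \<partial>N)"
  shows "M = N"
proof (rule cdf_unique[OF M(1) N(1)], rule ext)
  fix E :: real
  \<comment> \<open>The cut polynomials depend on the endpoints, so both measures are placed in one
    interval having \<open>E\<close> in its interior.\<close>
  let ?l = "min (min a c) E - 1" and ?u = "max (max b d) E + 1"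
  have "AE x in M. x \<in> {?l..?u}" using M(2) by eventually_elim auto
  note 1 = real_distribution.moment_eval_cut_poly_tendsto[OF M(1) _ _ this, of E]
  have "AE x in N. x \<in> {?l..?u}" using N(2) by eventually_elim auto
  note 2 = real_distribution.moment_eval_cut_poly_tendsto[OF N(1) _ _ this, of E]
  show "cdf M E = cdf N E"
    unfolding cdf_def using 1 2 by (intro LIMSEQ_unique[OF 1]) (auto simp: eq)
qed

section \<open>Spectral measures of symmetric operators on finitely supported functions\<close>

definition fin_supp :: "('v \<Rightarrow> real) \<Rightarrow> bool" where
  "fin_supp f \<longleftrightarrow> finite {x. f x \<noteq> 0}"

definition ip :: "('v \<Rightarrow> real) \<Rightarrow> ('v \<Rightarrow> real) \<Rightarrow> real" where
  "ip f g = (\<Sum>x\<in>{x. f x \<noteq> 0}. f x * g x)"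

lemma fin_supp_lin [intro]:
  assumes "fin_supp f" "fin_supp g"
  shows "fin_supp (\<lambda>x. c * f x + g x)"
  using assms unfolding fin_supp_def
  by (auto intro: finite_subset[of _ "{x. f x \<noteq> 0} \<union> {x. g x \<noteq> 0}"])

lemma fin_supp_indicator [intro, simp]: "fin_supp (indicator {v})"
  unfolding fin_supp_def by (rule finite_subset[of _ "{v}"]) (auto simp: indicator_def)

lemma ip_superset:
  assumes "finite F" "\<And>x. f x \<noteq> 0 \<Longrightarrow> g x \<noteq> 0 \<Longrightarrow> x \<in> F" "fin_supp f"
  shows "ip f g = (\<Sum>x\<in>F. f x * g x)"
proof -
  have "(\<Sum>x\<in>{x. f x \<noteq> 0}. f x * g x) = (\<Sum>x\<in>{x. f x \<noteq> 0} \<inter> F. f x * g x)"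
    using assms by (intro sum.mono_neutral_right) (auto simp: fin_supp_def)
  also have "\<dots> = (\<Sum>x\<in>F. f x * g x)"
    using assms by (intro sum.mono_neutral_left) auto
  finally show ?thesis unfolding ip_def .
qed

lemma ip_commute: "fin_supp f \<Longrightarrow> fin_supp g \<Longrightarrow> ip f g = ip g f"
  by (subst ip_superset[of "{x. g x \<noteq> 0}"]) (auto simp: ip_def fin_supp_def mult.commute)

lemma ip_lin_left:
  assumes "fin_supp f" "fin_supp g"
  shows "ip (\<lambda>x. c * f x + g x) h = c * ip f h + ip g h"
proof -
  let ?F = "{x. f x \<noteq> 0} \<union> {x. g x \<noteq> 0}"
  have F: "finite ?F" using assms by (auto simp: fin_supp_def)
  have "ip (\<lambda>x. c * f x + g x) h = (\<Sum>x\<in>?F. (c * f x + g x) * h x)"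
    by (rule ip_superset[OF F]) (use fin_supp_lin[OF assms] in auto)
  also have "\<dots> = c * (\<Sum>x\<in>?F. f x * h x) + (\<Sum>x\<in>?F. g x * h x)"
    by (simp add: sum_distrib_left sum.distrib algebra_simps)
  also have "\<dots> = c * ip f h + ip g h"
    using ip_superset[OF F, of f h] ip_superset[OF F, of g h] assms by simp
  finally show ?thesis .
qed

lemma ip_lin_right:
  "ip h (\<lambda>x. c * f x + g x) = c * ip h f + ip h g"
  by (simp add: ip_def sum_distrib_left sum.distrib algebra_simps)

lemma ip_indicator: "ip f (indicator {v}) = f v" if "fin_supp f"
  using that by (subst ip_superset[of "{v}"]) (auto simp: indicator_def split: if_splits)

lemma ip_indicator_left: "ip (indicator {v}) f = f v"
  by (subst ip_superset[of "{v}"]) (auto simp: indicator_def split: if_splits)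

locale sym_op =
  fixes T :: "('v \<Rightarrow> real) \<Rightarrow> 'v \<Rightarrow> real"
  assumes lin: "T (\<lambda>x. c * f x + g x) = (\<lambda>x. c * T f x + T g x)"
    and fin: "fin_supp f \<Longrightarrow> fin_supp (T f)"
    and sym: "fin_supp f \<Longrightarrow> fin_supp g \<Longrightarrow> ip (T f) g = ip f (T g)"
begin

lemma zero: "T (\<lambda>x. 0) = (\<lambda>x. 0)"
  using lin[of "-1" "\<lambda>x. 0" "\<lambda>x. 0"] by simp

lemma scale: "T (\<lambda>x. c * f x) = (\<lambda>x. c * T f x)"
  using lin[of c f "\<lambda>x. 0"] zero by simp

lemma lin_funpow: "(T ^^ n) (\<lambda>x. c * f x + g x) = (\<lambda>x. c * (T ^^ n) f x + (T ^^ n) g x)"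
  by (induction n) (auto simp: lin)

lemma scale_funpow: "(T ^^ n) (\<lambda>x. c * f x) = (\<lambda>x. c * (T ^^ n) f x)"
  by (induction n) (auto simp: scale)

lemma fin_funpow: "fin_supp f \<Longrightarrow> fin_supp ((T ^^ n) f)"
  by (induction n) (auto simp: fin)

lemma sym_funpow: "fin_supp f \<Longrightarrow> fin_supp g \<Longrightarrow> ip ((T ^^ n) f) g = ip f ((T ^^ n) g)"
  by (induction n arbitrary: f g) (auto simp: sym fin_funpow fin funpow_swap1)

end

text \<open>Stands in for a self-adjoint operator with spectrum in \<open>[0,R]\<close>. Only
  finitely supported functions are tested; these contain every
  \<open>(T ^^ n) (indicator {v})\<close>, so no completion is formed.\<close>

locale pos_op = sym_op T for T :: "('v \<Rightarrow> real) \<Rightarrow> 'v \<Rightarrow> real" +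
  fixes R :: real
  assumes R: "0 < R"
    and pos: "fin_supp f \<Longrightarrow> 0 \<le> ip (T f) f"
    and upper: "fin_supp f \<Longrightarrow> ip (T f) f \<le> R * ip f f"
begin

text \<open>\<open>S\<close> and \<open>U\<close> play the roles of \<open>x\<close> and
  \<open>1 - x\<close>: they commute, have nonnegative forms and sum to the identity.\<close>

definition "S f = (\<lambda>x. T f x / R)"
definition "U f = (\<lambda>x. f x - T f x / R)"

lemma S_lin: "S (\<lambda>x. c * f x + g x) = (\<lambda>x. c * S f x + S g x)"
  unfolding S_def lin by (simp add: add_divide_distrib)

lemma U_alt: "U f = (\<lambda>x. (-1) * S f x + f x)"
  by (simp add: U_def S_def)

lemma S_alt: "S f = (\<lambda>x. (1 / R) * T f x + (\<lambda>x. 0) x)"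
  by (simp add: S_def)

lemma ip_S: "ip (S f) g = ip (T f) g / R"
  using R by (simp add: ip_def S_def sum_divide_distrib)

lemma fin_supp_zero: "fin_supp (\<lambda>x. 0)" by (simp add: fin_supp_def)

lemma S_sym_op: "sym_op S"
proof
  show fs: "fin_supp (S f)" if "fin_supp f" for f
    unfolding S_alt by (intro fin_supp_lin fin that fin_supp_zero)
  show "ip (S f) g = ip f (S g)" if "fin_supp f" "fin_supp g" for f g
    unfolding ip_S sym[OF that] by (simp add: ip_def S_def sum_divide_distrib)
qed (rule S_lin)

interpretation S: sym_op S by (rule S_sym_op)

lemma U_sym_op: "sym_op U"
proof
  show "U (\<lambda>x. c * f x + g x) = (\<lambda>x. c * U f x + U g x)" for c f g
    unfolding U_alt S_lin by (simp add: algebra_simps)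
  show "fin_supp (U f)" if "fin_supp f" for f
    unfolding U_alt by (intro fin_supp_lin S.fin that)
  show "ip (U f) g = ip f (U g)" if "fin_supp f" "fin_supp g" for f g
    unfolding U_alt using that by (simp only: ip_lin_left ip_lin_right S.fin S.sym)
qed

interpretation U: sym_op U by (rule U_sym_op)

lemma SU: "S (U f) = U (S f)"
  unfolding U_alt S_lin by simp

lemma ip_S_nonneg: "fin_supp f \<Longrightarrow> 0 \<le> ip (S f) f"
  using pos[of f] R by (simp add: ip_S)

lemma ip_U_nonneg: "fin_supp f \<Longrightarrow> 0 \<le> ip (U f) f"
proof -
  assume f: "fin_supp f"
  have "ip (S f) f \<le> ip f f" using upper[OF f] R by (simp add: ip_S field_simps)
  moreover have "ip (U f) f = - 1 * ip (S f) f + ip f f"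
    unfolding U_alt by (rule ip_lin_left[OF S.fin[OF f] f])
  ultimately show ?thesis by simp
qed

lemma U_funpow_S: "(U ^^ l) (S f) = S ((U ^^ l) f)"
  by (induction l) (auto simp: SU)

lemma S_funpow_U: "(S ^^ k) (U f) = U ((S ^^ k) f)"
  by (induction k) (auto simp: SU)

lemma S_split: "f = (\<lambda>x. 1 * S f x + U f x)"
  by (simp add: S_def U_def)

text \<open>Even powers are absorbed into \<open>f\<close>; the remaining product is handled by
  \<open>SU = USU + SUS\<close> on the two squares, since \<open>S + U\<close> is the identity.\<close>
lemma ip_SU_nonneg: "fin_supp f \<Longrightarrow> 0 \<le> ip ((S ^^ k) ((U ^^ l) f)) f"
proof (induction "k + l" arbitrary: k l f rule: less_induct)
  case less
  note f = less.prems
  show ?case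
  proof (cases "2 \<le> k")
    case True
    then obtain k' where k: "k = Suc (Suc k')" by (metis add_2_eq_Suc le_Suc_ex)
    have "ip ((S ^^ k) ((U ^^ l) f)) f = ip (S ((S ^^ k') (S ((U ^^ l) f)))) f"
      unfolding k by (simp add: funpow_swap1)
    also have "\<dots> = ip ((S ^^ k') ((U ^^ l) (S f))) (S f)"
      unfolding U_funpow_S by (intro S.sym S.fin_funpow S.fin U.fin_funpow f)
    finally show ?thesis using less.hyps[of k' l "S f"] k f S.fin by auto
  next
    case k: False
    show ?thesis
    proof (cases "2 \<le> l")
      case True
      then obtain l' where l: "l = Suc (Suc l')" by (metis add_2_eq_Suc le_Suc_ex)
      have "ip ((S ^^ k) ((U ^^ l) f)) f = ip (U ((S ^^ k) ((U ^^ l') (U f)))) f"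
        unfolding l by (simp add: S_funpow_U[symmetric] funpow_swap1)
      also have "\<dots> = ip ((S ^^ k) ((U ^^ l') (U f))) (U f)"
        by (intro U.sym S.fin_funpow U.fin U.fin_funpow f)
      finally show ?thesis using less.hyps[of k l' "U f"] l f U.fin by auto
    next
      case l: False
      have nn: "0 \<le> ip f f" by (auto simp: ip_def intro: sum_nonneg)
      have "ip (S (U f)) f = ip (S (U f)) (\<lambda>x. 1 * S f x + U f x)" by (simp add: S_def U_def)
      also have "\<dots> = ip (U (S f)) (S f) + ip (S (U f)) (U f)"
        unfolding ip_lin_right by (simp add: SU)
      also have "\<dots> \<ge> 0" using ip_U_nonneg[of "S f"] ip_S_nonneg[of "U f"] f S.fin U.fin by auto
      finally have "0 \<le> ip (S (U f)) f" .
      moreover have "k = 0 \<or> k = 1" "l = 0 \<or> l = 1" using k l by auto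
      ultimately show ?thesis using nn ip_U_nonneg ip_S_nonneg f by auto
    qed
  qed
qed

definition "moments f k l = ip ((S ^^ k) ((U ^^ l) f)) f"

lemma completely_monotone_moments: "fin_supp f \<Longrightarrow> completely_monotone (moments f)"
proof
  fix k l assume f: "fin_supp f"
  show "0 \<le> moments f k l" unfolding moments_def by (rule ip_SU_nonneg[OF f])
  have "moments f k l = ip ((S ^^ k) (\<lambda>x. 1 * S ((U ^^ l) f) x + U ((U ^^ l) f) x)) f"
    unfolding moments_def by (subst S_split[of "(U ^^ l) f"]) (rule refl)
  also have "\<dots> = 1 * ip ((S ^^ k) (S ((U ^^ l) f))) f + ip ((S ^^ k) (U ((U ^^ l) f))) f"
    unfolding S.lin_funpow by (intro ip_lin_left S.fin_funpow S.fin U.fin U.fin_funpow f)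
  finally show "moments f k l = moments f (Suc k) l + moments f k (Suc l)"
    unfolding moments_def by (simp add: funpow_swap1)
qed

lemma S_funpow: "(S ^^ i) f = (\<lambda>x. (T ^^ i) f x / R ^ i)"
proof (induction i)
  case (Suc i)
  have "T (\<lambda>x. (T ^^ i) f x / R ^ i) = (\<lambda>x. (1 / R ^ i) * T ((T ^^ i) f) x)"
    using scale[of "1 / R ^ i" "(T ^^ i) f"] by simp
  then show ?case using Suc by (simp add: S_def mult.commute)
qed simp

lemma moments_0: "ip ((T ^^ i) f) f = R ^ i * moments f i 0"
proof -
  have "moments f i 0 = ip (\<lambda>x. (T ^^ i) f x / R ^ i) f" by (simp add: moments_def S_funpow)
  also have "\<dots> = ip ((T ^^ i) f) f / R ^ i"
    using R by (auto simp: ip_def sum_divide_distrib)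
  finally show ?thesis using R by simp
qed

theorem spectral_measure:
  assumes f: "fin_supp f" and one: "ip f f = 1"
  obtains \<mu> where "real_distribution \<mu>" "AE x in \<mu>. x \<in> {0..R}"
    "\<And>i. (\<integral>x. x ^ i \<partial>\<mu>) = ip ((T ^^ i) f) f"
proof -
  interpret completely_monotone "moments f" by (rule completely_monotone_moments[OF f])
  obtain \<nu> where \<nu>: "real_distribution \<nu>" "AE x in \<nu>. x \<in> {0..1}"
    "\<And>j. (\<integral>x. x ^ j \<partial>\<nu>) = moments f j 0"
    using Hausdorff_moment one by (auto simp: moments_def)
  interpret real_distribution \<nu> by (rule \<nu>)
  show thesis
  proof (rule that[of "distr \<nu> borel (\<lambda>x. R * x)"])
    show "AE x in distr \<nu> borel (\<lambda>x. R * x). x \<in> {0..R}"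
      using \<nu>(2) R by (subst AE_distr_iff) (auto elim!: AE_mp)
    show "(\<integral>x. x ^ i \<partial>distr \<nu> borel (\<lambda>x. R * x)) = ip ((T ^^ i) f) f" for i
      by (subst integral_distr) (auto simp: power_mult_distrib moments_0 \<nu>(3))
  qed (auto intro!: real_distribution_distr)
qed

text \<open>Integration against the spectral measure of the normalized vector replaces the
  functional calculus. For a vector of norm zero all moments vanish, being dominated by the zeroth
  one.\<close>

lemma moment_eval_nonneg:
  assumes f: "fin_supp f" and q: "\<And>x. x \<in> {0..R} \<Longrightarrow> 0 \<le> poly q x"
  shows "0 \<le> moment_eval (\<lambda>i. ip ((T ^^ i) f) f) q"
proof (cases "ip f f = 0")
  case True
  have "moments f i 0 = 0" for i
    using completely_monotone.bounded[OF completely_monotone_moments[OF f], of i 0]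
      completely_monotone.nonneg[OF completely_monotone_moments[OF f], of i 0] True
    by (simp add: moments_def)
  thus ?thesis by (simp add: moment_eval_def moments_0)
next
  case False
  define c where "c = ip f f"
  have c: "c > 0" using False unfolding c_def by (auto simp: ip_def less_le intro: sum_nonneg)
  define g where "g = (\<lambda>x. (1 / sqrt c) * f x)"
  have g: "fin_supp g" using f by (auto simp: g_def fin_supp_def)
  have ig: "ip ((T ^^ i) g) g = ip ((T ^^ i) f) f / c" for i
  proof -
    have s: "fin_supp ((T ^^ i) f)" by (rule fin_funpow[OF f])
    have "ip ((T ^^ i) g) g = ip (\<lambda>x. (1 / sqrt c) * (T ^^ i) f x + 0) (\<lambda>x. (1 / sqrt c) * f x + 0)"
      unfolding g_def scale_funpow by simp
    also have "\<dots> = (1 / sqrt c) * ((1 / sqrt c) * ip ((T ^^ i) f) f)"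
      unfolding ip_lin_right ip_lin_left[OF s fin_supp_zero] by (simp add: ip_def)
    also have "\<dots> = ip ((T ^^ i) f) f / (sqrt c * sqrt c)" by simp
    finally show ?thesis using c by simp
  qed
  have "ip g g = 1" using ig[of 0] c by (simp add: c_def)
  then obtain \<mu> where \<mu>: "real_distribution \<mu>" "AE x in \<mu>. x \<in> {0..R}"
    "\<And>i. (\<integral>x. x ^ i \<partial>\<mu>) = ip ((T ^^ i) g) g"
    using spectral_measure[OF g] by blast
  have "AE x in \<mu>. 0 \<le> poly q x" using \<mu>(2) by eventually_elim (rule q)
  hence "0 \<le> (\<integral>x. poly q x \<partial>\<mu>)" by (rule integral_nonneg_AE)
  also have "\<dots> = moment_eval (\<lambda>i. ip ((T ^^ i) g) g) q"
    using real_distribution.integral_poly[OF \<mu>(1,2)] \<mu>(3) by simp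
  also have "\<dots> = moment_eval (\<lambda>i. ip ((T ^^ i) f) f) q / c"
    by (simp add: moment_eval_def ig sum_divide_distrib)
  finally show ?thesis using c by (simp add: zero_le_divide_iff)
qed

text \<open>Decompose \<open>v = c f + h\<close> with \<open>h\<close> orthogonal to the eigenvector \<open>f\<close>.\<close>
lemma moment_eval_eigenvector:
  assumes f: "fin_supp f" "0 < ip f f" and eig: "T f = (\<lambda>x. lam * f x)" and v: "fin_supp v"
    and q: "\<And>x. x \<in> {0..R} \<Longrightarrow> 0 \<le> poly q x"
  shows "(ip v f)\<^sup>2 / ip f f * poly q lam \<le> moment_eval (\<lambda>i. ip ((T ^^ i) v) v) q"
proof -
  define c where "c = ip v f / ip f f"
  define h where "h = (\<lambda>x. (- c) * f x + v x)"
  have h: "fin_supp h" unfolding h_def using f v by (intro fin_supp_lin)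
  have v_eq: "v = (\<lambda>x. c * f x + h x)" by (simp add: h_def)
  have hf: "ip h f = 0" unfolding h_def ip_lin_left[OF f(1) v] using f by (simp add: c_def)
  have pow: "(T ^^ i) f = (\<lambda>x. lam ^ i * f x)" for i
  proof (induction i)
    case (Suc i)
    have "T (\<lambda>x. lam ^ i * f x) = (\<lambda>x. lam ^ i * (lam * f x))" by (simp only: scale eig)
    then show ?case using Suc by (simp add: mult.left_commute mult.assoc)
  qed simp
  have "ip ((T ^^ i) v) v = c\<^sup>2 * ip f f * lam ^ i + ip ((T ^^ i) h) h" for i
  proof -
    have Th: "fin_supp ((T ^^ i) h)" by (rule fin_funpow[OF h])
    have "(T ^^ i) v = (\<lambda>x. (c * lam ^ i) * f x + (T ^^ i) h x)"
      unfolding v_eq lin_funpow pow by (simp add: mult.assoc)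
    hence "ip ((T ^^ i) v) v = ip (\<lambda>x. (c * lam ^ i) * f x + (T ^^ i) h x) (\<lambda>x. c * f x + h x)"
      using v_eq by simp
    also have "\<dots> = c * (c * lam ^ i) * ip f f + c * ip ((T ^^ i) h) f
        + (c * lam ^ i) * ip f h + ip ((T ^^ i) h) h"
      unfolding ip_lin_right ip_lin_left[OF f(1) Th] by (simp add: algebra_simps)
    also have "ip f h = 0" using hf ip_commute[OF f(1) h] by simp
    \<comment> \<open>Symmetry moves the powers onto the eigenvector, so the cross term is a
      multiple of \<open>ip h f\<close>, which is zero.\<close>
    also have "ip ((T ^^ i) h) f = lam ^ i * ip h f"
      unfolding sym_funpow[OF h f(1)] pow by (simp add: ip_def sum_distrib_left algebra_simps)
    finally show ?thesis using hf by (simp add: power2_eq_square)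
  qed
  hence "moment_eval (\<lambda>i. ip ((T ^^ i) v) v) q
      = c\<^sup>2 * ip f f * poly q lam + moment_eval (\<lambda>i. ip ((T ^^ i) h) h) q"
    by (simp add: moment_eval_def poly_altdef sum.distrib sum_distrib_left algebra_simps)
  moreover have "c\<^sup>2 * ip f f = (ip v f)\<^sup>2 / ip f f"
    using f by (simp add: c_def power2_eq_square)
  ultimately show ?thesis using moment_eval_nonneg[OF h q] by simp
qed

end

section \<open>Evaluating the definite description of the spectral measure\<close>

lemma spec_measure_eqI:
  assumes \<mu>: "real_distribution \<mu>" "AE x in \<mu>. x \<in> {0..R}"
    and mom: "\<And>i. (\<integral>x. x ^ i \<partial>\<mu>) = (T ^^ i) (indicator {v}) v"
  shows "spec_measure T v = \<mu>"
  unfolding spec_measure_def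
proof (rule the_equality)
  interpret real_distribution \<mu> by (rule \<mu>)
  have "AE x in \<mu>. x \<in> {-R..R}" using \<mu>(2) by eventually_elim auto
  hence "emeasure \<mu> (- {-R..R}) = 0"
    by (subst (asm) AE_iff_measurable[where N="- {-R..R}"]) auto
  thus "sets \<mu> = sets borel \<and> finite_measure \<mu> \<and> (\<exists>R. emeasure \<mu> (- {-R..R}) = 0) \<and>
      (\<forall>n. (\<integral>x. x ^ n \<partial>\<mu>) = (T ^^ n) (indicator {v}) v)"
    using mom by (auto intro: finite_measure_axioms)
next
  fix \<nu> :: "real measure"
  assume \<nu>: "sets \<nu> = sets borel \<and> finite_measure \<nu> \<and> (\<exists>R. emeasure \<nu> (- {-R..R}) = 0) \<and>
      (\<forall>n. (\<integral>x. x ^ n \<partial>\<nu>) = (T ^^ n) (indicator {v}) v)"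
  then obtain R' where R': "emeasure \<nu> (- {-R'..R'}) = 0" by blast
  interpret finite_measure \<nu> using \<nu> by blast
  \<comment> \<open>The description asks only for a finite measure; the zeroth moment fixes the
    total mass, which brings the competitor into the scope of \<open>moments_unique\<close>.\<close>
  have "measure \<nu> (space \<nu>) = 1" using \<nu>[THEN conjunct2, THEN conjunct2, THEN conjunct2, rule_format, of 0] by simp
  hence "prob_space \<nu>" by (intro prob_spaceI) (simp add: emeasure_eq_measure)
  hence rd: "real_distribution \<nu>" using \<nu> by (simp add: real_distribution_def real_distribution_axioms_def)
  have "AE x in \<nu>. x \<in> {-R'..R'}"
    by (rule AE_I[OF _ R']) (use \<nu> in auto)
  thus "\<nu> = \<mu>" using \<nu> mom by (intro moments_unique[OF rd _ \<mu>]) auto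
qed

lemma spec_measure_props:
  assumes "pos_op T R"
  shows real_distribution_spec_measure: "real_distribution (spec_measure T v)"
    and AE_spec_measure: "AE x in spec_measure T v. x \<in> {0..R}"
    and moments_spec_measure: "(\<integral>x. x ^ i \<partial>spec_measure T v) = (T ^^ i) (indicator {v}) v"
proof -
  interpret pos_op T R by fact
  have m: "ip ((T ^^ i) (indicator {v})) (indicator {v}) = (T ^^ i) (indicator {v}) v" for i
    by (simp add: ip_indicator fin_funpow)
  have "ip (indicator {v}) (indicator {v} :: lamp \<Rightarrow> real) = 1" by (simp add: ip_indicator)
  then obtain \<mu> where \<mu>: "real_distribution \<mu>" "AE x in \<mu>. x \<in> {0..R}"
    "\<And>i. (\<integral>x. x ^ i \<partial>\<mu>) = (T ^^ i) (indicator {v}) v"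
    using spectral_measure[of "indicator {v}"] m by auto
  have "spec_measure T v = \<mu>" by (rule spec_measure_eqI[OF \<mu>])
  thus "real_distribution (spec_measure T v)" "AE x in spec_measure T v. x \<in> {0..R}"
    "(\<integral>x. x ^ i \<partial>spec_measure T v) = (T ^^ i) (indicator {v}) v"
    using \<mu> by auto
qed

lemma spec_measure_tendsto:
  assumes T: "pos_op T R" and E: "0 < E" "E < R"
  shows "(\<lambda>n. moment_eval (\<lambda>i. (T ^^ i) (indicator {v}) v) (cut_poly 0 R E n))
    \<longlonglongrightarrow> measure (spec_measure T v) {..E}"
  using real_distribution.moment_eval_cut_poly_tendsto
    [OF real_distribution_spec_measure[OF T] E AE_spec_measure[OF T], of v]
  by (simp add: moments_spec_measure[OF T])

section \<open>Equivariant random kernels and the trace\<close>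

text \<open>Over \<open>N\<close> equal steps the errors add up to \<open>N * K / N^2\<close>, which
  tends to 0. An upper estimate of increments thus does the work of a nonpositive
  derivative.\<close>

lemma second_order_nonincreasing:
  fixes F :: "real \<Rightarrow> real"
  assumes F: "\<And>s t. 0 \<le> t \<Longrightarrow> t \<le> s \<Longrightarrow> s \<le> 1 \<Longrightarrow> F s - F t \<le> K * (s - t)\<^sup>2"
  shows "F 1 \<le> F 0"
proof -
  have step: "F 1 \<le> F 0 + K * (1 / real N)" if N: "N \<ge> 1" for N :: nat
  proof -
    have "F (real n / real N) \<le> F 0 + real n * (K * (1 / real N)\<^sup>2)" if "n \<le> N" for n
      using that
    proof (induction n)
      case (Suc n)
      have "F (real (Suc n) / real N) - F (real n / real N)
          \<le> K * (real (Suc n) / real N - real n / real N)\<^sup>2"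
        by (rule F) (use Suc.prems N in \<open>auto simp: divide_simps\<close>)
      also have "real (Suc n) / real N - real n / real N = 1 / real N"
        by (simp add: add_divide_distrib)
      finally show ?case using Suc by (simp add: algebra_simps)
    qed simp
    from this[of N] N show ?thesis by (simp add: power2_eq_square)
  qed
  have "(\<lambda>N. F 0 + K * (1 / real N)) \<longlonglongrightarrow> F 0 + K * 0"
    by (intro tendsto_intros lim_const_over_n)
  thus ?thesis by (intro LIMSEQ_le_const[of _ "F 0"]) (use step in auto)
qed

lemma moment_eval_pderiv:
  "moment_eval m (pderiv q) = (\<Sum>i\<le>degree q. coeff q i * (real i * m (i - 1)))"
proof (cases "degree q")
  case 0
  then show ?thesis by (auto simp: moment_eval_def pderiv_eq_0_iff[THEN iffD2])
next
  case (Suc d)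
  then show ?thesis
    by (subst Suc, subst sum.atMost_Suc_shift)
       (auto simp: moment_eval_def degree_pderiv coeff_pderiv mult_ac)
qed

text \<open>A random environment with measure-preserving translations. The identity belongs to
  \<open>S\<close> so that diagonal kernels, such as the perturbation of the Laplacian, are among
  the operators \<open>kop\<close>.\<close>

locale random_kernels = group G + prob_space M
  for G :: "('g, 'r) monoid_scheme" (structure) and M :: "'w measure" +
  fixes S :: "'g set" and \<theta> :: "'g \<Rightarrow> 'w \<Rightarrow> 'w"
  assumes S: "finite S" "S \<subseteq> carrier G" "\<one> \<in> S"
    and \<theta>_measurable: "g \<in> carrier G \<Longrightarrow> \<theta> g \<in> measurable M M"
    and \<theta>_invariant: "g \<in> carrier G \<Longrightarrow> distr M M (\<theta> g) = M"
begin

definition kop :: "('g \<Rightarrow> 'g \<Rightarrow> real) \<Rightarrow> ('g \<Rightarrow> real) \<Rightarrow> 'g \<Rightarrow> real" where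
  "kop k f x = (\<Sum>s\<in>S. k x (x \<otimes> s) * f (x \<otimes> s))"

definition random_kernel :: "('w \<Rightarrow> 'g \<Rightarrow> 'g \<Rightarrow> real) \<Rightarrow> bool" where
  "random_kernel k \<longleftrightarrow>
    (\<forall>x\<in>carrier G. \<forall>y\<in>carrier G. (\<lambda>\<omega>. k \<omega> x y) \<in> borel_measurable M) \<and>
    (\<exists>B\<ge>0. \<forall>\<omega>\<in>space M. \<forall>x\<in>carrier G. \<forall>y\<in>carrier G. \<bar>k \<omega> x y\<bar> \<le> B) \<and>
    (\<forall>g\<in>carrier G. \<forall>\<omega>\<in>space M. \<forall>x\<in>carrier G. \<forall>y\<in>carrier G.
      k (\<theta> g \<omega>) (g \<otimes> x) (g \<otimes> y) = k \<omega> x y)"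

definition kops :: "'w \<Rightarrow> ('w \<Rightarrow> 'g \<Rightarrow> 'g \<Rightarrow> real) list \<Rightarrow> ('g \<Rightarrow> real) \<Rightarrow> 'g \<Rightarrow> real" where
  "kops \<omega> ks = foldr (\<lambda>k. kop (k \<omega>)) ks"

definition tr :: "('w \<Rightarrow> 'g \<Rightarrow> 'g \<Rightarrow> real) list \<Rightarrow> real" where
  "tr ks = (\<integral>\<omega>. kops \<omega> ks (indicator {\<one>}) \<one> \<partial>M)"

lemma mult_S: "x \<in> carrier G \<Longrightarrow> s \<in> S \<Longrightarrow> x \<otimes> s \<in> carrier G"
  using S by auto

lemma kops_simps [simp]:
  "kops \<omega> [] f = f" "kops \<omega> (k # ks) f = kop (k \<omega>) (kops \<omega> ks f)"
  "kops \<omega> (ks @ ls) f = kops \<omega> ks (kops \<omega> ls f)"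
  by (simp_all add: kops_def)

lemma kops_replicate: "kops \<omega> (replicate n k) f = (kop (k \<omega>) ^^ n) f"
  by (induction n) auto

lemma kop_cong:
  "x \<in> carrier G \<Longrightarrow> (\<And>y. y \<in> carrier G \<Longrightarrow> f y = g y) \<Longrightarrow> kop k f x = kop k g x"
  by (simp add: kop_def mult_S)

lemma kops_cong:
  "x \<in> carrier G \<Longrightarrow> (\<And>y. y \<in> carrier G \<Longrightarrow> f y = g y) \<Longrightarrow> kops \<omega> ks f x = kops \<omega> ks g x"
  by (induction ks arbitrary: x) (auto intro: kop_cong)

lemma kop_sum: "kop k (\<lambda>y. \<Sum>i\<in>I. c i * f i y) = (\<lambda>x. \<Sum>i\<in>I. c i * kop k (f i) x)"
  by (rule ext, simp add: kop_def sum_distrib_left, subst sum.swap) (simp add: mult_ac)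

lemma kops_sum: "kops \<omega> ks (\<lambda>y. \<Sum>i\<in>I. c i * f i y) = (\<lambda>x. \<Sum>i\<in>I. c i * kops \<omega> ks (f i) x)"
  by (induction ks) (auto simp: kop_sum)

lemma kop_diff: "kop k (\<lambda>y. f y - g y) x = kop k f x - kop k g x"
  by (simp add: kop_def sum_subtractf algebra_simps)

lemma kop_scale: "kop k (\<lambda>y. c * f y) x = c * kop k f x"
  by (simp add: kop_def sum_distrib_left algebra_simps)

lemma kop_bound:
  assumes "x \<in> carrier G" "\<And>y. y \<in> carrier G \<Longrightarrow> \<bar>k x y\<bar> \<le> B" "\<And>y. y \<in> carrier G \<Longrightarrow> \<bar>f y\<bar> \<le> C"
  shows "\<bar>kop k f x\<bar> \<le> real (card S) * B * C"
proof -
  have B: "0 \<le> B" using assms(2)[OF assms(1)] by linarith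
  have "\<bar>kop k f x\<bar> \<le> (\<Sum>s\<in>S. \<bar>k x (x \<otimes> s) * f (x \<otimes> s)\<bar>)"
    unfolding kop_def by (rule sum_abs)
  also have "\<dots> \<le> (\<Sum>s\<in>S. B * C)"
    unfolding abs_mult using assms mult_S B by (intro sum_mono mult_mono) auto
  finally show ?thesis by simp
qed

lemma kops_bounded:
  assumes "\<And>k. k \<in> set ks \<Longrightarrow> random_kernel k" "\<And>y. y \<in> carrier G \<Longrightarrow> \<bar>f y\<bar> \<le> C"
  shows "\<exists>B. \<forall>\<omega>\<in>space M. \<forall>x\<in>carrier G. \<bar>kops \<omega> ks f x\<bar> \<le> B"
  using assms(1)
proof (induction ks)
  case Nil
  then show ?case using assms(2) by auto
next
  case (Cons k ks)
  then obtain B where B: "\<And>\<omega> x. \<omega> \<in> space M \<Longrightarrow> x \<in> carrier G \<Longrightarrow> \<bar>kops \<omega> ks f x\<bar> \<le> B" by auto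
  have "random_kernel k" using Cons.prems by simp
  then obtain B' where B': "\<And>\<omega> x y. \<omega> \<in> space M \<Longrightarrow> x \<in> carrier G \<Longrightarrow>
      y \<in> carrier G \<Longrightarrow> \<bar>k \<omega> x y\<bar> \<le> B'"
    unfolding random_kernel_def by blast
  have "\<bar>kops \<omega> (k # ks) f x\<bar> \<le> real (card S) * B' * B" if "\<omega> \<in> space M" "x \<in> carrier G" for \<omega> x
    unfolding kops_simps by (rule kop_bound[OF that(2)]) (use B B' that in auto)
  thus ?case by blast
qed

lemma kops_measurable:
  assumes "\<And>k. k \<in> set ks \<Longrightarrow> random_kernel k" "x \<in> carrier G"
  shows "(\<lambda>\<omega>. kops \<omega> ks f x) \<in> borel_measurable M"
  using assms
proof (induction ks arbitrary: x)
  case (Cons k ks)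
  have "random_kernel k" using Cons.prems by simp
  then show ?case unfolding kops_simps kop_def
    using Cons mult_S
    by (intro borel_measurable_sum borel_measurable_times) (auto simp: random_kernel_def)
qed simp

lemma kops_integrable:
  assumes "\<And>k. k \<in> set ks \<Longrightarrow> random_kernel k" "x \<in> carrier G"
  shows "integrable M (\<lambda>\<omega>. kops \<omega> ks (indicator {z}) x)"
proof -
  obtain B where "\<forall>\<omega>\<in>space M. \<forall>x\<in>carrier G. \<bar>kops \<omega> ks (indicator {z}) x\<bar> \<le> B"
    using kops_bounded[OF assms(1), of ks "indicator {z}" 1] by (auto simp: indicator_def)
  thus ?thesis using assms(2)
    by (intro integrable_const_bound[of _ B] kops_measurable assms) auto
qed

lemma kops_equivariant:
  assumes "\<And>k. k \<in> set ks \<Longrightarrow> random_kernel k" "\<omega> \<in> space M" "g \<in> carrier G" "x \<in> carrier G"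
    and "\<And>y. y \<in> carrier G \<Longrightarrow> f' (g \<otimes> y) = f y"
  shows "kops (\<theta> g \<omega>) ks f' (g \<otimes> x) = kops \<omega> ks f x"
  using assms(1,4)
proof (induction ks arbitrary: x)
  case (Cons k ks)
  have "random_kernel k" using Cons.prems by simp
  hence "k (\<theta> g \<omega>) (g \<otimes> x) (g \<otimes> (x \<otimes> s)) = k \<omega> x (x \<otimes> s)" if "s \<in> S" for s
    unfolding random_kernel_def using assms Cons.prems mult_S that by blast
  then show ?case unfolding kops_simps kop_def
    using Cons assms(3) S mult_S by (intro sum.cong) (auto simp: m_assoc subset_iff)
qed (use assms in auto)

text \<open>Mass transport: moving the target of each jump of the outermost kernel back to the identity
  by \<open>\<theta>\<close> turns it into the innermost kernel.\<close>
lemma tr_rotate1: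
  assumes k: "random_kernel k" and ks: "\<And>l. l \<in> set ks \<Longrightarrow> random_kernel l"
  shows "tr (k # ks) = tr (ks @ [k])"
proof -
  define h where "h s \<omega> = k \<omega> (inv s) \<one> * kops \<omega> ks (indicator {inv s}) \<one>" for s \<omega>
  have Sc: "s \<in> carrier G" if "s \<in> S" for s using S that by auto
  have hm: "h s \<in> borel_measurable M" if "s \<in> S" for s
    unfolding h_def using k Sc[OF that]
    by (intro borel_measurable_times kops_measurable ks) (auto simp: random_kernel_def)
  have hi: "integrable M (h s)" if "s \<in> S" for s
  proof -
    obtain B' where B': "\<And>\<omega> x y. \<omega> \<in> space M \<Longrightarrow> x \<in> carrier G \<Longrightarrow> y \<in> carrier G \<Longrightarrow> \<bar>k \<omega> x y\<bar> \<le> B'"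
      using k unfolding random_kernel_def by blast
    obtain C where "\<forall>\<omega>\<in>space M. \<forall>x\<in>carrier G. \<bar>kops \<omega> ks (indicator {inv s}) x\<bar> \<le> C"
      using kops_bounded[OF ks, of ks "indicator {inv s}" 1] by (auto simp: indicator_def)
    hence C: "\<bar>kops \<omega> ks (indicator {inv s}) \<one>\<bar> \<le> C" if "\<omega> \<in> space M" for \<omega>
      using that one_closed by blast
    have "\<bar>h s \<omega>\<bar> \<le> B' * C" if "\<omega> \<in> space M" for \<omega>
      unfolding h_def abs_mult
    proof (rule mult_mono)
      show "\<bar>k \<omega> (inv s) \<one>\<bar> \<le> B'" using B'[OF that] Sc[OF \<open>s \<in> S\<close>] by simp
      thus "0 \<le> B'" by linarith
    qed (use C[OF that] in simp_all)
    thus ?thesis using hm[OF that] by (intro integrable_const_bound[of _ "B' * C"] AE_I2) auto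
  qed
  have shift: "k \<omega> \<one> s * kops \<omega> ks (indicator {\<one>}) s = h s (\<theta> (inv s) \<omega>)"
    if s: "s \<in> S" and \<omega>: "\<omega> \<in> space M" for s \<omega>
  proof -
    have "k (\<theta> (inv s) \<omega>) (inv s \<otimes> \<one>) (inv s \<otimes> s) = k \<omega> \<one> s"
      using k Sc[OF s] \<omega> unfolding random_kernel_def by blast
    moreover have "kops (\<theta> (inv s) \<omega>) ks (indicator {inv s}) (inv s \<otimes> s) = kops \<omega> ks (indicator {\<one>}) s"
      using Sc[OF s] \<omega>
      by (intro kops_equivariant ks) (auto simp: indicator_def r_cancel_one')
    ultimately show ?thesis using Sc[OF s] by (simp add: h_def)
  qed
  have eqint: "(\<integral>\<omega>. h s (\<theta> (inv s) \<omega>) \<partial>M) = (\<integral>\<omega>. h s \<omega> \<partial>M)"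
    "integrable M (\<lambda>\<omega>. h s (\<theta> (inv s) \<omega>))" if s: "s \<in> S" for s
    using integral_distr[OF \<theta>_measurable hm, of "inv s" s] \<theta>_invariant[of "inv s"] s Sc[OF s]
      integrable_distr_eq[OF \<theta>_measurable hm, of "inv s" s] hi[OF s]
    by auto
  have "tr (k # ks) = (\<integral>\<omega>. (\<Sum>s\<in>S. h s (\<theta> (inv s) \<omega>)) \<partial>M)"
    unfolding tr_def
    by (intro Bochner_Integration.integral_cong refl)
       (auto simp: kop_def shift[symmetric] Sc intro!: sum.cong)
  also have "\<dots> = (\<Sum>s\<in>S. \<integral>\<omega>. h s \<omega> \<partial>M)"
    by (subst Bochner_Integration.integral_sum) (auto simp: eqint)
  also have "\<dots> = (\<integral>\<omega>. (\<Sum>s\<in>S. h s \<omega>) \<partial>M)"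
    by (rule Bochner_Integration.integral_sum[symmetric]) (rule hi)
  also have "\<dots> = tr (ks @ [k])"
    unfolding tr_def
  proof (intro Bochner_Integration.integral_cong refl)
    fix \<omega>
    \<comment> \<open>Applied to the delta function at the identity, the innermost kernel charges
      exactly the points \<open>inv s\<close>, with the weights already occurring in
      \<open>h\<close>.\<close>
    have "kop (k \<omega>) (indicator {\<one>}) y = (\<Sum>s\<in>S. k \<omega> (inv s) \<one> * indicator {inv s} y)"
      if y: "y \<in> carrier G" for y
      unfolding kop_def
    proof (rule sum.cong)
      fix s assume s: "s \<in> S"
      have "y \<otimes> s = \<one> \<longleftrightarrow> y = inv s"
        using y Sc[OF s] by (metis inv_equality l_inv)
      thus "k \<omega> y (y \<otimes> s) * indicator {\<one>} (y \<otimes> s) = k \<omega> (inv s) \<one> * indicator {inv s} y"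
        by (auto simp: indicator_def)
    qed simp
    hence "kops \<omega> ks (kop (k \<omega>) (indicator {\<one>})) \<one>
        = kops \<omega> ks (\<lambda>y. \<Sum>s\<in>S. k \<omega> (inv s) \<one> * indicator {inv s} y) \<one>"
      by (intro kops_cong) auto
    thus "(\<Sum>s\<in>S. h s \<omega>) = kops \<omega> (ks @ [k]) (indicator {\<one>}) \<one>"
      by (simp add: kops_sum h_def)
  qed
  finally show ?thesis .
qed

lemma tr_commute:
  assumes "\<And>k. k \<in> set ks \<Longrightarrow> random_kernel k" "\<And>k. k \<in> set ls \<Longrightarrow> random_kernel k"
  shows "tr (ks @ ls) = tr (ls @ ks)"
  using assms
proof (induction ks arbitrary: ls)
  case (Cons k ks)
  have "tr ((k # ks) @ ls) = tr ((ks @ ls) @ [k])"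
    using tr_rotate1[of k "ks @ ls"] Cons.prems by auto
  also have "\<dots> = tr (ks @ (ls @ [k]))" by simp
  also have "\<dots> = tr ((ls @ [k]) @ ks)" using Cons.prems by (intro Cons.IH) auto
  finally show ?case by simp
qed simp

lemma integral_moment_eval:
  assumes "random_kernel k"
  shows "(\<integral>\<omega>. moment_eval (\<lambda>i. (kop (k \<omega>) ^^ i) (indicator {\<one>}) \<one>) q \<partial>M)
    = moment_eval (\<lambda>i. tr (replicate i k)) q"
    and "integrable M (\<lambda>\<omega>. moment_eval (\<lambda>i. (kop (k \<omega>) ^^ i) (indicator {\<one>}) \<one>) q)"
proof -
  have i: "integrable M (\<lambda>\<omega>. kops \<omega> (replicate i k) (indicator {\<one>}) \<one>)" for i
    using assms by (intro kops_integrable) auto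
  show "(\<integral>\<omega>. moment_eval (\<lambda>i. (kop (k \<omega>) ^^ i) (indicator {\<one>}) \<one>) q \<partial>M)
    = moment_eval (\<lambda>i. tr (replicate i k)) q"
    "integrable M (\<lambda>\<omega>. moment_eval (\<lambda>i. (kop (k \<omega>) ^^ i) (indicator {\<one>}) \<one>) q)"
    unfolding moment_eval_def tr_def kops_replicate[symmetric] using i by simp_all
qed

end

section \<open>The trace along an affine path of kernels\<close>

locale kernel_interpolation = random_kernels G M S \<theta>
  for G :: "('g, 'r) monoid_scheme" (structure) and M :: "'w measure" and S \<theta> +
  fixes K :: "real \<Rightarrow> 'w \<Rightarrow> 'g \<Rightarrow> 'g \<Rightarrow> real" and c :: "'w \<Rightarrow> 'g \<Rightarrow> real" and B :: real
  assumes affine: "K s \<omega> x y = K t \<omega> x y + (s - t) * (if x = y then c \<omega> x else 0)"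
    and K_bound: "t \<in> {0..1} \<Longrightarrow> \<omega> \<in> space M \<Longrightarrow> x \<in> carrier G \<Longrightarrow> y \<in> carrier G \<Longrightarrow> \<bar>K t \<omega> x y\<bar> \<le> B"
    and c_bound: "\<omega> \<in> space M \<Longrightarrow> x \<in> carrier G \<Longrightarrow> \<bar>c \<omega> x\<bar> \<le> B"
    and K_random: "t \<in> {0..1} \<Longrightarrow> random_kernel (K t)"
    and D_random: "random_kernel (\<lambda>\<omega> x y. if x = y then c \<omega> x else 0)"
begin

text \<open>Not the degree operator: multiplication by the velocity \<open>c\<close> of the path,
  which in the application is \<open>k\<close> minus the degree at the vertices of the random
  graph.\<close>

abbreviation "D \<equiv> \<lambda>\<omega> x y. if x = y then c \<omega> x else 0"
text \<open>Bounds the norm of every \<open>kop (K t \<omega>)\<close>, with \<open>t\<close> in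
  \<open>[0,1]\<close>, on bounded functions.\<close>

abbreviation "\<beta> \<equiv> real (card S) * B"

lemma B_nonneg: "0 \<le> B"
proof -
  obtain \<omega> where "\<omega> \<in> space M" using not_empty by blast
  from c_bound[OF this one_closed] show ?thesis by linarith
qed

lemma \<beta>_nonneg: "0 \<le> \<beta>" using B_nonneg by simp

lemma kop_D: "x \<in> carrier G \<Longrightarrow> kop (D \<omega>) f x = c \<omega> x * f x"
proof -
  assume x: "x \<in> carrier G"
  have "kop (D \<omega>) f x = (\<Sum>s\<in>S. if s = \<one> then c \<omega> x * f x else 0)"
    unfolding kop_def using x S by (intro sum.cong) (auto simp: l_cancel_one l_cancel_one' subset_iff)
  thus ?thesis using S by simp
qed

lemma kop_affine: "kop (K s \<omega>) f x - kop (K t \<omega>) f x = (s - t) * kop (D \<omega>) f x"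
  unfolding kop_def affine[of s \<omega> _ _ t]
  by (simp add: sum_subtractf[symmetric] sum_distrib_left algebra_simps)

lemma kop_diff_split:
  "kop (K s \<omega>) f x - kop (K t \<omega>) g x = kop (K s \<omega>) (\<lambda>y. f y - g y) x + (s - t) * kop (D \<omega>) g x"
  using kop_affine[of s \<omega> g x t] by (simp add: kop_diff)

text \<open>Noncommutative telescoping: \<open>a^n - b^n\<close> is the sum of
  \<open>a^j (a - b) b^(n-1-j)\<close> over \<open>j < n\<close>, with \<open>a - b\<close> equal to
  \<open>s - t\<close> times \<open>D\<close>.\<close>

lemma pow_diff:
  "kops \<omega> (replicate n (K s)) f x - kops \<omega> (replicate n (K t)) f x
    = (s - t) * (\<Sum>j<n. kops \<omega> (replicate j (K s) @ D # replicate (n - 1 - j) (K t)) f x)"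
proof (induction n arbitrary: x)
  case (Suc n)
  let ?h = "\<lambda>j x. kops \<omega> (replicate j (K s) @ D # replicate (n - 1 - j) (K t)) f x"
  have "kops \<omega> (replicate (Suc n) (K s)) f x - kops \<omega> (replicate (Suc n) (K t)) f x
     = kop (K s \<omega>) (\<lambda>y. kops \<omega> (replicate n (K s)) f y - kops \<omega> (replicate n (K t)) f y) x
       + (s - t) * kop (D \<omega>) (kops \<omega> (replicate n (K t)) f) x"
    by (simp add: kop_diff_split)
  also have "\<dots> = (s - t) * (\<Sum>j<n. kop (K s \<omega>) (?h j) x)
      + (s - t) * kop (D \<omega>) (kops \<omega> (replicate n (K t)) f) x"
    unfolding Suc.IH kop_scale using kop_sum[of "K s \<omega>" "\<lambda>_. 1" ?h "{..<n}"] by simp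
  also have "\<dots> = (s - t) * (\<Sum>j<Suc n. kops \<omega> (replicate j (K s) @ D # replicate (Suc n - 1 - j) (K t)) f x)"
    unfolding sum.lessThan_Suc_shift by (simp add: distrib_left)
  finally show ?case .
qed simp

lemma pow_bound:
  assumes "t \<in> {0..1}" "\<omega> \<in> space M" "x \<in> carrier G" "\<And>y. y \<in> carrier G \<Longrightarrow> \<bar>f y\<bar> \<le> C"
  shows "\<bar>kops \<omega> (replicate n (K t)) f x\<bar> \<le> \<beta> ^ n * C"
  using assms(3)
proof (induction n arbitrary: x)
  case (Suc n)
  from kop_bound[OF Suc.prems, of "K t \<omega>" B, OF _ Suc.IH] K_bound[OF assms(1,2) Suc.prems]
  show ?case by (simp add: mult_ac)
qed (use assms in auto)

text \<open>Induction through \<open>a^(n+1) - b^(n+1) = a (a^n - b^n) + (a - b) b^n\<close>. The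
  base \<open>\<beta> + 1\<close> is at least one, so a single power dominates both terms even when
  \<open>\<beta> < 1\<close>.\<close>

lemma pow_lipschitz:
  assumes "s \<in> {0..1}" "t \<in> {0..1}" "\<omega> \<in> space M" "x \<in> carrier G" "\<And>y. y \<in> carrier G \<Longrightarrow> \<bar>f y\<bar> \<le> 1"
  shows "\<bar>kops \<omega> (replicate n (K s)) f x - kops \<omega> (replicate n (K t)) f x\<bar> \<le> real n * B * (\<beta> + 1) ^ n * \<bar>s - t\<bar>"
  using assms(4)
proof (induction n arbitrary: x)
  case (Suc n)
  let ?d = "\<lambda>y. kops \<omega> (replicate n (K s)) f y - kops \<omega> (replicate n (K t)) f y"
  let ?g = "kops \<omega> (replicate n (K t)) f"
  have 1: "\<bar>kop (K s \<omega>) ?d x\<bar> \<le> \<beta> * (real n * B * (\<beta> + 1) ^ n * \<bar>s - t\<bar>)"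
    by (rule kop_bound[OF Suc.prems _ Suc.IH]) (use K_bound assms Suc.prems in auto)
  have "\<bar>?g x\<bar> \<le> \<beta> ^ n" using pow_bound[OF assms(2,3) Suc.prems assms(5), where n=n] by simp
  also have "\<dots> \<le> (\<beta> + 1) ^ n" by (rule power_mono) (use \<beta>_nonneg in auto)
  also have "\<dots> \<le> (\<beta> + 1) ^ Suc n" by (rule power_increasing) (use \<beta>_nonneg in auto)
  finally have "\<bar>c \<omega> x * ?g x\<bar> \<le> B * (\<beta> + 1) ^ Suc n"
    unfolding abs_mult using c_bound[OF assms(3) Suc.prems] B_nonneg by (intro mult_mono) auto
  hence 2: "\<bar>(s - t) * kop (D \<omega>) ?g x\<bar> \<le> \<bar>s - t\<bar> * (B * (\<beta> + 1) ^ Suc n)"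
    unfolding kop_D[OF Suc.prems] abs_mult[of "s - t"] by (rule mult_left_mono) simp
  have "\<beta> * (real n * B * (\<beta> + 1) ^ n * \<bar>s - t\<bar>) \<le> (\<beta> + 1) * (real n * B * (\<beta> + 1) ^ n * \<bar>s - t\<bar>)"
    using B_nonneg \<beta>_nonneg by (intro mult_right_mono mult_nonneg_nonneg) auto
  with 1 2 have "\<bar>kop (K s \<omega>) ?d x + (s - t) * kop (D \<omega>) ?g x\<bar>
      \<le> (\<beta> + 1) * (real n * B * (\<beta> + 1) ^ n * \<bar>s - t\<bar>) + \<bar>s - t\<bar> * (B * (\<beta> + 1) ^ Suc n)"
    by linarith
  also have "\<dots> = real (Suc n) * B * (\<beta> + 1) ^ Suc n * \<bar>s - t\<bar>"
    by (simp add: algebra_simps)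
  finally show ?case by (simp add: kop_diff_split)
qed simp

text \<open>Exchanging the \<open>j\<close> factors at \<open>s\<close> for factors at
  \<open>t\<close> costs a multiple of \<open>\<bar>s - t\<bar>\<close>; together with the prefactor
  \<open>s - t\<close> of the telescoped difference the total error becomes quadratic.\<close>

lemma tr_mixed_bound:
  assumes st: "s \<in> {0..1}" "t \<in> {0..1}" and jn: "j + l = n"
  shows "\<bar>tr (D # replicate l (K t) @ replicate j (K s)) - tr (D # replicate n (K t))\<bar>
    \<le> B * \<beta> ^ l * (real j * B * (\<beta> + 1) ^ j) * \<bar>s - t\<bar>"
proof -
  let ?f = "\<lambda>\<omega>. kops \<omega> (D # replicate l (K t) @ replicate j (K s)) (indicator {\<one>}) \<one>"
  let ?g = "\<lambda>\<omega>. kops \<omega> (D # replicate n (K t)) (indicator {\<one>}) \<one>"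
  have int: "integrable M ?f" "integrable M ?g"
    using K_random st D_random by (auto intro!: kops_integrable simp del: kops_simps)
  have rn: "replicate n (K t) = replicate l (K t) @ replicate j (K t)"
    using jn by (simp add: replicate_add[symmetric] add.commute)
  have lin: "kops \<omega> ks (\<lambda>y. f y - g y) = (\<lambda>x. kops \<omega> ks f x - kops \<omega> ks g x)" for \<omega> ks f g
    by (induction ks) (auto simp: kop_diff)
  have pt: "\<bar>?f \<omega> - ?g \<omega>\<bar> \<le> B * \<beta> ^ l * (real j * B * (\<beta> + 1) ^ j) * \<bar>s - t\<bar>" if \<omega>: "\<omega> \<in> space M" for \<omega>
  proof -
    let ?d = "\<lambda>y. kops \<omega> (replicate j (K s)) (indicator {\<one>}) y - kops \<omega> (replicate j (K t)) (indicator {\<one>}) y"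
    have "?f \<omega> - ?g \<omega> = c \<omega> \<one> * kops \<omega> (replicate l (K t)) ?d \<one>"
      unfolding rn by (simp add: kop_D lin algebra_simps)
    moreover have "\<bar>kops \<omega> (replicate l (K t)) ?d \<one>\<bar> \<le> \<beta> ^ l * (real j * B * (\<beta> + 1) ^ j * \<bar>s - t\<bar>)"
      by (rule pow_bound[OF st(2) \<omega> one_closed pow_lipschitz[OF st \<omega>]]) (auto simp: indicator_def)
    ultimately have "\<bar>?f \<omega> - ?g \<omega>\<bar> \<le> B * (\<beta> ^ l * (real j * B * (\<beta> + 1) ^ j * \<bar>s - t\<bar>))"
      using c_bound[OF \<omega> one_closed] B_nonneg by (simp add: abs_mult mult_mono)
    thus ?thesis by (simp add: mult_ac)
  qed
  have eq: "tr (D # replicate l (K t) @ replicate j (K s)) - tr (D # replicate n (K t))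
      = (\<integral>\<omega>. ?f \<omega> - ?g \<omega> \<partial>M)"
    unfolding tr_def using int by (rule Bochner_Integration.integral_diff[symmetric])
  have i: "integrable M (\<lambda>\<omega>. \<bar>?f \<omega> - ?g \<omega>\<bar>)"
    by (rule integrable_abs[OF Bochner_Integration.integrable_diff[OF int]])
  have "(\<integral>\<omega>. \<bar>?f \<omega> - ?g \<omega>\<bar> \<partial>M)
      \<le> (\<integral>\<omega>. B * \<beta> ^ l * (real j * B * (\<beta> + 1) ^ j) * \<bar>s - t\<bar> \<partial>M)"
    by (rule integral_mono[OF i integrable_const pt])
  hence "(\<integral>\<omega>. \<bar>?f \<omega> - ?g \<omega>\<bar> \<partial>M) \<le> B * \<beta> ^ l * (real j * B * (\<beta> + 1) ^ j) * \<bar>s - t\<bar>"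
    using prob_space by simp
  thus ?thesis unfolding eq by (rule order_trans[OF integral_abs_bound])
qed

text \<open>In the telescoped terms \<open>D\<close> stands between powers of two different
  operators. Cyclicity brings it to the front, and then all terms agree at \<open>s = t\<close>, as
  if \<open>D\<close> and \<open>K t\<close> commuted.\<close>

lemma tr_pow_diff:
  assumes st: "s \<in> {0..1}" "t \<in> {0..1}"
  shows "tr (replicate n (K s)) - tr (replicate n (K t))
    = (s - t) * (\<Sum>j<n. tr (D # replicate (n - 1 - j) (K t) @ replicate j (K s)))"
proof -
  have r: "random_kernel (K s)" "random_kernel (K t)" "random_kernel D"
    using K_random st D_random by auto
  have cyc: "tr (replicate j (K s) @ D # replicate (n - 1 - j) (K t))
      = tr (D # replicate (n - 1 - j) (K t) @ replicate j (K s))" for j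
    using r tr_commute[of "replicate j (K s)" "D # replicate (n - 1 - j) (K t)"] by auto
  have "tr (replicate n (K s)) - tr (replicate n (K t))
    = (\<integral>\<omega>. kops \<omega> (replicate n (K s)) (indicator {\<one>}) \<one> - kops \<omega> (replicate n (K t)) (indicator {\<one>}) \<one> \<partial>M)"
    unfolding tr_def using r
    by (intro Bochner_Integration.integral_diff[symmetric] kops_integrable) auto
  also have "\<dots> = (s - t) * (\<Sum>j<n. tr (replicate j (K s) @ D # replicate (n - 1 - j) (K t)))"
  proof -
    have "integrable M (\<lambda>\<omega>. kops \<omega> (replicate j (K s) @ D # replicate (n - 1 - j) (K t)) (indicator {\<one>}) \<one>)" for j
      using r by (intro kops_integrable) auto
    thus ?thesis unfolding pow_diff tr_def by (simp del: kops_simps)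
  qed
  finally show ?thesis unfolding cyc .
qed

lemma tr_pow_second_order:
  "\<exists>C. \<forall>s\<in>{0..1}. \<forall>t\<in>{0..1}. \<bar>tr (replicate n (K s)) - tr (replicate n (K t))
      - (s - t) * (real n * tr (D # replicate (n - 1) (K t)))\<bar> \<le> C * (s - t)\<^sup>2"
proof -
  define C where "C = (\<Sum>j<n. B * \<beta> ^ (n - 1 - j) * (real j * B * (\<beta> + 1) ^ j))"
  show ?thesis
  proof (intro exI[of _ C] ballI)
    fix s t :: real assume st: "s \<in> {0..1}" "t \<in> {0..1}"
    let ?m = "\<lambda>j. tr (D # replicate (n - 1 - j) (K t) @ replicate j (K s)) - tr (D # replicate (n - 1) (K t))"
    have "\<bar>\<Sum>j<n. ?m j\<bar> \<le> (\<Sum>j<n. \<bar>?m j\<bar>)" by (rule sum_abs)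
    also have "\<dots> \<le> (\<Sum>j<n. B * \<beta> ^ (n - 1 - j) * (real j * B * (\<beta> + 1) ^ j) * \<bar>s - t\<bar>)"
      by (intro sum_mono tr_mixed_bound st) auto
    finally have le: "\<bar>\<Sum>j<n. ?m j\<bar> \<le> C * \<bar>s - t\<bar>" by (simp add: C_def sum_distrib_right)
    have "tr (replicate n (K s)) - tr (replicate n (K t))
      - (s - t) * (real n * tr (D # replicate (n - 1) (K t))) = (s - t) * (\<Sum>j<n. ?m j)"
      unfolding tr_pow_diff[OF st] by (simp add: sum_subtractf algebra_simps)
    hence "\<bar>tr (replicate n (K s)) - tr (replicate n (K t))
      - (s - t) * (real n * tr (D # replicate (n - 1) (K t)))\<bar> \<le> \<bar>s - t\<bar> * (C * \<bar>s - t\<bar>)"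
      using mult_left_mono[OF le, of "\<bar>s - t\<bar>"] by (simp only: abs_mult abs_ge_zero)
    thus "\<bar>tr (replicate n (K s)) - tr (replicate n (K t))
      - (s - t) * (real n * tr (D # replicate (n - 1) (K t)))\<bar> \<le> C * (s - t)\<^sup>2"
      using power2_abs[of "s - t"] by (simp add: power2_eq_square mult.left_commute)
  qed
qed

text \<open>With \<open>D\<close> in front, the derivative of the trace of \<open>q(K t)\<close> is
  the expectation of the scalar \<open>c \<omega> \<one>\<close> times a diagonal entry of
  \<open>q'(K t)\<close>, so a pointwise sign at the identity is enough. The quadratic remainders of
  the powers are combined with the coefficients of \<open>q\<close>.\<close>

theorem moment_eval_antimono:
  assumes neg: "\<And>t \<omega>. t \<in> {0..1} \<Longrightarrow> \<omega> \<in> space M \<Longrightarrow>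
      c \<omega> \<one> * moment_eval (\<lambda>i. (kop (K t \<omega>) ^^ i) (indicator {\<one>}) \<one>) (pderiv q) \<le> 0"
  shows "(\<integral>\<omega>. moment_eval (\<lambda>i. (kop (K 1 \<omega>) ^^ i) (indicator {\<one>}) \<one>) q \<partial>M)
    \<le> (\<integral>\<omega>. moment_eval (\<lambda>i. (kop (K 0 \<omega>) ^^ i) (indicator {\<one>}) \<one>) q \<partial>M)"
proof -
  define F where "F t = moment_eval (\<lambda>i. tr (replicate i (K t))) q" for t
  define F' where "F' t = (\<Sum>i\<le>degree q. coeff q i * (real i * tr (D # replicate (i - 1) (K t))))" for t
  have F': "F' t \<le> 0" if t: "t \<in> {0..1}" for t
  proof -
    have int: "integrable M (\<lambda>\<omega>. kops \<omega> (D # replicate i (K t)) (indicator {\<one>}) \<one>)" for i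
      using K_random[OF t] D_random by (intro kops_integrable) auto
    have "F' t = (\<integral>\<omega>. (\<Sum>i\<le>degree q. coeff q i * (real i * kops \<omega> (D # replicate (i - 1) (K t)) (indicator {\<one>}) \<one>)) \<partial>M)"
      unfolding F'_def tr_def using int by (simp del: kops_simps)
    also have "\<dots> = (\<integral>\<omega>. c \<omega> \<one> * moment_eval (\<lambda>i. (kop (K t \<omega>) ^^ i) (indicator {\<one>}) \<one>) (pderiv q) \<partial>M)"
      by (simp add: kop_D moment_eval_pderiv kops_replicate sum_distrib_left mult_ac)
    also have "\<dots> \<le> (\<integral>\<omega>. 0 \<partial>M)"
    proof (rule integral_mono_AE')
      show "integrable M (\<lambda>\<omega>. 0 :: real)" by simp
      show "AE \<omega> in M. c \<omega> \<one> * moment_eval (\<lambda>i. (kop (K t \<omega>) ^^ i) (indicator {\<one>}) \<one>) (pderiv q) \<le> 0"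
        using neg[OF t] by (rule AE_I2)
    qed simp
    finally show ?thesis by simp
  qed
  from choice[OF allI[OF tr_pow_second_order]] obtain C where "\<forall>n. \<forall>s\<in>{0..1}. \<forall>t\<in>{0..1}.
      \<bar>tr (replicate n (K s)) - tr (replicate n (K t))
        - (s - t) * (real n * tr (D # replicate (n - 1) (K t)))\<bar> \<le> C n * (s - t)\<^sup>2" ..
  hence C: "\<bar>tr (replicate n (K s)) - tr (replicate n (K t))
        - (s - t) * (real n * tr (D # replicate (n - 1) (K t)))\<bar> \<le> C n * (s - t)\<^sup>2"
    if "s \<in> {0..1}" "t \<in> {0..1}" for n s t using that by blast
  have "F 1 \<le> F 0"
  proof (rule second_order_nonincreasing)
    fix s t :: real assume st: "0 \<le> t" "t \<le> s" "s \<le> 1"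
    let ?r = "\<lambda>i. tr (replicate i (K s)) - tr (replicate i (K t))
        - (s - t) * (real i * tr (D # replicate (i - 1) (K t)))"
    have "F s - F t - (s - t) * F' t = (\<Sum>i\<le>degree q. coeff q i * ?r i)"
      unfolding F_def F'_def moment_eval_def
      by (simp add: sum_subtractf[symmetric] sum_distrib_left algebra_simps)
    also have "\<dots> \<le> (\<Sum>i\<le>degree q. \<bar>coeff q i * ?r i\<bar>)" by (intro sum_mono) simp
    also have "\<dots> \<le> (\<Sum>i\<le>degree q. \<bar>coeff q i\<bar> * (C i * (s - t)\<^sup>2))"
      unfolding abs_mult using st by (intro sum_mono mult_left_mono C) auto
    also have "\<dots> = (\<Sum>i\<le>degree q. \<bar>coeff q i\<bar> * C i) * (s - t)\<^sup>2"
      by (simp add: sum_distrib_left sum_distrib_right mult_ac)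
    finally show "F s - F t \<le> (\<Sum>i\<le>degree q. \<bar>coeff q i\<bar> * C i) * (s - t)\<^sup>2"
      using mult_nonneg_nonpos[of "s - t" "F' t"] F'[of t] st by auto
  qed
  thus ?thesis unfolding F_def using integral_moment_eval(1)[OF K_random] by simp
qed

end

section \<open>The lamplighter graph\<close>

definition lamp_group :: "nat \<Rightarrow> lamp monoid" where
  "lamp_group m = \<lparr>carrier = lamp_verts m, monoid.mult = lamp_mult m, one = lamp_id\<rparr>"

lemma lamp_group_simps [simp]:
  "carrier (lamp_group m) = lamp_verts m" "\<one>\<^bsub>lamp_group m\<^esub> = lamp_id"
  "x \<otimes>\<^bsub>lamp_group m\<^esub> y = lamp_mult m x y"
  by (simp_all add: lamp_group_def)

lemma lamp_id_in_verts: "0 < m \<Longrightarrow> lamp_id \<in> lamp_verts m"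
  by (simp add: lamp_id_def lamp_verts_def)

lemma lamp_mult_in_verts:
  assumes "0 < m" "g \<in> lamp_verts m" "h \<in> lamp_verts m"
  shows "lamp_mult m g h \<in> lamp_verts m"
proof -
  have "finite {z. fst h (z - snd g) \<noteq> 0}"
  proof -
    have "{z. fst h (z - snd g) \<noteq> 0} = (\<lambda>z. z + snd g) ` {z. fst h z \<noteq> 0}"
      by (auto intro!: image_eqI[where x="_ - snd g"])
    thus ?thesis using assms(3) by (auto simp: lamp_verts_def)
  qed
  moreover have "finite {z. fst g z \<noteq> 0}" using assms(2) by (auto simp: lamp_verts_def)
  ultimately have "finite {z. (fst g z + fst h (z - snd g)) mod int m \<noteq> 0}"
    by (auto intro: finite_subset[of _ "{z. fst g z \<noteq> 0} \<union> {z. fst h (z - snd g) \<noteq> 0}"])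
  thus ?thesis using assms(1) by (simp add: lamp_mult_def lamp_verts_def)
qed

lemma group_lamp_group:
  assumes m: "0 < m"
  shows "group (lamp_group m)"
proof (rule groupI)
  fix g assume g: "g \<in> carrier (lamp_group m)"
  define h where "h = ((\<lambda>z. (- fst g (z + snd g)) mod int m), - snd g)"
  have "{z. fst g (z + snd g) \<noteq> 0} = (\<lambda>z. z - snd g) ` {z. fst g z \<noteq> 0}"
    by (auto intro!: image_eqI[where x="_ + snd g"])
  hence "finite {z. fst g (z + snd g) \<noteq> 0}" using g by (auto simp: lamp_verts_def)
  hence "finite {z. (- fst g (z + snd g)) mod int m \<noteq> 0}"
    by (rule finite_subset[rotated]) auto
  hence "h \<in> lamp_verts m" using m by (simp add: h_def lamp_verts_def)
  moreover have "lamp_mult m h g = lamp_id"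
    by (simp add: lamp_mult_def lamp_id_def h_def mod_simps)
  ultimately show "\<exists>h\<in>carrier (lamp_group m). h \<otimes>\<^bsub>lamp_group m\<^esub> g = \<one>\<^bsub>lamp_group m\<^esub>" by auto
qed (use m in \<open>auto simp: lamp_mult_in_verts lamp_id_in_verts\<close>,
     auto simp: lamp_mult_def lamp_id_def lamp_verts_def mod_simps algebra_simps mod_pos_pos_trivial)

text \<open>Adding every residue to a lamp amounts to setting it to every value, so neighbours arise
  by overwriting. A step up resets the lamp at the site of arrival, a step down the one at the site
  of departure: on the passage between \<open>x\<close> and \<open>x + 1\<close> it is the lamp at
  \<open>x + 1\<close> either way, which makes adjacency symmetric.\<close>

definition up_nbrs :: "nat \<Rightarrow> lamp \<Rightarrow> lamp set" where
  "up_nbrs m g = (\<lambda>l. ((fst g)(snd g + 1 := l), snd g + 1)) ` {0..<int m}"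

definition down_nbrs :: "nat \<Rightarrow> lamp \<Rightarrow> lamp set" where
  "down_nbrs m g = (\<lambda>l. ((fst g)(snd g := l), snd g - 1)) ` {0..<int m}"

definition nbrs :: "nat \<Rightarrow> lamp \<Rightarrow> lamp set" where
  "nbrs m g = up_nbrs m g \<union> down_nbrs m g"

lemma S0_alt: "S0 m = (\<lambda>l. ((\<lambda>z. if z = 1 then l else 0), 1)) ` {0..<int m}
    \<union> (\<lambda>l. ((\<lambda>z. if z = 0 then l else 0), -1)) ` {0..<int m}"
  by (auto simp: S0_def)

lemma finite_S0: "finite (S0 m)"
  by (simp add: S0_alt)

lemma S0_subset: "0 < m \<Longrightarrow> S0 m \<subseteq> lamp_verts m"
  by (auto simp: S0_def lamp_verts_def)

lemma mod_shift_image: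
  assumes "0 < m"
  shows "(\<lambda>l. (a + l) mod int m) ` {0..<int m} = {0..<int m}"
proof (intro equalityI subsetI)
  fix l assume l: "l \<in> {0..<int m}"
  have "l = (a + (l - a) mod int m) mod int m" using l by (simp add: mod_simps)
  thus "l \<in> (\<lambda>l. (a + l) mod int m) ` {0..<int m}" using assms by (intro image_eqI) auto
qed (use assms in auto)

lemma lamp_mult_S0:
  assumes m: "0 < m" and g: "g \<in> lamp_verts m"
  shows "lamp_mult m g ` S0 m = nbrs m g"
proof -
  have r: "fst g z mod int m = fst g z" for z
    using g by (auto simp: lamp_verts_def)
  have 1: "lamp_mult m g ((\<lambda>z. if z = 1 then l else 0), 1)
      = ((fst g)(snd g + 1 := (fst g (snd g + 1) + l) mod int m), snd g + 1)" for l
    by (auto simp: lamp_mult_def r fun_eq_iff)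
  have 2: "lamp_mult m g ((\<lambda>z. if z = 0 then l else 0), -1)
      = ((fst g)(snd g := (fst g (snd g) + l) mod int m), snd g - 1)" for l
    by (auto simp: lamp_mult_def r fun_eq_iff)
  have "(\<lambda>l. lamp_mult m g ((\<lambda>z. if z = 1 then l else 0), 1)) ` {0..<int m} = up_nbrs m g"
    unfolding 1 up_nbrs_def
    by (subst (2) mod_shift_image[OF m, of "fst g (snd g + 1)", symmetric]) (simp only: image_image)
  moreover have "(\<lambda>l. lamp_mult m g ((\<lambda>z. if z = 0 then l else 0), -1)) ` {0..<int m} = down_nbrs m g"
    unfolding 2 down_nbrs_def
    by (subst (2) mod_shift_image[OF m, of "fst g (snd g)", symmetric]) (simp only: image_image)
  ultimately show ?thesis by (simp add: S0_alt nbrs_def image_Un image_image)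
qed

lemma card_up_nbrs: "card (up_nbrs m g) = m"
  unfolding up_nbrs_def by (subst card_image) (auto simp: inj_on_def fun_upd_eqD)

lemma card_down_nbrs: "card (down_nbrs m g) = m"
  unfolding down_nbrs_def by (subst card_image) (auto simp: inj_on_def fun_upd_eqD)

lemma finite_nbrs [simp]: "finite (up_nbrs m g)" "finite (down_nbrs m g)" "finite (nbrs m g)"
  by (simp_all add: up_nbrs_def down_nbrs_def nbrs_def)

lemma up_down_disjoint: "up_nbrs m g \<inter> down_nbrs m g = {}"
  by (auto simp: up_nbrs_def down_nbrs_def)

lemma card_nbrs: "card (nbrs m g) = 2 * m"
  by (simp add: nbrs_def card_Un_disjoint up_down_disjoint card_up_nbrs card_down_nbrs)

text \<open>Generators are counted as neighbours of the identity, where steps up and down are told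
  apart by their level.\<close>

lemma kdeg_eq: "0 < m \<Longrightarrow> kdeg m = 2 * real m"
proof -
  assume m: "0 < m"
  interpret group "lamp_group m" by (rule group_lamp_group[OF m])
  have "inj_on (lamp_mult m lamp_id) (S0 m)"
    using inj_on_multc S0_subset[OF m] lamp_id_in_verts[OF m] l_one
    by (intro inj_onI) (metis lamp_group_simps subsetD)
  hence "card (S0 m) = 2 * m"
    using card_image[of "lamp_mult m lamp_id" "S0 m"] lamp_mult_S0[OF m lamp_id_in_verts[OF m]] card_nbrs
    by simp
  thus ?thesis by (simp add: kdeg_def)
qed

lemma nbrs_in_verts: "0 < m \<Longrightarrow> g \<in> lamp_verts m \<Longrightarrow> h \<in> nbrs m g \<Longrightarrow> h \<in> lamp_verts m"
  unfolding lamp_mult_S0[symmetric] using S0_subset lamp_mult_in_verts by blast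

lemma nbrs_sym:
  assumes "g \<in> lamp_verts m" "h \<in> nbrs m g"
  shows "g \<in> nbrs m h"
proof -
  have r: "fst g z \<in> {0..<int m}" for z using assms by (auto simp: lamp_verts_def)
  show ?thesis
    using assms(2) unfolding nbrs_def
  proof
    assume "h \<in> up_nbrs m g"
    then obtain l where "h = ((fst g)(snd g + 1 := l), snd g + 1)" by (auto simp: up_nbrs_def)
    hence "g \<in> down_nbrs m h"
      unfolding down_nbrs_def using r[of "snd g + 1"]
      by (intro image_eqI[where x="fst g (snd g + 1)"]) (auto simp: prod_eq_iff)
    thus "g \<in> up_nbrs m h \<union> down_nbrs m h" ..
  next
    assume "h \<in> down_nbrs m g"
    then obtain l where "h = ((fst g)(snd g := l), snd g - 1)" by (auto simp: down_nbrs_def)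
    hence "g \<in> up_nbrs m h"
      unfolding up_nbrs_def using r[of "snd g"]
      by (intro image_eqI[where x="fst g (snd g)"]) (auto simp: prod_eq_iff)
    thus "g \<in> up_nbrs m h \<union> down_nbrs m h" ..
  qed
qed

lemma cay_edges_iff:
  assumes m: "0 < m"
  shows "{x, y} \<in> cay_edges m \<longleftrightarrow> x \<in> lamp_verts m \<and> y \<in> nbrs m x"
proof
  assume "{x, y} \<in> cay_edges m"
  then obtain g s where gs: "{x, y} = {g, lamp_mult m g s}" "g \<in> lamp_verts m" "s \<in> S0 m"
    by (auto simp: cay_edges_def)
  have n: "lamp_mult m g s \<in> nbrs m g" using gs lamp_mult_S0[OF m gs(2)] by blast
  from gs(1) consider "x = g" "y = lamp_mult m g s" | "y = g" "x = lamp_mult m g s"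
    by (auto simp: doubleton_eq_iff)
  thus "x \<in> lamp_verts m \<and> y \<in> nbrs m x"
    by cases (use gs(2) n nbrs_sym[OF gs(2) n] nbrs_in_verts[OF m gs(2) n] in simp_all)
next
  assume a: "x \<in> lamp_verts m \<and> y \<in> nbrs m x"
  then obtain s where "s \<in> S0 m" "y = lamp_mult m x s" using lamp_mult_S0[OF m, of x] by blast
  thus "{x, y} \<in> cay_edges m" using a unfolding cay_edges_def by blast
qed

section \<open>The interpolated Laplacian\<close>

definition gdeg :: "lamp set \<Rightarrow> lamp set set \<Rightarrow> lamp \<Rightarrow> real" where
  "gdeg V E x = real (card {y \<in> V. {x, y} \<in> E})"

definition lapT :: "real \<Rightarrow> nat \<Rightarrow> lamp set \<Rightarrow> lamp set set \<Rightarrow> (lamp \<Rightarrow> real) \<Rightarrow> lamp \<Rightarrow> real" where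
  "lapT t m V E f x = (if x \<in> V
    then (kdeg m + t * (kdeg m - gdeg V E x)) * f x - (\<Sum>y\<in>{y \<in> V. {x, y} \<in> E}. f y) else 0)"

text \<open>The operators act on the whole group and vanish outside \<open>V\<close>, so all
  environments share one index set, as the calculus of equivariant kernels requires.\<close>

definition lap_kernel :: "real \<Rightarrow> nat \<Rightarrow> lamp set \<Rightarrow> lamp set set \<Rightarrow> lamp \<Rightarrow> lamp \<Rightarrow> real" where
  "lap_kernel t m V E x y =
    (if x = y then if x \<in> V then kdeg m + t * (kdeg m - gdeg V E x) else 0 else 0)
    - of_bool (x \<in> V \<and> y \<in> V \<and> {x, y} \<in> E)"

lemma lapA_eq: "lapA m V E = lapT 0 m V E"
  by (auto simp: fun_eq_iff lapA_def lapT_def adjop_def)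

lemma lapD_eq: "lapD m V E = lapT 1 m V E"
  by (auto simp: fun_eq_iff lapD_def lapT_def adjop_def degop_def gdeg_def algebra_simps)

locale lamp_subgraph =
  fixes m :: nat and V :: "lamp set" and E :: "lamp set set"
  assumes m: "2 \<le> m" and V: "V \<subseteq> lamp_verts m" and E: "E \<subseteq> cay_edges m"
begin

lemma m_pos: "0 < m" using m by simp

lemma edge_nbr: "{x, y} \<in> E \<Longrightarrow> x \<in> lamp_verts m \<and> y \<in> nbrs m x"
  using E cay_edges_iff[OF m_pos] by blast

lemma graph_nbrs: "{y \<in> V. {x, y} \<in> E} \<subseteq> nbrs m x"
  using edge_nbr by blast

lemma graph_nbrs_finite [simp]: "finite {y \<in> V. {x, y} \<in> E}"
  by (rule finite_subset[OF graph_nbrs]) simp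

lemma gdeg_le: "gdeg V E x \<le> kdeg m"
  using card_mono[OF _ graph_nbrs, of x] by (simp add: gdeg_def kdeg_eq[OF m_pos] card_nbrs)

lemma gdeg_nonneg: "0 \<le> gdeg V E x"
  by (simp add: gdeg_def)

lemma lapT_superset:
  assumes "finite F" "\<And>x. f x \<noteq> 0 \<Longrightarrow> x \<in> F"
  shows "lapT t m V E f x = (\<Sum>y\<in>F. lap_kernel t m V E x y * f y)"
proof -
  have 1: "(\<Sum>y\<in>F. (if x = y then if x \<in> V then kdeg m + t * (kdeg m - gdeg V E x) else 0 else 0) * f y)
      = (if x \<in> V then (kdeg m + t * (kdeg m - gdeg V E x)) * f x else 0)"
    using assms(1) assms(2)[of x]
    by (cases "x \<in> F") (auto simp: if_distrib[where f="\<lambda>z. z * _"] cong: if_cong)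
  have "(\<Sum>y\<in>F. of_bool (x \<in> V \<and> y \<in> V \<and> {x, y} \<in> E) * f y)
      = (\<Sum>y\<in>F \<inter> {y \<in> V. {x, y} \<in> E}. if x \<in> V then f y else 0)"
    using assms(1) by (intro sum.mono_neutral_cong_right) auto
  also have "\<dots> = (\<Sum>y\<in>{y \<in> V. {x, y} \<in> E}. if x \<in> V then f y else 0)"
    using assms by (intro sum.mono_neutral_left) auto
  also have "\<dots> = (if x \<in> V then (\<Sum>y\<in>{y \<in> V. {x, y} \<in> E}. f y) else 0)" by simp
  finally show ?thesis
    unfolding lap_kernel_def left_diff_distrib sum_subtractf 1 by (simp add: lapT_def)
qed

lemma lap_kernel_sym: "lap_kernel t m V E x y = lap_kernel t m V E y x"
  by (auto simp: lap_kernel_def insert_commute)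

lemma lapT_fin_supp:
  assumes "fin_supp f"
  shows "fin_supp (lapT t m V E f)"
proof -
  let ?F = "{x. f x \<noteq> 0}"
  have "x \<in> ?F \<union> (\<Union>y\<in>?F. nbrs m y)" if "lapT t m V E f x \<noteq> 0" for x
  proof (rule ccontr)
    assume n: "x \<notin> ?F \<union> (\<Union>y\<in>?F. nbrs m y)"
    have "f y = 0" if "y \<in> V" "{x, y} \<in> E" for y
    proof -
      have "x \<in> nbrs m y" using edge_nbr[of y x] that by (simp add: insert_commute)
      thus ?thesis using n by blast
    qed
    hence "lapT t m V E f x = 0" using n by (auto simp: lapT_def)
    thus False using that by simp
  qed
  thus ?thesis using assms unfolding fin_supp_def
    by (auto intro: finite_subset[of _ "?F \<union> (\<Union>y\<in>?F. nbrs m y)"])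
qed

lemma ip_lapT:
  assumes "fin_supp f" "fin_supp g" "finite F" "\<And>x. f x \<noteq> 0 \<Longrightarrow> x \<in> F" "\<And>x. g x \<noteq> 0 \<Longrightarrow> x \<in> F"
  shows "ip (lapT t m V E f) g = (\<Sum>x\<in>F. \<Sum>y\<in>F. lap_kernel t m V E x y * f y * g x)"
  using assms
  by (subst ip_superset[of F]) (auto simp: lapT_fin_supp lapT_superset[OF assms(3,4)] sum_distrib_right)

lemma lapT_sym:
  assumes "fin_supp f" "fin_supp g"
  shows "ip (lapT t m V E f) g = ip f (lapT t m V E g)"
proof -
  let ?F = "{x. f x \<noteq> 0} \<union> {x. g x \<noteq> 0}"
  have F: "finite ?F" using assms by (simp add: fin_supp_def)
  have "ip (lapT t m V E f) g = (\<Sum>x\<in>?F. \<Sum>y\<in>?F. lap_kernel t m V E x y * f y * g x)"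
    by (rule ip_lapT[OF assms F]) auto
  also have "\<dots> = (\<Sum>y\<in>?F. \<Sum>x\<in>?F. lap_kernel t m V E x y * f y * g x)" by (rule sum.swap)
  also have "\<dots> = (\<Sum>y\<in>?F. \<Sum>x\<in>?F. lap_kernel t m V E y x * g x * f y)"
    by (simp add: lap_kernel_sym mult_ac)
  also have "\<dots> = ip (lapT t m V E g) f"
    by (rule ip_lapT[OF assms(2,1) F, symmetric]) auto
  also have "\<dots> = ip f (lapT t m V E g)"
    using assms lapT_fin_supp by (intro ip_commute)
  finally show ?thesis .
qed

text \<open>Schur test: rows and columns of the symmetric 0/1 matrix sum to at most
  \<open>k\<close>, and \<open>\<bar>a b\<bar> \<le> a^2 / 2 + b^2 / 2\<close> splits the form
  between them.\<close>

lemma adj_form_bound: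
  assumes "finite F"
  shows "\<bar>\<Sum>x\<in>F. \<Sum>y\<in>F. of_bool (x \<in> V \<and> y \<in> V \<and> {x, y} \<in> E) * f y * f x\<bar> \<le> kdeg m * (\<Sum>x\<in>F. (f x)\<^sup>2)"
proof -
  let ?a = "\<lambda>x y. of_bool (x \<in> V \<and> y \<in> V \<and> {x, y} \<in> E) :: real"
  have deg: "(\<Sum>y\<in>F. ?a x y) \<le> kdeg m" for x
  proof -
    have "(\<Sum>y\<in>F. ?a x y) = (\<Sum>y\<in>F \<inter> {y. x \<in> V \<and> y \<in> V \<and> {x, y} \<in> E}. 1)"
      using assms by (simp add: of_bool_def sum.If_cases)
    also have "\<dots> \<le> real (card {y \<in> V. {x, y} \<in> E})"
      by (simp, rule card_mono) auto
    also have "\<dots> \<le> kdeg m" using gdeg_le by (simp add: gdeg_def)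
    finally show ?thesis .
  qed
  have am: "\<bar>f y * f x\<bar> \<le> (f x)\<^sup>2 / 2 + (f y)\<^sup>2 / 2" for x y
    using sum_squares_bound[of "\<bar>f y\<bar>" "\<bar>f x\<bar>"] by (simp add: abs_mult)
  have "\<bar>\<Sum>x\<in>F. \<Sum>y\<in>F. ?a x y * f y * f x\<bar> \<le> (\<Sum>x\<in>F. \<Sum>y\<in>F. \<bar>?a x y * f y * f x\<bar>)"
    by (rule order_trans[OF sum_abs sum_mono[OF sum_abs]])
  also have "\<dots> \<le> (\<Sum>x\<in>F. \<Sum>y\<in>F. ?a x y * ((f x)\<^sup>2 / 2 + (f y)\<^sup>2 / 2))"
    using am by (intro sum_mono) (auto simp: of_bool_def)
  also have "\<dots> = (\<Sum>x\<in>F. \<Sum>y\<in>F. ?a x y * ((f x)\<^sup>2 / 2)) + (\<Sum>x\<in>F. \<Sum>y\<in>F. ?a x y * ((f y)\<^sup>2 / 2))"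
    by (simp add: distrib_left sum.distrib)
  also have "(\<Sum>x\<in>F. \<Sum>y\<in>F. ?a x y * ((f y)\<^sup>2 / 2)) = (\<Sum>x\<in>F. \<Sum>y\<in>F. ?a x y * ((f x)\<^sup>2 / 2))"
    by (subst sum.swap) (intro sum.cong refl, auto simp: insert_commute)
  also have "(\<Sum>x\<in>F. \<Sum>y\<in>F. ?a x y * ((f x)\<^sup>2 / 2)) + (\<Sum>x\<in>F. \<Sum>y\<in>F. ?a x y * ((f x)\<^sup>2 / 2))
      = (\<Sum>x\<in>F. (\<Sum>y\<in>F. ?a x y) * (f x)\<^sup>2)"
    by (simp add: sum_distrib_right sum.distrib[symmetric] del: of_bool_conj) (simp add: field_simps)
  also have "\<dots> \<le> (\<Sum>x\<in>F. kdeg m * (f x)\<^sup>2)"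
    by (intro sum_mono mult_right_mono deg) auto
  finally show ?thesis by (simp add: sum_distrib_left)
qed

text \<open>On \<open>V\<close> the diagonal lies between \<open>k\<close> and \<open>2k\<close>,
  and the adjacency form is at most \<open>k\<close> in absolute value. This yields \<open>0\<close>
  and \<open>3k\<close> as bounds uniform in \<open>t\<close> and in the graph.\<close>

lemma pos_op_lapT:
  assumes t: "t \<in> {0..1}"
  shows "pos_op (lapT t m V E) (3 * kdeg m)"
proof
  show "lapT t m V E (\<lambda>x. c * f x + g x) = (\<lambda>x. c * lapT t m V E f x + lapT t m V E g x)" for c f g
    by (auto simp: fun_eq_iff lapT_def sum.distrib sum_distrib_left algebra_simps)
  show "0 < 3 * kdeg m" using m by (simp add: kdeg_eq)
  let ?d = "\<lambda>x. if x \<in> V then kdeg m + t * (kdeg m - gdeg V E x) else 0"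
  let ?a = "\<lambda>x y. of_bool (x \<in> V \<and> y \<in> V \<and> {x, y} \<in> E) :: real"
  have form: "ip (lapT t m V E f) f = (\<Sum>x\<in>F. ?d x * (f x)\<^sup>2) - (\<Sum>x\<in>F. \<Sum>y\<in>F. ?a x y * f y * f x)"
    if f: "fin_supp f" "F = {x. f x \<noteq> 0}" for f F
  proof -
    have F: "finite F" using f by (simp add: fin_supp_def)
    have "ip (lapT t m V E f) f = (\<Sum>x\<in>F. \<Sum>y\<in>F. lap_kernel t m V E x y * f y * f x)"
      by (rule ip_lapT[OF f(1,1) F]) (auto simp: f)
    also have "\<dots> = (\<Sum>x\<in>F. \<Sum>y\<in>F. (if x = y then ?d x * (f x)\<^sup>2 else 0)) - (\<Sum>x\<in>F. \<Sum>y\<in>F. ?a x y * f y * f x)"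
      unfolding sum_subtractf[symmetric]
      by (intro sum.cong refl) (auto simp: lap_kernel_def power2_eq_square algebra_simps)
    also have "(\<Sum>x\<in>F. \<Sum>y\<in>F. (if x = y then ?d x * (f x)\<^sup>2 else 0)) = (\<Sum>x\<in>F. ?d x * (f x)\<^sup>2)"
      using F by (simp add: sum.delta')
    finally show ?thesis .
  qed
  have d: "kdeg m \<le> ?d x" "?d x \<le> 2 * kdeg m" if "x \<in> V" for x
  proof -
    have "0 \<le> t * (kdeg m - gdeg V E x)" using t gdeg_le[of x] by auto
    moreover have "t * (kdeg m - gdeg V E x) \<le> 1 * (kdeg m - gdeg V E x)"
      using t gdeg_le[of x] by (intro mult_right_mono) auto
    ultimately show "kdeg m \<le> ?d x" "?d x \<le> 2 * kdeg m" using that gdeg_nonneg[of x] by auto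
  qed
  have restr: "(\<Sum>x\<in>F. \<Sum>y\<in>F. ?a x y * f y * f x) = (\<Sum>x\<in>F. \<Sum>y\<in>F. ?a x y * g y * g x)"
    if "g = (\<lambda>x. if x \<in> V then f x else 0)" for f g :: "lamp \<Rightarrow> real" and F
    unfolding that by (intro sum.cong refl) auto
  have k0: "0 \<le> kdeg m" by (simp add: kdeg_def)
  {
    fix f :: "lamp \<Rightarrow> real" assume f: "fin_supp f"
    let ?F = "{x. f x \<noteq> 0}"
    \<comment> \<open>Off \<open>V\<close> the diagonal vanishes as well, so the adjacency form has
      to be bounded by the part of \<open>f\<close> on \<open>V\<close> alone; a bound by all of
      \<open>f\<close> could exceed the diagonal term.\<close>
    define g where "g = (\<lambda>x. if x \<in> V then f x else 0)"
    have F: "finite ?F" using f by (simp add: fin_supp_def)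
    have adj: "\<bar>\<Sum>x\<in>?F. \<Sum>y\<in>?F. ?a x y * f y * f x\<bar> \<le> (\<Sum>x\<in>?F. kdeg m * (g x)\<^sup>2)"
      using adj_form_bound[OF F, of g] unfolding restr[OF g_def] by (simp add: sum_distrib_left)
    have "(\<Sum>x\<in>?F. kdeg m * (g x)\<^sup>2) \<le> (\<Sum>x\<in>?F. ?d x * (f x)\<^sup>2)"
      using d(1) by (intro sum_mono) (auto simp: g_def intro!: mult_right_mono)
    with adj show "0 \<le> ip (lapT t m V E f) f" unfolding form[OF f refl] by linarith
    have "(\<Sum>x\<in>?F. ?d x * (f x)\<^sup>2) + (\<Sum>x\<in>?F. kdeg m * (g x)\<^sup>2) \<le> (\<Sum>x\<in>?F. 3 * kdeg m * (f x)\<^sup>2)"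
      unfolding sum.distrib[symmetric]
    proof (intro sum_mono)
      fix x
      show "?d x * (f x)\<^sup>2 + kdeg m * (g x)\<^sup>2 \<le> 3 * kdeg m * (f x)\<^sup>2"
        using mult_right_mono[OF d(2), of x "(f x)\<^sup>2"] k0 by (auto simp: g_def)
    qed
    also have "\<dots> = 3 * kdeg m * ip f f"
      by (simp add: ip_def sum_distrib_left power2_eq_square mult.assoc)
    finally show "ip (lapT t m V E f) f \<le> 3 * kdeg m * ip f f"
      using adj unfolding form[OF f refl] by linarith
  }
qed (simp_all add: lapT_fin_supp lapT_sym)

end

section \<open>Percolation on the lamplighter graph\<close>

text \<open>What the two models share: a measurable random subgraph, equivariant under
  measure-preserving translations. The product structure of the measure serves to verify these
  axioms and to bound the probability of an isolated box.\<close>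

locale percolation = prob_space M for M :: "'w measure" +
  fixes m :: nat and V :: "'w \<Rightarrow> lamp set" and E :: "'w \<Rightarrow> lamp set set" and \<theta> :: "lamp \<Rightarrow> 'w \<Rightarrow> 'w"
  assumes m: "2 \<le> m"
    and V: "V \<omega> \<subseteq> lamp_verts m"
    and E: "E \<omega> \<subseteq> cay_edges m"
    and V_sets: "x \<in> lamp_verts m \<Longrightarrow> {\<omega> \<in> space M. x \<in> V \<omega>} \<in> sets M"
    and E_sets: "e \<in> cay_edges m \<Longrightarrow> {\<omega> \<in> space M. e \<in> E \<omega>} \<in> sets M"
    and \<theta>_measurable: "g \<in> lamp_verts m \<Longrightarrow> \<theta> g \<in> measurable M M"
    and \<theta>_invariant: "g \<in> lamp_verts m \<Longrightarrow> distr M M (\<theta> g) = M"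
    and V_equivariant: "g \<in> lamp_verts m \<Longrightarrow> x \<in> lamp_verts m \<Longrightarrow> \<omega> \<in> space M \<Longrightarrow>
      lamp_mult m g x \<in> V (\<theta> g \<omega>) \<longleftrightarrow> x \<in> V \<omega>"
    and E_equivariant: "g \<in> lamp_verts m \<Longrightarrow> x \<in> lamp_verts m \<Longrightarrow> y \<in> lamp_verts m \<Longrightarrow> \<omega> \<in> space M \<Longrightarrow>
      {lamp_mult m g x, lamp_mult m g y} \<in> E (\<theta> g \<omega>) \<longleftrightarrow> {x, y} \<in> E \<omega>"
begin

lemma m_pos: "0 < m" using m by simp

lemma subgraph: "lamp_subgraph m (V \<omega>) (E \<omega>)"
  using m V E by (simp add: lamp_subgraph_def)

sublocale rk: random_kernels "lamp_group m" M "insert lamp_id (S0 m)" \<theta>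
proof (intro random_kernels.intro group_lamp_group m_pos prob_space_axioms random_kernels_axioms.intro)
  show "insert lamp_id (S0 m) \<subseteq> carrier (lamp_group m)"
    using S0_subset[OF m_pos] lamp_id_in_verts[OF m_pos] by simp
qed (use finite_S0 \<theta>_measurable \<theta>_invariant in simp_all)

lemma mult_left_cancel:
  "g \<in> lamp_verts m \<Longrightarrow> x \<in> lamp_verts m \<Longrightarrow> y \<in> lamp_verts m \<Longrightarrow>
    lamp_mult m g x = lamp_mult m g y \<longleftrightarrow> x = y"
  using rk.Units_l_cancel[of g x y] by (simp add: rk.Units_eq)

lemma kop_lap_kernel: "rk.kop (lap_kernel t m (V \<omega>) (E \<omega>)) = lapT t m (V \<omega>) (E \<omega>)"
proof (intro ext)
  fix f x
  interpret lamp_subgraph m "V \<omega>" "E \<omega>" by (rule subgraph)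
  show "rk.kop (lap_kernel t m (V \<omega>) (E \<omega>)) f x = lapT t m (V \<omega>) (E \<omega>) f x"
  proof (cases "x \<in> lamp_verts m")
    case False
    hence "x \<notin> V \<omega>" using V by blast
    thus ?thesis unfolding rk.kop_def by (simp add: lapT_def lap_kernel_def)
  next
    case True
    let ?F = "insert x (nbrs m x)"
    \<comment> \<open>\<open>f\<close> is arbitrary here, while \<open>lapT_superset\<close> wants
      its support inside a finite set. Cutting \<open>f\<close> off outside \<open>x\<close> and its
      neighbours does not change the value at \<open>x\<close>.\<close>
    define h where "h y = (if y \<in> ?F then f y else 0)" for y
    have img: "lamp_mult m x ` insert lamp_id (S0 m) = ?F"
      using lamp_mult_S0[OF m_pos True] rk.r_one[of x] True by simp
    have inj: "inj_on (lamp_mult m x) (insert lamp_id (S0 m))"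
    proof (rule inj_onI)
      fix a b assume ab: "a \<in> insert lamp_id (S0 m)" "b \<in> insert lamp_id (S0 m)"
        and eq: "lamp_mult m x a = lamp_mult m x b"
      have "a \<in> lamp_verts m" "b \<in> lamp_verts m"
        using ab S0_subset[OF m_pos] lamp_id_in_verts[OF m_pos] by blast+
      thus "a = b" using mult_left_cancel[of x a b] True eq by simp
    qed
    have "rk.kop (lap_kernel t m (V \<omega>) (E \<omega>)) f x = (\<Sum>y\<in>?F. lap_kernel t m (V \<omega>) (E \<omega>) x y * f y)"
      unfolding rk.kop_def img[symmetric] by (subst sum.reindex[OF inj]) simp
    also have "\<dots> = (\<Sum>y\<in>?F. lap_kernel t m (V \<omega>) (E \<omega>) x y * h y)"
      by (intro sum.cong) (simp_all add: h_def)
    also have "\<dots> = lapT t m (V \<omega>) (E \<omega>) h x"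
      by (rule lapT_superset[symmetric]) (simp_all add: h_def split: if_splits)
    also have "\<dots> = lapT t m (V \<omega>) (E \<omega>) f x"
    proof -
      have "h y = f y" if "y \<in> {y \<in> V \<omega>. {x, y} \<in> E \<omega>}" for y
        using graph_nbrs[of x] that by (auto simp: h_def)
      hence "(\<Sum>y\<in>{y \<in> V \<omega>. {x, y} \<in> E \<omega>}. h y) = (\<Sum>y\<in>{y \<in> V \<omega>. {x, y} \<in> E \<omega>}. f y)"
        by (rule sum.cong[OF refl])
      moreover have "h x = f x" by (simp add: h_def)
      ultimately show ?thesis by (simp only: lapT_def)
    qed
    finally show ?thesis .
  qed
qed

lemma edge_sets: "{\<omega> \<in> space M. {x, y} \<in> E \<omega>} \<in> sets M"
proof (cases "{x, y} \<in> cay_edges m")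
  case False
  hence "{\<omega> \<in> space M. {x, y} \<in> E \<omega>} = {}" using E by blast
  thus ?thesis by (simp only: sets.empty_sets)
qed (rule E_sets)

lemma vertex_sets: "{\<omega> \<in> space M. x \<in> V \<omega>} \<in> sets M"
proof (cases "x \<in> lamp_verts m")
  case False
  hence "{\<omega> \<in> space M. x \<in> V \<omega>} = {}" using V by blast
  thus ?thesis by (simp only: sets.empty_sets)
qed (rule V_sets)

lemma measurable_vertex [measurable]: "Measurable.pred M (\<lambda>\<omega>. x \<in> V \<omega>)"
  using vertex_sets by (simp add: pred_def)

lemma measurable_edge [measurable]: "Measurable.pred M (\<lambda>\<omega>. {x, y} \<in> E \<omega>)"
  using edge_sets by (simp add: pred_def)

lemma gdeg_measurable [measurable]: "(\<lambda>\<omega>. gdeg (V \<omega>) (E \<omega>) x) \<in> borel_measurable M"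
proof -
  have "gdeg (V \<omega>) (E \<omega>) x = (\<Sum>y\<in>nbrs m x. of_bool (y \<in> V \<omega> \<and> {x, y} \<in> E \<omega>))" for \<omega>
  proof -
    interpret lamp_subgraph m "V \<omega>" "E \<omega>" by (rule subgraph)
    have "{y \<in> V \<omega>. {x, y} \<in> E \<omega>} = {y \<in> nbrs m x. y \<in> V \<omega> \<and> {x, y} \<in> E \<omega>}"
      using graph_nbrs[of x] by blast
    thus ?thesis unfolding gdeg_def
      by (simp add: of_bool_def sum.If_cases Int_def del: Collect_conj_eq)
  qed
  thus ?thesis by (simp only:) measurable
qed

lemma gdeg_equivariant:
  assumes "g \<in> lamp_verts m" "x \<in> lamp_verts m" "\<omega> \<in> space M"
  shows "gdeg (V (\<theta> g \<omega>)) (E (\<theta> g \<omega>)) (lamp_mult m g x) = gdeg (V \<omega>) (E \<omega>) x"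
proof -
  let ?A = "{y \<in> V \<omega>. {x, y} \<in> E \<omega>}"
  let ?B = "{y \<in> V (\<theta> g \<omega>). {lamp_mult m g x, y} \<in> E (\<theta> g \<omega>)}"
  have img: "lamp_mult m g ` ?A = ?B"
  proof (intro equalityI subsetI)
    fix y assume "y \<in> lamp_mult m g ` ?A"
    then obtain z where z: "y = lamp_mult m g z" "z \<in> V \<omega>" "{x, z} \<in> E \<omega>" by blast
    hence "z \<in> lamp_verts m" using V by blast
    thus "y \<in> ?B" using z assms V_equivariant E_equivariant by simp
  next
    fix y assume y: "y \<in> ?B"
    hence yv: "y \<in> lamp_verts m" using V by blast
    define z where "z = lamp_mult m (inv\<^bsub>lamp_group m\<^esub> g) y"
    have zv: "z \<in> lamp_verts m"
      using rk.m_closed[OF rk.inv_closed[of g], of y] assms yv by (simp add: z_def)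
    have yz: "y = lamp_mult m g z"
      using rk.inv_solve_left'[of g y z] rk.m_assoc[of g "inv\<^bsub>lamp_group m\<^esub> g" y] rk.r_inv[of g]
        rk.inv_closed[of g] rk.l_one[of y] assms yv by (simp add: z_def)
    have "z \<in> ?A" using y yz zv assms V_equivariant E_equivariant by simp
    thus "y \<in> lamp_mult m g ` ?A" using yz by blast
  qed
  have inj: "inj_on (lamp_mult m g) ?A"
  proof (rule inj_onI)
    fix a b assume "a \<in> ?A" "b \<in> ?A" and eq: "lamp_mult m g a = lamp_mult m g b"
    hence "a \<in> lamp_verts m" "b \<in> lamp_verts m" using V by blast+
    thus "a = b" using mult_left_cancel[of g a b] assms eq by simp
  qed
  show ?thesis using card_image[OF inj] unfolding img gdeg_def by (simp only:)
qed

text \<open>The number of missing neighbours of a vertex of the graph, which is the velocity of the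
  diagonal in \<open>t\<close>; it is nonnegative because no degree exceeds
  \<open>k\<close>.\<close>

definition "defect \<omega> x = (if x \<in> V \<omega> then kdeg m - gdeg (V \<omega>) (E \<omega>) x else 0)"

lemma defect_bounds: "0 \<le> defect \<omega> x" "defect \<omega> x \<le> kdeg m"
proof -
  interpret lamp_subgraph m "V \<omega>" "E \<omega>" by (rule subgraph)
  show "0 \<le> defect \<omega> x" "defect \<omega> x \<le> kdeg m"
    using gdeg_le[of x] gdeg_nonneg[of x] by (simp_all add: defect_def kdeg_def)
qed

lemma lap_kernel_alt: "lap_kernel t m (V \<omega>) (E \<omega>) x y =
    (if x = y then (if x \<in> V \<omega> then kdeg m else 0) + t * defect \<omega> x else 0)
    - of_bool (x \<in> V \<omega> \<and> y \<in> V \<omega> \<and> {x, y} \<in> E \<omega>)"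
  by (simp add: lap_kernel_def defect_def)

lemma random_kernel_lap:
  assumes t: "t \<in> {0..1}"
  shows "rk.random_kernel (\<lambda>\<omega>. lap_kernel t m (V \<omega>) (E \<omega>))"
  unfolding rk.random_kernel_def lamp_group_simps
proof (intro conjI ballI)
  show "(\<lambda>\<omega>. lap_kernel t m (V \<omega>) (E \<omega>) x y) \<in> borel_measurable M" for x y
    unfolding lap_kernel_def by measurable
  show "lap_kernel t m (V (\<theta> g \<omega>)) (E (\<theta> g \<omega>)) (lamp_mult m g x) (lamp_mult m g y) = lap_kernel t m (V \<omega>) (E \<omega>) x y"
    if "g \<in> lamp_verts m" "\<omega> \<in> space M" "x \<in> lamp_verts m" "y \<in> lamp_verts m" for g \<omega> x y
    using that by (simp add: lap_kernel_def V_equivariant E_equivariant gdeg_equivariant mult_left_cancel)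
  show "\<exists>B\<ge>0. \<forall>\<omega>\<in>space M. \<forall>x\<in>lamp_verts m. \<forall>y\<in>lamp_verts m. \<bar>lap_kernel t m (V \<omega>) (E \<omega>) x y\<bar> \<le> B"
  proof (intro exI[of _ "2 * kdeg m + 1"] conjI ballI)
    fix \<omega> x y
    have "0 \<le> t * defect \<omega> x" "t * defect \<omega> x \<le> 1 * kdeg m"
      using t defect_bounds[of \<omega> x] mult_mono[of t 1 "defect \<omega> x" "kdeg m"] by auto
    moreover have "0 \<le> kdeg m" by (simp add: kdeg_def)
    ultimately show "\<bar>lap_kernel t m (V \<omega>) (E \<omega>) x y\<bar> \<le> 2 * kdeg m + 1"
      unfolding lap_kernel_alt by (auto simp: of_bool_def)
  qed (simp add: kdeg_def)
qed

sublocale ki: kernel_interpolation "lamp_group m" M "insert lamp_id (S0 m)" \<theta>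
  "\<lambda>t \<omega>. lap_kernel t m (V \<omega>) (E \<omega>)" defect "2 * kdeg m + 1"
proof
  show "lap_kernel s m (V \<omega>) (E \<omega>) x y = lap_kernel t m (V \<omega>) (E \<omega>) x y + (s - t) * (if x = y then defect \<omega> x else 0)"
    for s t \<omega> x y
    unfolding lap_kernel_alt by (simp add: algebra_simps)
  show "\<bar>lap_kernel t m (V \<omega>) (E \<omega>) x y\<bar> \<le> 2 * kdeg m + 1" if t: "t \<in> {0..1}" for t \<omega> x y
  proof -
    have "0 \<le> t * defect \<omega> x" "t * defect \<omega> x \<le> 1 * kdeg m"
      using t defect_bounds[of \<omega> x] mult_mono[of t 1 "defect \<omega> x" "kdeg m"] by auto
    moreover have "0 \<le> kdeg m" by (simp add: kdeg_def)
    ultimately show ?thesis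
      unfolding lap_kernel_alt by (auto simp: of_bool_def)
  qed
  show "\<bar>defect \<omega> x\<bar> \<le> 2 * kdeg m + 1" for \<omega> x
    using defect_bounds[of \<omega> x] by simp
  show "rk.random_kernel (\<lambda>\<omega> x y. if x = y then defect \<omega> x else 0)"
    unfolding rk.random_kernel_def lamp_group_simps
  proof (intro conjI ballI)
    show "(\<lambda>\<omega>. if x = y then defect \<omega> x else 0) \<in> borel_measurable M" for x y
      unfolding defect_def by measurable
    show "(if lamp_mult m g x = lamp_mult m g y then defect (\<theta> g \<omega>) (lamp_mult m g x) else 0)
        = (if x = y then defect \<omega> x else 0)"
      if "g \<in> lamp_verts m" "\<omega> \<in> space M" "x \<in> lamp_verts m" "y \<in> lamp_verts m" for g \<omega> x y
      using that by (simp add: defect_def V_equivariant gdeg_equivariant mult_left_cancel)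
    show "\<exists>B\<ge>0. \<forall>\<omega>\<in>space M. \<forall>x\<in>lamp_verts m. \<forall>y\<in>lamp_verts m. \<bar>if x = y then defect \<omega> x else 0\<bar> \<le> B"
      using defect_bounds by (intro exI[of _ "kdeg m"]) (auto simp: kdeg_def)
  qed
qed (rule random_kernel_lap)

text \<open>The value 1 for \<open>\<iota> \<notin> V\<close> is what the polynomial approximations of the spectral projection
  produce there; it cancels in the comparison.\<close>
definition X :: "real \<Rightarrow> real \<Rightarrow> 'w \<Rightarrow> real" where
  "X t e \<omega> = (if lamp_id \<in> V \<omega>
    then measure (spec_measure (lapT t m (V \<omega>) (E \<omega>)) lamp_id) {..e} else 1)"

definition Q :: "real \<Rightarrow> real \<Rightarrow> nat \<Rightarrow> 'w \<Rightarrow> real" where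
  "Q t e n \<omega> = moment_eval (\<lambda>i. (lapT t m (V \<omega>) (E \<omega>) ^^ i) (indicator {lamp_id}) lamp_id)
    (cut_poly 0 (3 * kdeg m) e n)"

lemma R_pos: "0 < 3 * kdeg m" using m by (simp add: kdeg_eq)

lemma pos_op_lap: "t \<in> {0..1} \<Longrightarrow> pos_op (lapT t m (V \<omega>) (E \<omega>)) (3 * kdeg m)"
  using lamp_subgraph.pos_op_lapT[OF subgraph] .

lemma ip_lap:
  assumes "t \<in> {0..1}"
  shows "ip ((lapT t m (V \<omega>) (E \<omega>) ^^ i) (indicator {v})) (indicator {v})
    = (lapT t m (V \<omega>) (E \<omega>) ^^ i) (indicator {v}) v"
proof -
  interpret pos_op "lapT t m (V \<omega>) (E \<omega>)" "3 * kdeg m" by (rule pos_op_lap[OF assms])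
  show ?thesis by (simp add: ip_indicator fin_funpow)
qed

text \<open>The operator vanishes at \<open>lamp_id\<close>, so only the zeroth moment survives and
  what remains is the value of the cut polynomial at 0.\<close>

lemma Q_closed:
  assumes "lamp_id \<notin> V \<omega>"
  shows "Q t e n \<omega> = 1"
proof -
  have "(lapT t m (V \<omega>) (E \<omega>) ^^ i) (indicator {lamp_id}) lamp_id = (if i = 0 then 1 else 0)" for i
    by (cases i) (use assms in \<open>simp_all add: lapT_def\<close>)
  hence "Q t e n \<omega> = coeff (cut_poly 0 (3 * kdeg m) e n) 0"
    unfolding Q_def moment_eval_def by (simp add: if_distrib[where f="\<lambda>z. _ * z"] cong: if_cong)
  \<comment> \<open>For \<open>n = 0\<close> the base \<open>1 - 0 ^ 0\<close> is 0, but then the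
    exponent \<open>cut_exp\<close> is 0 too, by division by zero, and the power is still 1.\<close>
  also have "\<dots> = 1"
    unfolding poly_0_coeff_0[symmetric] poly_cut_poly by (cases n) (simp_all add: cut_exp_def)
  finally show ?thesis .
qed

lemma Q_tendsto:
  assumes t: "t \<in> {0..1}" and e: "0 < e" "e < 3 * kdeg m"
  shows "(\<lambda>n. Q t e n \<omega>) \<longlonglongrightarrow> X t e \<omega>"
  using spec_measure_tendsto[OF pos_op_lap[OF t] e] Q_closed by (simp add: Q_def X_def)

lemma Q_bound:
  assumes t: "t \<in> {0..1}"
  shows "\<bar>Q t e n \<omega>\<bar> \<le> 1"
proof (cases "lamp_id \<in> V \<omega>")
  case True
  note P = pos_op_lap[OF t, of \<omega>]
  show ?thesis
    using real_distribution.moment_eval_cut_poly_range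
      [OF real_distribution_spec_measure[OF P] R_pos AE_spec_measure[OF P], of lamp_id e n]
    by (simp add: Q_def moments_spec_measure[OF P])
qed (simp add: Q_closed)

lemma Q_integrable: "t \<in> {0..1} \<Longrightarrow> integrable M (Q t e n)"
  using rk.integral_moment_eval(2)[OF random_kernel_lap] unfolding Q_def[abs_def] kop_lap_kernel by simp

lemma X_measurable:
  assumes "t \<in> {0..1}" "0 < e" "e < 3 * kdeg m"
  shows "X t e \<in> borel_measurable M"
  by (rule borel_measurable_LIMSEQ_real[OF Q_tendsto[OF assms] borel_measurable_integrable[OF Q_integrable[OF assms(1)]]])

lemma X_range:
  assumes t: "t \<in> {0..1}"
  shows "0 \<le> X t e \<omega>" "X t e \<omega> \<le> 1"
proof -
  have "prob_space (spec_measure (lapT t m (V \<omega>) (E \<omega>)) lamp_id)"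
    using real_distribution_spec_measure[OF pos_op_lap[OF t]] by (simp add: real_distribution_def)
  from prob_space.prob_le_1[OF this] show "0 \<le> X t e \<omega>" "X t e \<omega> \<le> 1" by (simp_all add: X_def)
qed

lemma X_integrable:
  assumes "t \<in> {0..1}" "0 < e" "e < 3 * kdeg m"
  shows "integrable M (X t e)"
  by (rule integrable_const_bound[of _ 1]) (use X_range[OF assms(1)] X_measurable[OF assms] in auto)

text \<open>The approximants \<open>Q\<close> are compared for each fixed \<open>n\<close>, and
  dominated convergence carries the inequality over to the projections. The interval
  \<open>[0, 3k]\<close> common to all \<open>t\<close> allows one polynomial for the whole
  path.\<close>

lemma integral_X_mono:
  assumes e: "0 < e" "e < 3 * kdeg m"
  shows "(\<integral>\<omega>. X 1 e \<omega> \<partial>M) \<le> (\<integral>\<omega>. X 0 e \<omega> \<partial>M)"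
proof -
  have conv: "(\<lambda>n. \<integral>\<omega>. Q t e n \<omega> \<partial>M) \<longlonglongrightarrow> (\<integral>\<omega>. X t e \<omega> \<partial>M)" if t: "t \<in> {0..1}" for t
    by (rule integral_dominated_convergence[where w="\<lambda>_. 1"])
       (use Q_tendsto[OF t e] Q_bound[OF t] X_measurable[OF t e] Q_integrable[OF t] in auto)
  have le: "(\<integral>\<omega>. Q 1 e n \<omega> \<partial>M) \<le> (\<integral>\<omega>. Q 0 e n \<omega> \<partial>M)" for n
    unfolding Q_def kop_lap_kernel[symmetric]
  proof (rule ki.moment_eval_antimono[unfolded lamp_group_simps])
    fix t :: real and \<omega> assume t: "t \<in> {0..1}"
    interpret pos_op "lapT t m (V \<omega>) (E \<omega>)" "3 * kdeg m" by (rule pos_op_lap[OF t])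
    let ?q = "pderiv (cut_poly 0 (3 * kdeg m) e n)"
    have "0 \<le> moment_eval (\<lambda>i. ip ((lapT t m (V \<omega>) (E \<omega>) ^^ i) (indicator {lamp_id})) (indicator {lamp_id})) (- ?q)"
      by (rule moment_eval_nonneg) (use cut_poly_pderiv_nonpos[OF R_pos] in auto)
    hence "moment_eval (\<lambda>i. (lapT t m (V \<omega>) (E \<omega>) ^^ i) (indicator {lamp_id}) lamp_id) ?q \<le> 0"
      unfolding ip_lap[OF t] by (simp add: moment_eval_def sum_negf)
    thus "defect \<omega> lamp_id * moment_eval (\<lambda>i. (rk.kop (lap_kernel t m (V \<omega>) (E \<omega>)) ^^ i) (indicator {lamp_id}) lamp_id) ?q \<le> 0"
      unfolding kop_lap_kernel using defect_bounds(1) by (rule mult_nonneg_nonpos[rotated])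
  qed
  show ?thesis
    by (rule LIMSEQ_le[OF conv conv]) (use le in auto)
qed

definition dos :: "real \<Rightarrow> real \<Rightarrow> real" where
  "dos t e = (\<integral>\<omega>. (if lamp_id \<in> V \<omega>
    then measure (spec_measure (lapT t m (V \<omega>) (E \<omega>)) lamp_id) {..e} else 0) \<partial>M)"

lemma dos_integrand:
  "(if lamp_id \<in> V \<omega> then measure (spec_measure (lapT t m (V \<omega>) (E \<omega>)) lamp_id) {..e} else 0)
    = X t e \<omega> - of_bool (lamp_id \<notin> V \<omega>)"
  by (simp add: X_def)

lemma closed_integrable: "integrable M (\<lambda>\<omega>. of_bool (lamp_id \<notin> V \<omega>) :: real)"
  by (rule integrable_const_bound[of _ 1]) auto

theorem dos_mono:
  assumes e: "0 < e" "e < 3 * kdeg m"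
  shows "dos 1 e \<le> dos 0 e"
proof -
  have "dos t e = (\<integral>\<omega>. X t e \<omega> \<partial>M) - (\<integral>\<omega>. of_bool (lamp_id \<notin> V \<omega>) \<partial>M)" if t: "t \<in> {0..1}" for t
    unfolding dos_def dos_integrand
    by (rule Bochner_Integration.integral_diff[OF X_integrable[OF t e] closed_integrable])
  thus ?thesis using integral_X_mono[OF e] by simp
qed

end

section \<open>Radial eigenfunctions on isolated boxes\<close>

text \<open>A step between levels \<open>x\<close> and \<open>x + 1\<close> resets only the lamp at
  \<open>x + 1\<close>. The \<open>2r\<close> passages among the levels \<open>-r..r\<close> thus
  touch exactly the lamps \<open>-r + 1..r\<close>, and a step leaves the box only by leaving the
  range of levels.\<close>

definition lamp_box :: "nat \<Rightarrow> nat \<Rightarrow> lamp set" where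
  "lamp_box m r = {g \<in> lamp_verts m. \<bar>snd g\<bar> \<le> int r \<and> (\<forall>z. z \<notin> {- int r + 1..int r} \<longrightarrow> fst g z = 0)}"

text \<open>Places the first positive zero of the cosine at \<open>r + 1/2\<close>, half way between
  the outermost level and the missing one.\<close>

definition box_angle :: "nat \<Rightarrow> real" where
  "box_angle r = pi / (2 * real r + 1)"

definition box_fun :: "nat \<Rightarrow> nat \<Rightarrow> lamp \<Rightarrow> real" where
  "box_fun m r g = (if g \<in> lamp_box m r then cos (box_angle r * real_of_int (snd g)) else 0)"

definition box_eig :: "nat \<Rightarrow> nat \<Rightarrow> real" where
  "box_eig m r = 2 * real m * (1 - cos (box_angle r))"

lemma box_subset: "lamp_box m r \<subseteq> lamp_verts m"
  by (auto simp: lamp_box_def)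

lemma lamp_id_in_box: "0 < m \<Longrightarrow> lamp_id \<in> lamp_box m r"
  using lamp_id_in_verts[of m] by (simp add: lamp_box_def) (simp add: lamp_id_def)

text \<open>Membership of a neighbour is decided by its level, so a vertex has all \<open>m\<close>
  of its upper neighbours in the box or none. This is what lets functions of the level alone be
  mapped to such functions.\<close>

lemma up_nbrs_box:
  assumes "0 < m" "g \<in> lamp_box m r" "h \<in> up_nbrs m g"
  shows "h \<in> lamp_box m r \<longleftrightarrow> snd g < int r" and "snd h = snd g + 1"
proof -
  obtain l where h: "h = ((fst g)(snd g + 1 := l), snd g + 1)"
    using assms(3) by (auto simp: up_nbrs_def)
  have "h \<in> lamp_verts m"
    using nbrs_in_verts[of m g h] assms by (auto simp: nbrs_def lamp_box_def)
  thus "h \<in> lamp_box m r \<longleftrightarrow> snd g < int r" using assms(2) by (auto simp: h lamp_box_def)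
  show "snd h = snd g + 1" by (simp add: h)
qed

lemma down_nbrs_box:
  assumes "0 < m" "g \<in> lamp_box m r" "h \<in> down_nbrs m g"
  shows "h \<in> lamp_box m r \<longleftrightarrow> - int r < snd g" and "snd h = snd g - 1"
proof -
  obtain l where h: "h = ((fst g)(snd g := l), snd g - 1)"
    using assms(3) by (auto simp: down_nbrs_def)
  have "h \<in> lamp_verts m"
    using nbrs_in_verts[of m g h] assms by (auto simp: nbrs_def lamp_box_def)
  thus "h \<in> lamp_box m r \<longleftrightarrow> - int r < snd g" using assms(2) by (auto simp: h lamp_box_def)
  show "snd h = snd g - 1" by (simp add: h)
qed

lemma finite_card_box:
  assumes m: "0 < m"
  shows "finite (lamp_box m r)" and "card (lamp_box m r) \<le> (2 * r + 1) * m ^ (2 * r)"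
proof -
  let ?S = "{- int r + 1..int r}"
  let ?A = "(?S \<rightarrow>\<^sub>E {0..<int m}) \<times> {- int r..int r}"
  have A: "finite ?A" by (intro finite_cartesian_product finite_PiE) auto
  have sub: "lamp_box m r \<subseteq> (\<lambda>(f, x). ((\<lambda>z. if z \<in> ?S then f z else 0), x)) ` ?A"
  proof
    fix g assume g: "g \<in> lamp_box m r"
    have "(restrict (fst g) ?S, snd g) \<in> ?A"
      using g by (auto simp: lamp_box_def lamp_verts_def)
    moreover have "g = (\<lambda>(f, x). ((\<lambda>z. if z \<in> ?S then f z else 0), x)) (restrict (fst g) ?S, snd g)"
      using g by (auto simp: lamp_box_def prod_eq_iff fun_eq_iff)
    ultimately show "g \<in> (\<lambda>(f, x). ((\<lambda>z. if z \<in> ?S then f z else 0), x)) ` ?A" by (rule rev_image_eqI)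
  qed
  thus "finite (lamp_box m r)" using A by (meson finite_imageI finite_subset)
  have "card (lamp_box m r) \<le> card ?A" by (rule surj_card_le[OF A sub])
  also have "\<dots> = m ^ (2 * r) * (2 * r + 1)"
    by (simp add: card_cartesian_product card_PiE nat_mult_distrib nat_add_distrib)
  finally show "card (lamp_box m r) \<le> (2 * r + 1) * m ^ (2 * r)" by (simp add: mult.commute)
qed

text \<open>In bond percolation a vertex belongs to the graph only through an open edge, so every
  vertex of the box needs a neighbour inside it; for \<open>r = 0\<close> there would be
  none.\<close>

lemma box_nbr_exists:
  assumes m: "0 < m" and r: "1 \<le> r" and g: "g \<in> lamp_box m r"
  shows "\<exists>h\<in>lamp_box m r. h \<in> nbrs m g"
proof (cases "snd g < int r")
  case True
  obtain h where "h \<in> up_nbrs m g" using m by (force simp: up_nbrs_def)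
  thus ?thesis using up_nbrs_box[OF m g] True unfolding nbrs_def by blast
next
  case False
  obtain h where "h \<in> down_nbrs m g" using m by (force simp: down_nbrs_def)
  moreover have "- int r < snd g" using False r by linarith
  ultimately show ?thesis using down_nbrs_box[OF m g] unfolding nbrs_def by blast
qed

text \<open>One condition on edges fits both models: closing the outer neighbours or closing the
  outgoing edges removes the same Cayley edges at \<open>K\<close>.\<close>

definition isolated :: "nat \<Rightarrow> lamp set \<Rightarrow> lamp set \<Rightarrow> lamp set set \<Rightarrow> bool" where
  "isolated m K V E \<longleftrightarrow> K \<subseteq> V \<and> (\<forall>x\<in>K. \<forall>y\<in>nbrs m x. {x, y} \<in> E \<longleftrightarrow> y \<in> K)"

lemma cos_reflect: "box_angle r * (real r + 1) = pi - box_angle r * real r"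
proof -
  have "box_angle r * (2 * real r + 1) = pi" by (simp add: box_angle_def)
  thus ?thesis by (simp add: algebra_simps)
qed

lemma cos_sum: "cos (a * (x + 1)) + cos (a * (x - 1)) = 2 * cos a * cos (a * x)" for a x :: real
  by (simp add: cos_add cos_diff algebra_simps)

text \<open>The radial function satisfies the three-term recursion also at the ends of the box, since
  \<open>cos (\<theta>(r + 1)) = - cos (\<theta>r)\<close>: the extra Dirichlet term of \<open>\<Delta>\<^sup>D\<close> at a missing neighbour is exactly
  reproduced by the odd continuation.\<close>
lemma (in lamp_subgraph) box_eigenfunction:
  assumes r: "1 \<le> r" and iso: "isolated m (lamp_box m r) V E"
  shows "lapT 1 m V E (box_fun m r) = (\<lambda>x. box_eig m r * box_fun m r x)"
proof
  fix g
  let ?h = "\<lambda>x. cos (box_angle r * x)"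
  show "lapT 1 m V E (box_fun m r) g = box_eig m r * box_fun m r g"
  proof (cases "g \<in> lamp_box m r")
    case False
    have "box_fun m r y = 0" if "y \<in> V" "{g, y} \<in> E" for y
    proof -
      have yg: "{y, g} \<in> E" using that by (simp add: insert_commute)
      hence "y \<notin> lamp_box m r" using False iso edge_nbr[OF yg] unfolding isolated_def by blast
      thus ?thesis by (simp add: box_fun_def)
    qed
    thus ?thesis using False by (simp add: lapT_def box_fun_def)
  next
    case True
    define x where "x = snd g"
    have xr: "\<bar>x\<bar> \<le> int r" using True by (simp add: lamp_box_def x_def)
    have gV: "g \<in> V" using True iso by (auto simp: isolated_def)
    define U where "U = (if x < int r then up_nbrs m g else {})"
    define W where "W = (if - int r < x then down_nbrs m g else {})"
    have "{y \<in> V. {g, y} \<in> E} = {y \<in> nbrs m g. y \<in> lamp_box m r}"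
      using iso True graph_nbrs[of g] unfolding isolated_def by blast
    also have "\<dots> = U \<union> W"
      using up_nbrs_box(1)[OF m_pos True] down_nbrs_box(1)[OF m_pos True]
      unfolding U_def W_def nbrs_def x_def by (simp only: split: if_split) blast
    finally have nb: "{y \<in> V. {g, y} \<in> E} = U \<union> W" .
    have fin: "finite U" "finite W" "U \<inter> W = {}"
      using up_down_disjoint by (auto simp: U_def W_def)
    have cU: "real (card U) = (if x < int r then real m else 0)"
      and cW: "real (card W) = (if - int r < x then real m else 0)"
      by (simp_all add: U_def W_def card_up_nbrs card_down_nbrs)
    have "gdeg V E g = real (card U) + real (card W)"
      unfolding gdeg_def nb by (simp add: card_Un_disjoint fin)
    moreover have "(\<Sum>y\<in>U. box_fun m r y) = real (card U) * ?h (real_of_int x + 1)"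
    proof -
      have "box_fun m r y = ?h (real_of_int x + 1)" if "y \<in> U" for y
        using up_nbrs_box[OF m_pos True, of y] that by (auto simp: U_def x_def box_fun_def split: if_splits)
      thus ?thesis by simp
    qed
    moreover have "(\<Sum>y\<in>W. box_fun m r y) = real (card W) * ?h (real_of_int x - 1)"
    proof -
      have "box_fun m r y = ?h (real_of_int x - 1)" if "y \<in> W" for y
        using down_nbrs_box[OF m_pos True, of y] that by (auto simp: W_def x_def box_fun_def split: if_splits)
      thus ?thesis by simp
    qed
    moreover have "box_fun m r g = ?h (real_of_int x)" using True by (simp add: box_fun_def x_def)
    \<comment> \<open>\<open>4m\<close> is \<open>2k\<close>, from which \<open>t = 1\<close>
      subtracts the degree. A missing direction has cardinality 0 and so leaves an extra
      \<open>m\<close> on the diagonal.\<close>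
    ultimately have lap: "lapT 1 m V E (box_fun m r) g
        = (4 * real m - (real (card U) + real (card W))) * ?h (real_of_int x)
          - (real (card U) * ?h (real_of_int x + 1) + real (card W) * ?h (real_of_int x - 1))"
      using gV unfolding lapT_def nb by (simp add: sum.union_disjoint fin kdeg_eq m_pos)
    have up: "real m * ?h (real_of_int x + 1) = real (card U) * ?h (real_of_int x + 1)
        - (real m - real (card U)) * ?h (real_of_int x)"
    proof (cases "x < int r")
      case False
      hence "x = int r" using xr by linarith
      hence "?h (real_of_int x + 1) = - ?h (real_of_int x)" by (simp add: cos_reflect)
      thus ?thesis using False by (simp add: cU)
    qed (simp add: cU)
    have down: "real m * ?h (real_of_int x - 1) = real (card W) * ?h (real_of_int x - 1)
        - (real m - real (card W)) * ?h (real_of_int x)"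
    proof (cases "- int r < x")
      case False
      hence x: "real_of_int x = - real r" using xr by linarith
      have "box_angle r * (- real r - 1) = - (box_angle r * (real r + 1))"
        by (simp add: algebra_simps)
      hence "?h (real_of_int x - 1) = cos (- (box_angle r * (real r + 1)))" by (simp only: x)
      also have "\<dots> = - ?h (real_of_int x)" unfolding cos_minus cos_reflect x by simp
      finally show ?thesis using False by (simp add: cW)
    qed (simp add: cW)
    have combine: "(4 * M - (u + w)) * h0 - (u * h1 + w * h2) = 2 * M * h0 - M * (h1 + h2)"
      if "M * h1 = u * h1 - (M - u) * h0" "M * h2 = w * h2 - (M - w) * h0" for M u w h0 h1 h2 :: real
      using that by (simp add: algebra_simps)
    have "lapT 1 m V E (box_fun m r) g
        = 2 * real m * ?h (real_of_int x) - real m * (?h (real_of_int x + 1) + ?h (real_of_int x - 1))"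
      unfolding lap using up down by (rule combine)
    also have "\<dots> = box_eig m r * ?h (real_of_int x)"
      unfolding cos_sum box_eig_def by (simp add: algebra_simps)
    finally show ?thesis using True by (simp add: box_fun_def x_def)
  qed
qed

lemma box_eig_bounds: "0 \<le> box_eig m r" "box_eig m r \<le> real m * (box_angle r)\<^sup>2"
proof -
  have "1 - cos a \<le> a\<^sup>2 / 2" for a :: real
  proof -
    have "cos a = 1 - 2 * (sin (a / 2))\<^sup>2" using cos_double_sin[of "a / 2"] by simp
    moreover have "(sin (a / 2))\<^sup>2 \<le> (a / 2)\<^sup>2"
      using abs_sin_x_le_abs_x[of "a / 2"] unfolding abs_le_square_iff .
    ultimately show ?thesis by (simp add: power2_eq_square)
  qed
  from mult_left_mono[OF this[of "box_angle r"], of "2 * real m"]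
  show "box_eig m r \<le> real m * (box_angle r)\<^sup>2" unfolding box_eig_def by simp
  show "0 \<le> box_eig m r" unfolding box_eig_def by simp
qed

lemma box_fun_norm:
  assumes m: "0 < m"
  shows "fin_supp (box_fun m r)" "1 \<le> ip (box_fun m r) (box_fun m r)"
    "ip (box_fun m r) (box_fun m r) \<le> real (card (lamp_box m r))" "box_fun m r lamp_id = 1"
proof -
  have fin: "finite (lamp_box m r)" by (rule finite_card_box[OF m])
  show fs: "fin_supp (box_fun m r)" unfolding fin_supp_def
    by (rule finite_subset[OF _ fin]) (auto simp: box_fun_def split: if_splits)
  have ip: "ip (box_fun m r) (box_fun m r) = (\<Sum>x\<in>lamp_box m r. (box_fun m r x)\<^sup>2)"
    by (subst ip_superset[OF fin _ fs]) (auto simp: box_fun_def power2_eq_square split: if_splits)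
  show one: "box_fun m r lamp_id = 1"
    using lamp_id_in_box[OF m, of r] by (simp add: box_fun_def) (simp add: lamp_id_def)
  have "(box_fun m r lamp_id)\<^sup>2 \<le> (\<Sum>x\<in>lamp_box m r. (box_fun m r x)\<^sup>2)"
    by (rule member_le_sum[OF lamp_id_in_box[OF m] _ fin]) simp
  thus "1 \<le> ip (box_fun m r) (box_fun m r)" using ip one by simp
  have "(\<Sum>x\<in>lamp_box m r. (box_fun m r x)\<^sup>2) \<le> (\<Sum>x\<in>lamp_box m r. 1)"
    by (rule sum_mono) (simp add: box_fun_def abs_square_le_1)
  thus "ip (box_fun m r) (box_fun m r) \<le> real (card (lamp_box m r))" using ip by simp
qed

text \<open>The eigenfunction equals 1 at the identity and is at most 1 in absolute value on the
  box, so its squared overlap with the delta function, divided by its squared norm, is at least the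
  reciprocal of the number of vertices.\<close>

lemma (in lamp_subgraph) spec_measure_box:
  assumes r: "1 \<le> r" and iso: "isolated m (lamp_box m r) V E"
    and e: "box_eig m r \<le> e" "0 < e" "e < 3 * kdeg m"
  shows "1 / real (card (lamp_box m r)) \<le> measure (spec_measure (lapT 1 m V E) lamp_id) {..e}"
proof -
  have one: "(1::real) \<in> {0..1}" by simp
  interpret pos_op "lapT 1 m V E" "3 * kdeg m" by (rule pos_op_lapT[OF one])
  note box = box_fun_norm[OF m_pos, of r]
  let ?c = "1 / ip (box_fun m r) (box_fun m r)"
  have ipd: "ip (indicator {lamp_id}) (box_fun m r) = 1"
    using box by (simp add: ip_indicator_left)
  have le: "?c * poly (cut_poly 0 (3 * kdeg m) e n) (box_eig m r)
      \<le> moment_eval (\<lambda>i. (lapT 1 m V E ^^ i) (indicator {lamp_id}) lamp_id) (cut_poly 0 (3 * kdeg m) e n)" for n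
    using moment_eval_eigenvector[OF box(1) _ box_eigenfunction[OF r iso] fin_supp_indicator,
        of "cut_poly 0 (3 * kdeg m) e n" lamp_id] box(2) cut_poly_range(1)[OF R]
    by (simp add: ipd ip_indicator fin_funpow)
  have "(\<lambda>n. ?c * poly (cut_poly 0 (3 * kdeg m) e n) (box_eig m r)) \<longlonglongrightarrow> ?c * indicator {..e} (box_eig m r)"
    using e box_eig_bounds(1)[of m r] by (intro tendsto_mult tendsto_const cut_poly_tendsto) auto
  hence "?c * indicator {..e} (box_eig m r) \<le> measure (spec_measure (lapT 1 m V E) lamp_id) {..e}"
    by (rule LIMSEQ_le[OF _ spec_measure_tendsto[OF pos_op_lapT[OF one] e(2,3)]]) (use le in auto)
  moreover have "1 / real (card (lamp_box m r)) \<le> ?c" using box(2,3) by (intro divide_left_mono) auto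
  ultimately show ?thesis using e(1) by simp
qed

section \<open>Doubly exponential lower bound\<close>

text \<open>The radius \<open>r\<close> is taken of order \<open>E\<^sup>-\<^sup>1\<^sup>/\<^sup>2\<close>, just large enough for the box eigenvalue to be at most \<open>E\<close>.\<close>
lemma double_exp_lower_bound:
  fixes q :: real and N :: "real \<Rightarrow> real"
  assumes m: "2 \<le> m" and q: "0 < q" "q < 1"
    and N: "\<And>r e. 1 \<le> r \<Longrightarrow> box_eig m r \<le> e \<Longrightarrow> 0 < e \<Longrightarrow> e < 3 * kdeg m \<Longrightarrow>
      q ^ card (lamp_box m r) / real (card (lamp_box m r)) \<le> N e"
  shows "\<exists>c1>0. \<exists>c2>0. \<forall>\<^sub>F e in at_right 0. exp (- c1 * exp (c2 * e powr (-1/2))) \<le> N e"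
proof -
  have m0: "0 < m" using m by simp
  \<comment> \<open>With \<open>K\<close> vertices in the box, \<open>ln (1 / q)\<close> pays for
    the probability \<open>q^K\<close> and the added 1 for the factor \<open>1 / K\<close>, since
    \<open>ln K \<le> K\<close>.\<close>
  define c1 where "c1 = ln (1 / q) + 1"
  \<comment> \<open>The box has at most \<open>(2r + 1) m^(2r) \<le> (3 m^2)^r = exp (a r)\<close>
    vertices.\<close>
  define a where "a = ln (3 * real m ^ 2)"
  \<comment> \<open>Rounding the radius up costs at most 1, and \<open>1 \<le> e powr (-1/2)\<close>
    for \<open>e < 1\<close>, so the radius is at most
    \<open>(pi * sqrt m + 1) * e powr (-1/2)\<close>.\<close>
  define c2 where "c2 = a * (pi * sqrt (real m) + 1)"
  have lnq: "0 < ln (1 / q)" using q by simp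
  hence c1: "0 < c1" by (simp add: c1_def)
  have "1 < 3 * real m ^ 2"
  proof -
    have "1 \<le> real m ^ 2" using m by (intro one_le_power) simp
    thus ?thesis by linarith
  qed
  hence a: "0 < a" unfolding a_def by (rule ln_gt_zero)
  hence c2: "0 < c2" unfolding c2_def by (intro mult_pos_pos add_nonneg_pos) auto
  have main: "exp (- c1 * exp (c2 * e powr (-1/2))) \<le> N e" if e: "0 < e" "e < 1" for e
  proof -
    define s where "s = e powr (-1/2)"
    have s: "s = 1 / sqrt e" unfolding s_def using e by (simp add: powr_minus_divide powr_half_sqrt)
    have s1: "1 \<le> s" unfolding s using e by simp
    \<comment> \<open>From \<open>box_eig m r \<le> m pi^2 / (2r + 1)^2\<close>, which is at most
      \<open>e\<close> as soon as \<open>r\<close> reaches \<open>pi * sqrt m * s\<close>.\<close>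
    define r where "r = nat \<lceil>pi * sqrt (real m) * s\<rceil>"
    have pos: "0 < pi * sqrt (real m) * s" using m0 s1 by simp
    have r1: "1 \<le> r" unfolding r_def using pos by linarith
    have rl: "pi * sqrt (real m) * s \<le> real r" unfolding r_def by linarith
    have "real r \<le> pi * sqrt (real m) * s + 1" unfolding r_def using pos by linarith
    also have "\<dots> \<le> pi * sqrt (real m) * s + s" using s1 by simp
    finally have ru: "a * real r \<le> c2 * s"
      unfolding c2_def using a by (simp add: distrib_right mult.assoc)
    have ee: "e < 3 * kdeg m" using e m by (simp add: kdeg_eq)
    have eig: "box_eig m r \<le> e"
    proof -
      have "(pi * sqrt (real m) * s)\<^sup>2 \<le> (2 * real r + 1)\<^sup>2"
        using rl pos by (intro power_mono) auto
      hence "pi\<^sup>2 * real m / e \<le> (2 * real r + 1)\<^sup>2"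
        using e by (simp add: s power_mult_distrib power_divide)
      hence "real m * (pi\<^sup>2 / (2 * real r + 1)\<^sup>2) \<le> e"
        using e by (simp add: field_simps)
      thus ?thesis using box_eig_bounds(2)[of m r] by (simp add: box_angle_def power_divide)
    qed
    let ?k = "real (card (lamp_box m r))"
    have k1: "1 \<le> ?k"
    proof -
      have "card (lamp_box m r) \<noteq> 0" using lamp_id_in_box[OF m0, of r] finite_card_box(1)[OF m0, of r] by auto
      thus ?thesis by linarith
    qed
    have "?k \<le> real ((2 * r + 1) * m ^ (2 * r))" using finite_card_box(2)[OF m0, of r] of_nat_le_iff by blast
    also have "\<dots> = (1 + real r * 2) * (real m ^ 2) ^ r" by (simp add: power_mult[symmetric]) (simp add: algebra_simps)
    also have "\<dots> \<le> 3 ^ r * (real m ^ 2) ^ r"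
      using Bernoulli_inequality[of "2::real" r] by (intro mult_right_mono) auto
    also have "\<dots> = exp (a * real r)"
      using m0 exp_of_nat_mult[of r a] by (simp add: a_def mult.commute power_mult_distrib)
    also have "\<dots> \<le> exp (c2 * s)" using ru by simp
    finally have ku: "?k \<le> exp (c2 * s)" .
    have "exp (- c1 * exp (c2 * s)) \<le> exp (- c1 * ?k)" using ku c1 by simp
    also have "\<dots> = exp (?k * ln q - ?k)"
      unfolding c1_def using q by (simp add: ln_div algebra_simps)
    also have "\<dots> \<le> exp (?k * ln q - ln ?k)" using ln_le_minus_one[of ?k] k1 by simp
    also have "\<dots> = q ^ card (lamp_box m r) / ?k" using q k1 by (simp add: exp_diff exp_of_nat_mult)
    also have "\<dots> \<le> N e" by (rule N[OF r1 eig e(1) ee])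
    finally show ?thesis by (simp add: s_def)
  qed
  have "\<forall>\<^sub>F e in at_right 0. exp (- c1 * exp (c2 * e powr (-1/2))) \<le> N e"
    using eventually_at_right_real[of 0 1] by (rule eventually_mono) (use main in auto)
  thus ?thesis using c1 c2 by blast
qed

lemma (in percolation) dos_lower_bound:
  assumes r: "1 \<le> r" and e: "box_eig m r \<le> e" "0 < e" "e < 3 * kdeg m"
    and p: "A \<in> sets M" "\<And>\<omega>. \<omega> \<in> A \<Longrightarrow> isolated m (lamp_box m r) (V \<omega>) (E \<omega>)" "P \<le> prob A"
  shows "P / real (card (lamp_box m r)) \<le> dos 1 e"
proof -
  let ?I = "\<lambda>\<omega>. if lamp_id \<in> V \<omega>
    then measure (spec_measure (lapT 1 m (V \<omega>) (E \<omega>)) lamp_id) {..e} else 0"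
  let ?k = "real (card (lamp_box m r))"
  have one: "(1::real) \<in> {0..1}" by simp
  have "P / ?k \<le> prob A / ?k" using p(3) by (simp add: divide_right_mono)
  also have "\<dots> = (\<integral>\<omega>. indicator A \<omega> * (1 / ?k) \<partial>M)" using p(1) by simp
  also have "\<dots> \<le> (\<integral>\<omega>. ?I \<omega> \<partial>M)"
  proof (rule integral_mono)
    show "integrable M (\<lambda>\<omega>. indicator A \<omega> * (1 / ?k))"
      using p(1) by (intro integrable_mult_left integrable_real_indicator) (simp_all add: less_top[symmetric])
    show "integrable M ?I" unfolding dos_integrand
      by (rule Bochner_Integration.integrable_diff[OF X_integrable[OF one e(2,3)] closed_integrable])
    fix \<omega>
    show "indicator A \<omega> * (1 / ?k) \<le> ?I \<omega>"
    proof (cases "\<omega> \<in> A")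
      case True
      have iso: "isolated m (lamp_box m r) (V \<omega>) (E \<omega>)" by (rule p(2)[OF True])
      hence "lamp_id \<in> V \<omega>" using lamp_id_in_box[OF m_pos] by (auto simp: isolated_def)
      thus ?thesis using lamp_subgraph.spec_measure_box[OF subgraph r iso e] True by simp
    qed simp
  qed
  finally show ?thesis by (simp add: dos_def)
qed

section \<open>Site and bond percolation\<close>

definition coins :: "'i set \<Rightarrow> real \<Rightarrow> ('i \<Rightarrow> bool) measure" where
  "coins I p = PiM I (\<lambda>_. measure_pmf (bernoulli_pmf p))"

lemma prob_space_coins: "prob_space (coins I p)"
  unfolding coins_def by (intro prob_space_PiM measure_pmf.prob_space_axioms)

lemma coin_sets: "i \<in> I \<Longrightarrow> {\<omega> \<in> space (coins I p). \<omega> i} \<in> sets (coins I p)"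
  unfolding coins_def by (rule sets_Collect_single') simp_all

lemma coins_reindex:
  assumes f: "bij_betw f I I"
  shows "(\<lambda>\<omega>. \<lambda>i\<in>I. \<omega> (f i)) \<in> measurable (coins I p) (coins I p)"
    and "distr (coins I p) (coins I p) (\<lambda>\<omega>. \<lambda>i\<in>I. \<omega> (f i)) = coins I p"
proof -
  have fI: "f i \<in> I" if "i \<in> I" for i using f that by (auto simp: bij_betw_def)
  show "(\<lambda>\<omega>. \<lambda>i\<in>I. \<omega> (f i)) \<in> measurable (coins I p) (coins I p)"
    unfolding coins_def by (intro measurable_restrict measurable_component_singleton fI)
  show "distr (coins I p) (coins I p) (\<lambda>\<omega>. \<lambda>i\<in>I. \<omega> (f i)) = coins I p"
    unfolding coins_def
    using distr_PiM_reindex[of I "\<lambda>_. measure_pmf (bernoulli_pmf p)" f I] f fI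
    by (auto simp: bij_betw_def measure_pmf.prob_space_axioms)
qed

text \<open>Each prescribed coin contributes a factor \<open>p\<close> or \<open>1 - p\<close>;
  bounding by the smaller one gives an estimate that does not depend on the pattern
  \<open>b\<close>.\<close>

lemma coins_cylinder:
  assumes p: "0 < p" "p < 1" and J: "finite J" "J \<subseteq> I"
  shows "{\<omega> \<in> space (coins I p). \<forall>i\<in>J. \<omega> i = b i} \<in> sets (coins I p)"
    and "min p (1 - p) ^ card J \<le> measure (coins I p) {\<omega> \<in> space (coins I p). \<forall>i\<in>J. \<omega> i = b i}"
proof -
  interpret product_prob_space "\<lambda>_::'a. measure_pmf (bernoulli_pmf p)" I
    by unfold_locales
  have c: "coins I p = PiM I (\<lambda>_. measure_pmf (bernoulli_pmf p))" by (simp add: coins_def)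
  have cyl: "{\<omega> \<in> space (coins I p). \<forall>i\<in>J. \<omega> i = b i} = emb I J (Pi\<^sub>E J (\<lambda>i. {b i}))"
    unfolding c prod_emb_def using J by (auto simp: space_PiM Pi_iff)
  show "{\<omega> \<in> space (coins I p). \<forall>i\<in>J. \<omega> i = b i} \<in> sets (coins I p)"
    unfolding cyl unfolding c using J by (intro sets_PiM_I) auto
  have "measure (coins I p) {\<omega> \<in> space (coins I p). \<forall>i\<in>J. \<omega> i = b i}
      = (\<Prod>i\<in>J. measure (measure_pmf (bernoulli_pmf p)) {b i})"
    unfolding cyl unfolding c using J by (intro measure_PiM_emb) auto
  also have "\<dots> = (\<Prod>i\<in>J. pmf (bernoulli_pmf p) (b i))" by (simp add: measure_pmf_single)
  also have "\<dots> \<ge> (\<Prod>i\<in>J. min p (1 - p))"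
  proof (rule prod_mono)
    fix i show "0 \<le> min p (1 - p) \<and> min p (1 - p) \<le> pmf (bernoulli_pmf p) (b i)"
      using p by (cases "b i") auto
  qed
  finally show "min p (1 - p) ^ card J \<le> measure (coins I p) {\<omega> \<in> space (coins I p). \<forall>i\<in>J. \<omega> i = b i}"
    by simp
qed

section \<open>Translations acting on vertices and edges\<close>

lemma lamp_mult_bij:
  assumes m: "0 < m" and g: "g \<in> lamp_verts m"
  shows "bij_betw (lamp_mult m g) (lamp_verts m) (lamp_verts m)"
    and "inv\<^bsub>lamp_group m\<^esub> g \<in> lamp_verts m"
    and "h \<in> lamp_verts m \<Longrightarrow> lamp_mult m (inv\<^bsub>lamp_group m\<^esub> g) (lamp_mult m g h) = h"
    and "h \<in> lamp_verts m \<Longrightarrow> lamp_mult m g (lamp_mult m (inv\<^bsub>lamp_group m\<^esub> g) h) = h"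
proof -
  interpret group "lamp_group m" by (rule group_lamp_group[OF m])
  show inv: "inv\<^bsub>lamp_group m\<^esub> g \<in> lamp_verts m" using inv_closed[of g] g by simp
  show 1: "lamp_mult m (inv\<^bsub>lamp_group m\<^esub> g) (lamp_mult m g h) = h" if "h \<in> lamp_verts m" for h
    using that g inv m_assoc[of "inv\<^bsub>lamp_group m\<^esub> g" g h] l_inv[of g] l_one[of h] by simp
  show 2: "lamp_mult m g (lamp_mult m (inv\<^bsub>lamp_group m\<^esub> g) h) = h" if "h \<in> lamp_verts m" for h
    using that g inv m_assoc[of g "inv\<^bsub>lamp_group m\<^esub> g" h] r_inv[of g] l_one[of h] by simp
  show "bij_betw (lamp_mult m g) (lamp_verts m) (lamp_verts m)"
    by (rule bij_betw_byWitness[of _ "lamp_mult m (inv\<^bsub>lamp_group m\<^esub> g)"])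
       (use 1 2 lamp_mult_in_verts[OF m g] lamp_mult_in_verts[OF m inv] in blast)+
qed

lemma cay_edges_translate:
  assumes m: "0 < m" and g: "g \<in> lamp_verts m" and e: "e \<in> cay_edges m"
  shows "lamp_mult m g ` e \<in> cay_edges m"
proof -
  interpret group "lamp_group m" by (rule group_lamp_group[OF m])
  obtain h s where hs: "e = {h, lamp_mult m h s}" "h \<in> lamp_verts m" "s \<in> S0 m"
    using e by (auto simp: cay_edges_def)
  have "lamp_mult m g (lamp_mult m h s) = lamp_mult m (lamp_mult m g h) s"
    using m_assoc[of g h s] g hs S0_subset[OF m] by auto
  hence "lamp_mult m g ` e = {lamp_mult m g h, lamp_mult m (lamp_mult m g h) s}"
    by (simp add: hs(1))
  moreover have "lamp_mult m g h \<in> lamp_verts m" by (rule lamp_mult_in_verts[OF m g hs(2)])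
  ultimately show ?thesis using hs(3) unfolding cay_edges_def by blast
qed

lemma cay_edges_subset: "0 < m \<Longrightarrow> e \<in> cay_edges m \<Longrightarrow> e \<subseteq> lamp_verts m"
  using lamp_mult_in_verts[of m] S0_subset[of m] by (auto simp: cay_edges_def)

lemma cay_edges_bij:
  assumes m: "0 < m" and g: "g \<in> lamp_verts m"
  shows "bij_betw (image (lamp_mult m g)) (cay_edges m) (cay_edges m)"
proof (rule bij_betw_byWitness[of _ "image (lamp_mult m (inv\<^bsub>lamp_group m\<^esub> g))"])
  note bij = lamp_mult_bij[OF m g]
  have id: "(\<lambda>x. f (f' x)) ` e = e" if "\<And>x. x \<in> lamp_verts m \<Longrightarrow> f (f' x) = x" "e \<in> cay_edges m" for f f' e
    using that cay_edges_subset[OF m that(2)] by (force simp: image_def subset_iff)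
  show "\<forall>e\<in>cay_edges m. lamp_mult m (inv\<^bsub>lamp_group m\<^esub> g) ` lamp_mult m g ` e = e"
    unfolding image_image using id bij(3) by blast
  show "\<forall>e\<in>cay_edges m. lamp_mult m g ` lamp_mult m (inv\<^bsub>lamp_group m\<^esub> g) ` e = e"
    unfolding image_image using id bij(4) by blast
qed (use cay_edges_translate[OF m] g lamp_mult_bij(2)[OF m g] in blast)+

lemma card_star_le:
  assumes K: "finite K"
  shows "finite (\<Union>x\<in>K. nbrs m x)" "card (\<Union>x\<in>K. nbrs m x) \<le> 2 * m * card K"
    "finite (\<Union>x\<in>K. (\<lambda>y. {x, y}) ` nbrs m x)" "card (\<Union>x\<in>K. (\<lambda>y. {x, y}) ` nbrs m x) \<le> 2 * m * card K"
proof -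
  show "finite (\<Union>x\<in>K. nbrs m x)" "finite (\<Union>x\<in>K. (\<lambda>y. {x, y}) ` nbrs m x)" using K by auto
  have "card (\<Union>x\<in>K. nbrs m x) \<le> (\<Sum>x\<in>K. card (nbrs m x))" by (rule card_UN_le[OF K])
  thus "card (\<Union>x\<in>K. nbrs m x) \<le> 2 * m * card K" by (simp add: card_nbrs mult.commute)
  have "card (\<Union>x\<in>K. (\<lambda>y. {x, y}) ` nbrs m x) \<le> (\<Sum>x\<in>K. card ((\<lambda>y. {x, y}) ` nbrs m x))"
    by (rule card_UN_le[OF K])
  also have "\<dots> \<le> (\<Sum>x\<in>K. card (nbrs m x))" by (intro sum_mono card_image_le) simp
  finally show "card (\<Union>x\<in>K. (\<lambda>y. {x, y}) ` nbrs m x) \<le> 2 * m * card K"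
    by (simp add: card_nbrs mult.commute)
qed

text \<open>The configuration is pulled back along the inverse, so that the graph of the shifted
  configuration is the translate by \<open>g\<close> of the original graph. The restricted
  abstraction keeps the result in the extensional functions underlying \<open>PiM\<close>.\<close>

definition site_shift :: "nat \<Rightarrow> lamp \<Rightarrow> (lamp \<Rightarrow> bool) \<Rightarrow> lamp \<Rightarrow> bool" where
  "site_shift m g \<omega> = (\<lambda>x\<in>lamp_verts m. \<omega> (lamp_mult m (inv\<^bsub>lamp_group m\<^esub> g) x))"

definition bond_shift :: "nat \<Rightarrow> lamp \<Rightarrow> (lamp set \<Rightarrow> bool) \<Rightarrow> lamp set \<Rightarrow> bool" where
  "bond_shift m g \<omega> = (\<lambda>e\<in>cay_edges m. \<omega> (lamp_mult m (inv\<^bsub>lamp_group m\<^esub> g) ` e))"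

lemma site_meas_eq: "site_meas m p = coins (lamp_verts m) p"
  by (simp add: site_meas_def coins_def)

lemma bond_meas_eq: "bond_meas m p = coins (cay_edges m) p"
  by (simp add: bond_meas_def coins_def)

lemma cay_edge_translate_iff:
  assumes m: "0 < m" and g: "g \<in> lamp_verts m" and x: "x \<in> lamp_verts m" "y \<in> lamp_verts m"
  shows "{lamp_mult m g x, lamp_mult m g y} \<in> cay_edges m \<longleftrightarrow> {x, y} \<in> cay_edges m"
proof
  assume "{lamp_mult m g x, lamp_mult m g y} \<in> cay_edges m"
  from cay_edges_translate[OF m lamp_mult_bij(2)[OF m g] this]
  show "{x, y} \<in> cay_edges m" using lamp_mult_bij(3)[OF m g] x by simp
next
  assume "{x, y} \<in> cay_edges m"
  from cay_edges_translate[OF m g this]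
  show "{lamp_mult m g x, lamp_mult m g y} \<in> cay_edges m" by simp
qed

lemma site_percolation:
  assumes m: "2 \<le> m"
  shows "percolation (site_meas m p) m (\<lambda>\<omega>. fst (site_graph m \<omega>)) (\<lambda>\<omega>. snd (site_graph m \<omega>)) (site_shift m)"
proof -
  have m0: "0 < m" using m by simp
  interpret prob_space "site_meas m p" unfolding site_meas_eq by (rule prob_space_coins)
  show ?thesis
  proof
    show "2 \<le> m" by (rule m)
    show "fst (site_graph m \<omega>) \<subseteq> lamp_verts m" "snd (site_graph m \<omega>) \<subseteq> cay_edges m" for \<omega>
      by (auto simp: site_graph_def)
    show "{\<omega> \<in> space (site_meas m p). x \<in> fst (site_graph m \<omega>)} \<in> events" if "x \<in> lamp_verts m" for x
      using coin_sets[OF that, of p] that by (simp add: site_meas_eq site_graph_def)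
    show "{\<omega> \<in> space (site_meas m p). e \<in> snd (site_graph m \<omega>)} \<in> events" if e: "e \<in> cay_edges m" for e
    proof -
      have "finite e" using e by (auto simp: cay_edges_def)
      have "{\<omega> \<in> space (site_meas m p). \<forall>x\<in>e. \<omega> x} \<in> events"
        using coin_sets[of _ "lamp_verts m" p] cay_edges_subset[OF m0 e] \<open>finite e\<close>
        by (intro sets.sets_Collect_finite_All) (auto simp: site_meas_eq)
      thus ?thesis using e by (simp add: site_graph_def)
    qed
    fix g assume g: "g \<in> lamp_verts m"
    note bij = lamp_mult_bij[OF m0 g]
    note gi = lamp_mult_bij(1)[OF m0 bij(2)]
    show "site_shift m g \<in> site_meas m p \<rightarrow>\<^sub>M site_meas m p"
      unfolding site_meas_eq site_shift_def[abs_def] by (rule coins_reindex(1)[OF gi])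
    show "distr (site_meas m p) (site_meas m p) (site_shift m g) = site_meas m p"
      unfolding site_meas_eq site_shift_def[abs_def] by (rule coins_reindex(2)[OF gi])
    have sh: "site_shift m g \<omega> (lamp_mult m g x) = \<omega> x" if "x \<in> lamp_verts m" for x \<omega>
      using that by (simp add: site_shift_def lamp_mult_in_verts[OF m0 g] bij(3))
    show "lamp_mult m g x \<in> fst (site_graph m (site_shift m g \<omega>)) \<longleftrightarrow> x \<in> fst (site_graph m \<omega>)"
      if "x \<in> lamp_verts m" for x \<omega>
      using that by (simp add: site_graph_def sh lamp_mult_in_verts[OF m0 g])
    show "{lamp_mult m g x, lamp_mult m g y} \<in> snd (site_graph m (site_shift m g \<omega>))
        \<longleftrightarrow> {x, y} \<in> snd (site_graph m \<omega>)"
      if "x \<in> lamp_verts m" "y \<in> lamp_verts m" for x y \<omega>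
      using that by (simp add: site_graph_def sh cay_edge_translate_iff[OF m0 g])
  qed
qed

lemma bond_percolation:
  assumes m: "2 \<le> m"
  shows "percolation (bond_meas m p) m (\<lambda>\<omega>. fst (bond_graph m \<omega>)) (\<lambda>\<omega>. snd (bond_graph m \<omega>)) (bond_shift m)"
proof -
  have m0: "0 < m" using m by simp
  interpret prob_space "bond_meas m p" unfolding bond_meas_eq by (rule prob_space_coins)
  \<comment> \<open>Vertices of the bond graph are endpoints of open edges. Rewriting this over the
    finite set of neighbours yields measurability and equivariance.\<close>
  have Vx: "x \<in> fst (bond_graph m \<omega>) \<longleftrightarrow> x \<in> lamp_verts m \<and> (\<exists>y\<in>nbrs m x. \<omega> {x, y})" for x \<omega>
  proof
    assume "x \<in> fst (bond_graph m \<omega>)"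
    then obtain e where e: "e \<in> cay_edges m" "\<omega> e" "x \<in> e" by (auto simp: bond_graph_def)
    obtain a b where "e = {a, b}" using e(1) unfolding cay_edges_def by blast
    hence "e = {x, a} \<or> e = {x, b}" using e(3) by auto
    then obtain y where "e = {x, y}" by blast
    thus "x \<in> lamp_verts m \<and> (\<exists>y\<in>nbrs m x. \<omega> {x, y})" using e cay_edges_iff[OF m0] by auto
  next
    assume "x \<in> lamp_verts m \<and> (\<exists>y\<in>nbrs m x. \<omega> {x, y})"
    then obtain y where "{x, y} \<in> cay_edges m" "\<omega> {x, y}" using cay_edges_iff[OF m0] by blast
    thus "x \<in> fst (bond_graph m \<omega>)" unfolding bond_graph_def by auto
  qed
  have nbrs_translate: "nbrs m (lamp_mult m g x) = lamp_mult m g ` nbrs m x"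
    if g: "g \<in> lamp_verts m" and x: "x \<in> lamp_verts m" for g x
  proof -
    interpret group "lamp_group m" by (rule group_lamp_group[OF m0])
    have "lamp_mult m (lamp_mult m g x) s = lamp_mult m g (lamp_mult m x s)" if "s \<in> S0 m" for s
      using m_assoc[of g x s] g x S0_subset[OF m0] that by auto
    thus ?thesis
      unfolding lamp_mult_S0[OF m0 x, symmetric] lamp_mult_S0[OF m0 lamp_mult_in_verts[OF m0 g x], symmetric] image_image
      by (rule image_cong[OF refl])
  qed
  show ?thesis
  proof
    show "2 \<le> m" by (rule m)
    show "fst (bond_graph m \<omega>) \<subseteq> lamp_verts m" "snd (bond_graph m \<omega>) \<subseteq> cay_edges m" for \<omega>
      using Vx by (blast, simp add: bond_graph_def)
    show "{\<omega> \<in> space (bond_meas m p). x \<in> fst (bond_graph m \<omega>)} \<in> events" if x: "x \<in> lamp_verts m" for x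
    proof -
      have "{\<omega> \<in> space (bond_meas m p). \<exists>y\<in>nbrs m x. \<omega> {x, y}} \<in> events"
        using coin_sets[of _ "cay_edges m" p] cay_edges_iff[OF m0, of x] x
        by (intro sets.sets_Collect_finite_Ex) (simp_all add: bond_meas_eq)
      thus ?thesis using x by (simp add: Vx)
    qed
    show "{\<omega> \<in> space (bond_meas m p). e \<in> snd (bond_graph m \<omega>)} \<in> events" if e: "e \<in> cay_edges m" for e
      using coin_sets[OF e, of p] e by (simp add: bond_meas_eq bond_graph_def)
    fix g assume g: "g \<in> lamp_verts m"
    note bij = lamp_mult_bij[OF m0 g]
    note gi = cay_edges_bij[OF m0 bij(2)]
    show "bond_shift m g \<in> bond_meas m p \<rightarrow>\<^sub>M bond_meas m p"
      unfolding bond_meas_eq bond_shift_def[abs_def] by (rule coins_reindex(1)[OF gi])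
    show "distr (bond_meas m p) (bond_meas m p) (bond_shift m g) = bond_meas m p"
      unfolding bond_meas_eq bond_shift_def[abs_def] by (rule coins_reindex(2)[OF gi])
    have sh: "bond_shift m g \<omega> {lamp_mult m g x, lamp_mult m g y} = \<omega> {x, y}"
      if "{x, y} \<in> cay_edges m" for x y \<omega>
      using that cay_edges_subset[OF m0 that] cay_edge_translate_iff[OF m0 g, of x y]
      by (simp add: bond_shift_def bij(3))
    show "{lamp_mult m g x, lamp_mult m g y} \<in> snd (bond_graph m (bond_shift m g \<omega>))
        \<longleftrightarrow> {x, y} \<in> snd (bond_graph m \<omega>)"
      if "x \<in> lamp_verts m" "y \<in> lamp_verts m" for x y \<omega>
      using that sh[of x y] by (auto simp: bond_graph_def cay_edge_translate_iff[OF m0 g])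
    show "lamp_mult m g x \<in> fst (bond_graph m (bond_shift m g \<omega>)) \<longleftrightarrow> x \<in> fst (bond_graph m \<omega>)"
      if x: "x \<in> lamp_verts m" for x \<omega>
    proof -
      have "bond_shift m g \<omega> {lamp_mult m g x, lamp_mult m g y} = \<omega> {x, y}" if "y \<in> nbrs m x" for y
        using sh[of x y] cay_edges_iff[OF m0, of x y] x that by blast
      thus ?thesis using x unfolding Vx nbrs_translate[OF g x]
        by (simp add: lamp_mult_in_verts[OF m0 g])
    qed
  qed
qed

section \<open>Probability of an isolated box\<close>

lemma site_isolated:
  assumes m: "2 \<le> m" and p: "0 < p" "p < 1" and r: "1 \<le> r"
  obtains A where "A \<in> sets (site_meas m p)"
    "\<And>\<omega>. \<omega> \<in> A \<Longrightarrow> isolated m (lamp_box m r) (fst (site_graph m \<omega>)) (snd (site_graph m \<omega>))"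
    "(min p (1 - p) ^ (2 * m + 1)) ^ card (lamp_box m r) \<le> measure (site_meas m p) A"
proof
  have m0: "0 < m" using m by simp
  let ?K = "lamp_box m r"
  let ?J = "?K \<union> (\<Union>x\<in>?K. nbrs m x)"
  \<comment> \<open>Sites of the box are open, their neighbours outside it are closed.\<close>
  let ?A = "{\<omega> \<in> space (coins (lamp_verts m) p). \<forall>x\<in>?J. \<omega> x = (x \<in> ?K)}"
  have K: "finite ?K" by (rule finite_card_box[OF m0])
  have J: "finite ?J" "?J \<subseteq> lamp_verts m"
    using K card_star_le(1)[OF K] box_subset[of m r] nbrs_in_verts[OF m0] by blast+
  note cyl = coins_cylinder[OF p J, of "\<lambda>x. x \<in> ?K"]
  show "?A \<in> sets (site_meas m p)" unfolding site_meas_eq by (rule cyl(1))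
  show "isolated m ?K (fst (site_graph m \<omega>)) (snd (site_graph m \<omega>))" if \<omega>: "\<omega> \<in> ?A" for \<omega>
    unfolding isolated_def
  proof (intro conjI ballI)
    have op: "\<omega> x = (x \<in> ?K)" if "x \<in> ?J" for x using \<omega> that by blast
    show "?K \<subseteq> fst (site_graph m \<omega>)" using op box_subset[of m r] by (auto simp: site_graph_def)
    fix x y assume x: "x \<in> ?K" and y: "y \<in> nbrs m x"
    have "{x, y} \<in> cay_edges m" using cay_edges_iff[OF m0] box_subset[of m r] x y by blast
    moreover have "\<omega> x" "\<omega> y = (y \<in> ?K)" using op[of x] op[of y] x y by blast+
    ultimately show "{x, y} \<in> snd (site_graph m \<omega>) \<longleftrightarrow> y \<in> ?K" by (simp add: site_graph_def)
  qed
  \<comment> \<open>The exponent \<open>2 * m + 1\<close> counts each vertex of the box together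
    with its at most \<open>2m\<close> neighbours.\<close>
  have "card ?J \<le> (2 * m + 1) * card ?K"
    using card_Un_le[of ?K "\<Union>x\<in>?K. nbrs m x"] card_star_le(2)[OF K, of m] by simp
  hence "min p (1 - p) ^ ((2 * m + 1) * card ?K) \<le> min p (1 - p) ^ card ?J"
    using p by (intro power_decreasing) auto
  thus "(min p (1 - p) ^ (2 * m + 1)) ^ card ?K \<le> measure (site_meas m p) ?A"
    using cyl(2) unfolding site_meas_eq power_mult by linarith
qed

lemma bond_isolated:
  assumes m: "2 \<le> m" and p: "0 < p" "p < 1" and r: "1 \<le> r"
  obtains A where "A \<in> sets (bond_meas m p)"
    "\<And>\<omega>. \<omega> \<in> A \<Longrightarrow> isolated m (lamp_box m r) (fst (bond_graph m \<omega>)) (snd (bond_graph m \<omega>))"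
    "(min p (1 - p) ^ (2 * m + 1)) ^ card (lamp_box m r) \<le> measure (bond_meas m p) A"
proof
  have m0: "0 < m" using m by simp
  let ?K = "lamp_box m r"
  let ?J = "\<Union>x\<in>?K. (\<lambda>y. {x, y}) ` nbrs m x"
  \<comment> \<open>Among the edges meeting the box, those inside are open and those leaving it are
    closed.\<close>
  let ?A = "{\<omega> \<in> space (coins (cay_edges m) p). \<forall>e\<in>?J. \<omega> e = (e \<subseteq> ?K)}"
  have K: "finite ?K" by (rule finite_card_box[OF m0])
  have J: "finite ?J" "?J \<subseteq> cay_edges m"
    using card_star_le(3)[OF K] box_subset[of m r] cay_edges_iff[OF m0] by blast+
  note cyl = coins_cylinder[OF p J, of "\<lambda>e. e \<subseteq> ?K"]
  show "?A \<in> sets (bond_meas m p)" unfolding bond_meas_eq by (rule cyl(1))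
  show "isolated m ?K (fst (bond_graph m \<omega>)) (snd (bond_graph m \<omega>))" if \<omega>: "\<omega> \<in> ?A" for \<omega>
    unfolding isolated_def
  proof (intro conjI ballI subsetI)
    have op: "\<omega> {x, y} = (y \<in> ?K)" if "x \<in> ?K" "y \<in> nbrs m x" for x y
    proof -
      have "{x, y} \<in> ?J" using that by blast
      hence "\<omega> {x, y} = ({x, y} \<subseteq> ?K)" using \<omega> by blast
      thus ?thesis using that by simp
    qed
    have edge: "{x, y} \<in> cay_edges m" if "x \<in> ?K" "y \<in> nbrs m x" for x y
      using cay_edges_iff[OF m0] box_subset[of m r] that by blast
    show "{x, y} \<in> snd (bond_graph m \<omega>) \<longleftrightarrow> y \<in> ?K" if "x \<in> ?K" "y \<in> nbrs m x" for x y
      using op[OF that] edge[OF that] by (simp add: bond_graph_def)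
    fix x assume x: "x \<in> ?K"
    then obtain y where "y \<in> ?K" "y \<in> nbrs m x" using box_nbr_exists[OF m0 r] by blast
    hence "{x, y} \<in> {e \<in> cay_edges m. \<omega> e}" using op[OF x] edge[OF x] by blast
    thus "x \<in> fst (bond_graph m \<omega>)" unfolding bond_graph_def by auto
  qed
  \<comment> \<open>At most \<open>2m\<close> edges per vertex of the box are prescribed; the
    exponent is kept equal to that of the site model.\<close>
  have "card ?J \<le> (2 * m + 1) * card ?K" using card_star_le(4)[OF K, of m] by simp
  hence "min p (1 - p) ^ ((2 * m + 1) * card ?K) \<le> min p (1 - p) ^ card ?J"
    using p by (intro power_decreasing) auto
  thus "(min p (1 - p) ^ (2 * m + 1)) ^ card ?K \<le> measure (bond_meas m p) ?A"
    using cyl(2) unfolding bond_meas_eq power_mult by linarith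
qed

lemma (in percolation) dos_asymptotics:
  assumes q: "0 < q" "q < 1"
    and iso: "\<And>r. 1 \<le> r \<Longrightarrow> \<exists>A\<in>sets M. (\<forall>\<omega>\<in>A. isolated m (lamp_box m r) (V \<omega>) (E \<omega>)) \<and>
      q ^ card (lamp_box m r) \<le> prob A"
  shows "\<exists>c1>0. \<exists>c2>0. \<forall>\<^sub>F e in at_right 0.
    exp (- c1 * exp (c2 * e powr (-1/2))) \<le> dos 1 e \<and> dos 1 e \<le> dos 0 e"
proof -
  have "\<exists>c1>0. \<exists>c2>0. \<forall>\<^sub>F e in at_right 0. exp (- c1 * exp (c2 * e powr (-1/2))) \<le> dos 1 e"
  proof (rule double_exp_lower_bound[OF m q])
    fix r e assume r: "1 \<le> r" and e: "box_eig m r \<le> e" "0 < e" "e < 3 * kdeg m"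
    obtain A where "A \<in> sets M" "\<And>\<omega>. \<omega> \<in> A \<Longrightarrow> isolated m (lamp_box m r) (V \<omega>) (E \<omega>)"
      "q ^ card (lamp_box m r) \<le> prob A"
      using iso[OF r] by blast
    thus "q ^ card (lamp_box m r) / real (card (lamp_box m r)) \<le> dos 1 e"
      by (rule dos_lower_bound[OF r e])
  qed
  moreover have "\<forall>\<^sub>F e in at_right 0. dos 1 e \<le> dos 0 e"
    using eventually_at_right_real[OF R_pos] by (rule eventually_mono) (use dos_mono in auto)
  ultimately show ?thesis using eventually_conj by blast
qed

theorem theorem3p9:
  fixes m :: nat and p :: real
  assumes "m \<ge> 2" and "0 < p" and "p < 1"
  shows "(\<exists>c1>0. \<exists>c2>0. \<forall>\<^sub>F E in at_right (0::real).
            exp (- c1 * exp (c2 * E powr (-1/2))) \<le> dos_site lapD m p E \<and>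
            dos_site lapD m p E \<le> dos_site lapA m p E)
       \<and> (\<exists>c1>0. \<exists>c2>0. \<forall>\<^sub>F E in at_right (0::real).
            exp (- c1 * exp (c2 * E powr (-1/2))) \<le> dos_bond lapD m p E \<and>
            dos_bond lapD m p E \<le> dos_bond lapA m p E)"
proof -
  \<comment> \<open>One base for both models: \<open>2m + 1\<close> prescribed coins per vertex
    isolate the box, each costing at most a factor \<open>min p (1 - p)\<close>.\<close>
  define q where "q = min p (1 - p) ^ (2 * m + 1)"
  have q: "0 < q" "q < 1"
    using assms power_Suc_less_one[of "min p (1 - p)" "2 * m"] by (simp_all add: q_def)
  interpret site: percolation "site_meas m p" m "\<lambda>\<omega>. fst (site_graph m \<omega>)" "\<lambda>\<omega>. snd (site_graph m \<omega>)" "site_shift m"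
    by (rule site_percolation[OF assms(1)])
  interpret bond: percolation "bond_meas m p" m "\<lambda>\<omega>. fst (bond_graph m \<omega>)" "\<lambda>\<omega>. snd (bond_graph m \<omega>)" "bond_shift m"
    by (rule bond_percolation[OF assms(1)])
  have "dos_site lapD m p = site.dos 1" "dos_site lapA m p = site.dos 0"
    "dos_bond lapD m p = bond.dos 1" "dos_bond lapA m p = bond.dos 0"
    by (rule ext, simp only: dos_site_def dos_bond_def site.dos_def bond.dos_def spec_at_id_def
        lapA_eq lapD_eq)+
  moreover have "\<exists>c1>0. \<exists>c2>0. \<forall>\<^sub>F e in at_right 0.
    exp (- c1 * exp (c2 * e powr (-1/2))) \<le> site.dos 1 e \<and> site.dos 1 e \<le> site.dos 0 e"
  proof (rule site.dos_asymptotics[OF q])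
    fix r :: nat assume "1 \<le> r"
    from site_isolated[OF assms this] obtain A where A: "A \<in> site.events"
      "\<And>\<omega>. \<omega> \<in> A \<Longrightarrow> isolated m (lamp_box m r) (fst (site_graph m \<omega>)) (snd (site_graph m \<omega>))"
      "q ^ card (lamp_box m r) \<le> site.prob A"
      unfolding q_def by blast
    thus "\<exists>A\<in>site.events. (\<forall>\<omega>\<in>A. isolated m (lamp_box m r) (fst (site_graph m \<omega>)) (snd (site_graph m \<omega>))) \<and>
        q ^ card (lamp_box m r) \<le> site.prob A" by blast
  qed
  moreover have "\<exists>c1>0. \<exists>c2>0. \<forall>\<^sub>F e in at_right 0.
    exp (- c1 * exp (c2 * e powr (-1/2))) \<le> bond.dos 1 e \<and> bond.dos 1 e \<le> bond.dos 0 e"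
  proof (rule bond.dos_asymptotics[OF q])
    fix r :: nat assume "1 \<le> r"
    from bond_isolated[OF assms this] obtain A where A: "A \<in> bond.events"
      "\<And>\<omega>. \<omega> \<in> A \<Longrightarrow> isolated m (lamp_box m r) (fst (bond_graph m \<omega>)) (snd (bond_graph m \<omega>))"
      "q ^ card (lamp_box m r) \<le> bond.prob A"
      unfolding q_def by blast
    thus "\<exists>A\<in>bond.events. (\<forall>\<omega>\<in>A. isolated m (lamp_box m r) (fst (bond_graph m \<omega>)) (snd (bond_graph m \<omega>))) \<and>
        q ^ card (lamp_box m r) \<le> bond.prob A" by blast
  qed
  ultimately show ?thesis by simp
qed

end
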